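(* Let $F$ be a clause-set with all clauses of length $1$ or $2$, let $\{x\}\in F$, and let $L$ be a linear order on the literals of $F$. In the procedure $\mathrm{enum}(F,\{x\},L)$, the enumeration of the paths $P\in\mathfrak U_x(\mathrm{idg}(F))$, in $L$-pathlex order, as delivered to the calls OUTPUT$(P)$, uses time $O(n(F)\,\ell(F))$ for finding the first such path and for finding each subsequent one, while finally determining that there are no further paths takes time $O(\ell(F))$; the space usage is $O(\ell(F))$. For the resulting enumeration of the elements $F'\in\mathrm{mus}_{\{x\}}(F)$ in $L$-pathlex order, each $F'$ has one or two corresponding paths $P$ with output $F'$, where only the first is printed and the second ignored; and given that $m\in\mathbb N_0$ elements $F'$ have been printed so far, finding the next one (or determining there is none) takes time $O((m+1)\,n(F)\,\ell(F))$.
   Context: Literals are variables and complements; clauses are finite sets of literals without complementary pair; clause-sets are finite sets of clauses; minimally unsatisfiable = unsatisfiable but removing any clause makes it satisfiable; $\mathrm{mus}_{\{x\}}(F)$ = minimally unsatisfiable subsets of $F$ containing $\{x\}$. $n(F)$ = number of variables, $\ell(F)=\sum_{C\in F}|C|$. The implication digraph $G=\mathrm{idg}(F)$ has vertex set all literals whose variable occurs in $F$; binary clause $\{a,b\}$ yields arcs $(\overline a,b),(\overline b,a)$; unit-clause $\{a\}$ yields arc $(\overline a,a)$, arcs of form $(a,\overline a)$ are units. $\mathcal{CL}(A)=\{\{\overline a,b\}:(a,b)\in A\}$. Paths have distinct vertices; regular = no complementary pair among vertices; nearly regular = exactly one complementary pair and regular after removing the last vertex; $\mathfrak U_z(G)$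 = nearly regular paths starting at $z$; $F(P)=\mathcal{CL}(E(P))\cup\{\{z\}\}$. Regular decomposition $P=P_0;P_1$ of nearly regular $P$ with last vertex $w$: split at vertex $\overline w$. Contraposition $\overline Q$: replace arcs $(a,b)$ by $(\overline b,\overline a)$ in reversed order. $L$-pathlex order: paths compared lexicographically as words of literals ordered by $L$; for a minimally unsatisfiable subset $F'$ with a unit-clause, $x(F')$ is the $L$-smallest $z$ with $\{z\}\in F'$, $P(F')$ the lexicographically smaller path $P\in\mathfrak U_{x(F')}(G)$ with $F(P)=F'$, and $F'<_LF''$ iff $P(F')<_LP(F'')$. Procedure $\mathrm{enum}(F,\{x\},L)$: if $\overline x$ is reachable from $x$ in $G$, call DFS with empty path and vertex $x$. DFS$(P,y)$: append $y$ to $P$; if $V(P)$ contains a complementary pair call OUTPUT$(P)$; otherwise compute (by one BFS) the set $R$ of out-neighbours $z$ of $y$ in $G-V(P)$ from which $\overline x$ is reachable in $G-V(P)$, and for each $z\in R$ in order $L$ call DFS$(P,z)$. OUTPUT$(P)$: if the last arc of $P$ is a unit, print $F(P)$; otherwise with $P=P_0;P_1$ and $P'=P_0;\overline{P_1}$, print $F(P)$ only if $P<_LP'$.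
   Formalization: The printed F' are ordered by their first paths starting at x, since with x(F') the L-smallest unit of F' the claimed L-pathlex order fails (e.g. {x},{y1},{y2},{¬x,¬y1},{¬x,¬y2}); the literal order is asserted among those F' with x(F') = x. *)

theory Defs
  imports Main
begin

section \<open>Clause-sets and minimal unsatisfiability\<close>

datatype 'v literal = Pos 'v | Neg 'v

primrec lneg :: "'v literal \<Rightarrow> 'v literal" where
  "lneg (Pos v) = Neg v"
| "lneg (Neg v) = Pos v"

primrec lvar :: "'v literal \<Rightarrow> 'v" where
  "lvar (Pos v) = v"
| "lvar (Neg v) = v"

type_synonym 'v clause = "'v literal set"
type_synonym 'v clauses = "'v clause set"

definition is_clause :: "'v clause \<Rightarrow> bool" where
  "is_clause C \<longleftrightarrow> finite C \<and> (\<forall>a\<in>C. lneg a \<notin> C)"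

definition is_clause_set :: "'v clauses \<Rightarrow> bool" where
  "is_clause_set F \<longleftrightarrow> finite F \<and> (\<forall>C\<in>F. is_clause C)"

definition vars :: "'v clauses \<Rightarrow> 'v set" where
  "vars F = lvar ` \<Union>F"

text \<open>All literals over the variables of \<open>F\<close>, whether or not they occur themselves: the vertices
  of the implication digraph.\<close>
definition lits :: "'v clauses \<Rightarrow> 'v literal set" where
  "lits F = {a. lvar a \<in> vars F}"

definition nvars :: "'v clauses \<Rightarrow> nat" where
  "nvars F = card (vars F)"

definition nocc :: "'v clauses \<Rightarrow> nat" where
  "nocc F = (\<Sum>C\<in>F. card C)"

primrec holds :: "('v \<Rightarrow> bool) \<Rightarrow> 'v literal \<Rightarrow> bool" where
  "holds \<phi> (Pos v) = \<phi> v"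
| "holds \<phi> (Neg v) = (\<not> \<phi> v)"

definition satisfiable :: "'v clauses \<Rightarrow> bool" where
  "satisfiable F \<longleftrightarrow> (\<exists>\<phi>. \<forall>C\<in>F. \<exists>a\<in>C. holds \<phi> a)"

definition min_unsat :: "'v clauses \<Rightarrow> bool" where
  "min_unsat F \<longleftrightarrow> \<not> satisfiable F \<and> (\<forall>C\<in>F. satisfiable (F - {C}))"

definition mus_with :: "'v literal \<Rightarrow> 'v clauses \<Rightarrow> 'v clauses set" where
  "mus_with x F = {F'. F' \<subseteq> F \<and> min_unsat F' \<and> {x} \<in> F'}"


section \<open>Implication digraph and nearly regular paths\<close>

type_synonym 'v arcs = "('v literal \<times> 'v literal) set"

text \<open>The arc set; the vertex set is \<^term>\<open>lits F\<close>.  The case \<open>a = b\<close> gives the arcs of the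
  unit-clauses, and for \<open>a \<noteq> b\<close> both arcs arise since \<open>{a, b} = {b, a}\<close>.\<close>
definition idg :: "'v clauses \<Rightarrow> 'v arcs" where
  "idg F = {(lneg a, b) | a b. {a, b} \<in> F}"

definition CL :: "'v arcs \<Rightarrow> 'v clauses" where
  "CL A = {{lneg a, b} | a b. (a, b) \<in> A}"

text \<open>A path is given by its vertex sequence (there are no parallel arcs).\<close>
definition is_path :: "'v clauses \<Rightarrow> 'v literal list \<Rightarrow> bool" where
  "is_path F P \<longleftrightarrow> P \<noteq> [] \<and> distinct P \<and> set P \<subseteq> lits F \<and> successively (\<lambda>a b. (a, b) \<in> idg F) P"

definition path_arcs :: "'v literal list \<Rightarrow> 'v arcs" where
  "path_arcs P = set (zip P (tl P))"

definition compl_pairs :: "'v literal list \<Rightarrow> 'v literal set set" where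
  "compl_pairs P = {{a, lneg a} | a. a \<in> set P \<and> lneg a \<in> set P}"

definition regular :: "'v literal list \<Rightarrow> bool" where
  "regular P \<longleftrightarrow> compl_pairs P = {}"

definition nearly_regular :: "'v literal list \<Rightarrow> bool" where
  "nearly_regular P \<longleftrightarrow> card (compl_pairs P) = 1 \<and> regular (butlast P)"

definition nr_paths :: "'v clauses \<Rightarrow> 'v literal \<Rightarrow> 'v literal list set" where
  "nr_paths F z = {P. is_path F P \<and> hd P = z \<and> nearly_regular P}"

definition path_clauses :: "'v literal list \<Rightarrow> 'v clauses" where
  "path_clauses P = CL (path_arcs P) \<union> {{hd P}}"

text \<open>Regular decomposition at the complement of the last vertex; this vertex belongs to both
  parts.\<close>
definition reg_fst :: "'v literal list \<Rightarrow> 'v literal list" where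
  "reg_fst P = takeWhile (\<lambda>a. a \<noteq> lneg (last P)) P @ [lneg (last P)]"

definition reg_snd :: "'v literal list \<Rightarrow> 'v literal list" where
  "reg_snd P = dropWhile (\<lambda>a. a \<noteq> lneg (last P)) P"

definition contraposition :: "'v literal list \<Rightarrow> 'v literal list" where
  "contraposition Q = rev (map lneg Q)"

text \<open>Composition \<open>P;Q\<close> of paths, where the last vertex of \<open>P\<close> is the first vertex of \<open>Q\<close>.\<close>
definition path_comp :: "'v literal list \<Rightarrow> 'v literal list \<Rightarrow> 'v literal list" where
  "path_comp P Q = P @ tl Q"

definition partner :: "'v literal list \<Rightarrow> 'v literal list" where
  "partner P = path_comp (reg_fst P) (contraposition (reg_snd P))"

definition last_arc_unit :: "'v literal list \<Rightarrow> bool" where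
  "last_arc_unit P \<longleftrightarrow> last P = lneg (last (butlast P))"


section \<open>Pathlex order\<close>

text \<open>The linear order \<open>L\<close> is reflexive, as usual for \<^const>\<open>linear_order_on\<close>.\<close>
definition pathlex ::
    "('v literal \<times> 'v literal) set \<Rightarrow> 'v literal list \<Rightarrow> 'v literal list \<Rightarrow> bool" where
  "pathlex L P Q \<longleftrightarrow> (P, Q) \<in> lexord (L - Id)"

definition first_path ::
    "('v literal \<times> 'v literal) set \<Rightarrow> 'v clauses \<Rightarrow> 'v literal \<Rightarrow> 'v clauses \<Rightarrow> 'v literal list" where
  "first_path L F z F' = (THE P. P \<in> nr_paths F z \<and> path_clauses P = F' \<and>
     (\<forall>Q \<in> nr_paths F z. path_clauses Q = F' \<longrightarrow> Q = P \<or> pathlex L P Q))"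

text \<open>Comparison of minimally unsatisfiable subsets by their first paths starting at the fixed
  vertex \<open>z\<close>, whereas \<open>muslex\<close> below starts each path at the least unit-clause of the
  respective subset.  The two agree on subsets whose least unit-clause is \<open>{z}\<close>, but not in
  general.\<close>
definition muslex_from ::
    "('v literal \<times> 'v literal) set \<Rightarrow> 'v clauses \<Rightarrow> 'v literal \<Rightarrow> 'v clauses \<Rightarrow> 'v clauses \<Rightarrow> bool" where
  "muslex_from L F z F' F'' \<longleftrightarrow> pathlex L (first_path L F z F') (first_path L F z F'')"

definition least_unit :: "('v literal \<times> 'v literal) set \<Rightarrow> 'v clauses \<Rightarrow> 'v literal" where
  "least_unit L F' = (THE z. {z} \<in> F' \<and> (\<forall>y. {y} \<in> F' \<longrightarrow> (z, y) \<in> L))"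

definition muslex ::
    "('v literal \<times> 'v literal) set \<Rightarrow> 'v clauses \<Rightarrow> 'v clauses \<Rightarrow> 'v clauses \<Rightarrow> bool" where
  "muslex L F F' F'' \<longleftrightarrow>
     pathlex L (first_path L F (least_unit L F') F') (first_path L F (least_unit L F'') F'')"


section \<open>The enumeration procedure\<close>

text \<open>The observable actions of a run: \<open>DFS_call P y\<close> is a call of DFS with path \<open>P\<close> and vertex
  \<open>y\<close>, \<open>Output P\<close> a call of OUTPUT, and \<open>Print F'\<close> the printing of a clause-set.\<close>
datatype 'v event = DFS_call "'v literal list" "'v literal" | Output "'v literal list" | Print "'v clauses"

definition output_prints :: "('v literal \<times> 'v literal) set \<Rightarrow> 'v literal list \<Rightarrow> bool" where
  "output_prints L P \<longleftrightarrow> last_arc_unit P \<or> pathlex L P (partner P)"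

definition output_run :: "('v literal \<times> 'v literal) set \<Rightarrow> 'v literal list \<Rightarrow> 'v event list" where
  "output_run L P = Output P # (if output_prints L P then [Print (path_clauses P)] else [])"

definition increasing_listing :: "('a \<times> 'a) set \<Rightarrow> 'a set \<Rightarrow> 'a list \<Rightarrow> bool" where
  "increasing_listing L S zs \<longleftrightarrow> distinct zs \<and> set zs = S \<and> sorted_wrt (\<lambda>a b. (a, b) \<in> L) zs"

text \<open>The out-neighbours of \<open>y\<close> in \<open>G - V(P)\<close> from which \<open>t\<close> is reachable in \<open>G - V(P)\<close>.\<close>
definition candidates ::
    "'v clauses \<Rightarrow> 'v literal \<Rightarrow> 'v literal list \<Rightarrow> 'v literal \<Rightarrow> 'v literal set" where
  "candidates F t P y =
     {z \<in> lits F - set P. (y, z) \<in> idg F \<and> (z, t) \<in> (Restr (idg F) (lits F - set P))\<^sup>*}"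

inductive dfs and dfs_loop for F :: "'v clauses" and L x where
  dfs_output: "\<not> regular (P @ [y]) \<Longrightarrow>
    dfs F L x P y (DFS_call P y # output_run L (P @ [y]))"
| dfs_branch: "regular (P @ [y]) \<Longrightarrow>
    increasing_listing L (candidates F (lneg x) (P @ [y]) y) zs \<Longrightarrow>
    dfs_loop F L x (P @ [y]) zs es \<Longrightarrow>
    dfs F L x P y (DFS_call P y # es)"
| loop_done: "dfs_loop F L x P [] []"
| loop_next: "dfs F L x P z es \<Longrightarrow> dfs_loop F L x P zs es' \<Longrightarrow> dfs_loop F L x P (z # zs) (es @ es')"

text \<open>\<open>enum F x L es\<close>: the procedure terminates and \<open>es\<close> is its sequence of actions.\<close>
definition enum ::
    "'v clauses \<Rightarrow> 'v literal \<Rightarrow> ('v literal \<times> 'v literal) set \<Rightarrow> 'v event list \<Rightarrow> bool" where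
  "enum F x L es \<longleftrightarrow>
     (if (x, lneg x) \<in> (idg F)\<^sup>* then dfs F L x [] x es else es = [])"

definition outputs :: "'v event list \<Rightarrow> 'v literal list list" where
  "outputs es = concat (map (\<lambda>e. case e of Output P \<Rightarrow> [P] | _ \<Rightarrow> []) es)"

definition prints :: "'v event list \<Rightarrow> 'v clauses list" where
  "prints es = concat (map (\<lambda>e. case e of Print F' \<Rightarrow> [F'] | _ \<Rightarrow> []) es)"


section \<open>The cost model: a random access machine with while-programs\<close>

text \<open>The memory consists of arrays of natural numbers (words); the first argument names the array,
  the second is the index.  A program can only mention finitely many arrays, and array names
  cannot be computed.  Every \<open>Skip\<close>, every \<open>Store\<close> and every test of \<open>If\<close> and \<open>While\<close>
  costs one time unit, and \<open>Emit\<close> costs one unit per emitted word plus one.  Expressions are part of the program text, so evaluating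
  one takes a number of machine operations bounded by a constant for the program.\<close>

type_synonym mem = "nat \<Rightarrow> nat \<Rightarrow> nat"

datatype aexp = Const nat | Cell nat aexp | Add aexp aexp | Sub aexp aexp

datatype bexp = Less aexp aexp | Equal aexp aexp | Not bexp | And bexp bexp

text \<open>\<open>Store a i e\<close> performs \<open>a[i] := e\<close>; \<open>Emit t a e\<close> emits the first \<open>e\<close> words of the array
  \<open>a\<close>, with tag \<open>t\<close>.\<close>
datatype com =
    Skip
  | Store nat aexp aexp
  | Seq com com
  | If bexp com com
  | While bexp com
  | Emit nat nat aexp

primrec aval :: "aexp \<Rightarrow> mem \<Rightarrow> nat" where
  "aval (Const k) m = k"
| "aval (Cell a e) m = m a (aval e m)"
| "aval (Add e e') m = aval e m + aval e' m"
| "aval (Sub e e') m = aval e m - aval e' m"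

primrec bval :: "bexp \<Rightarrow> mem \<Rightarrow> bool" where
  "bval (Less e e') m = (aval e m < aval e' m)"
| "bval (Equal e e') m = (aval e m = aval e' m)"
| "bval (Not b) m = (\<not> bval b m)"
| "bval (And b b') m = (bval b m \<and> bval b' m)"

text \<open>The memory cells read by an evaluation, and all words arising in it.\<close>
primrec acells :: "aexp \<Rightarrow> mem \<Rightarrow> (nat \<times> nat) set" where
  "acells (Const k) m = {}"
| "acells (Cell a e) m = insert (a, aval e m) (acells e m)"
| "acells (Add e e') m = acells e m \<union> acells e' m"
| "acells (Sub e e') m = acells e m \<union> acells e' m"

primrec awords :: "aexp \<Rightarrow> mem \<Rightarrow> nat set" where
  "awords (Const k) m = {k}"
| "awords (Cell a e) m = insert (m a (aval e m)) (awords e m)"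
| "awords (Add e e') m = insert (aval e m + aval e' m) (awords e m \<union> awords e' m)"
| "awords (Sub e e') m = insert (aval e m - aval e' m) (awords e m \<union> awords e' m)"

primrec bcells :: "bexp \<Rightarrow> mem \<Rightarrow> (nat \<times> nat) set" where
  "bcells (Less e e') m = acells e m \<union> acells e' m"
| "bcells (Equal e e') m = acells e m \<union> acells e' m"
| "bcells (Not b) m = bcells b m"
| "bcells (And b b') m = bcells b m \<union> bcells b' m"

primrec bwords :: "bexp \<Rightarrow> mem \<Rightarrow> nat set" where
  "bwords (Less e e') m = awords e m \<union> awords e' m"
| "bwords (Equal e e') m = awords e m \<union> awords e' m"
| "bwords (Not b) m = bwords b m"
| "bwords (And b b') m = bwords b m \<union> bwords b' m"

text \<open>A run is recorded as a list of time units, each with the cells accessed and the words handled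
  in it, interspersed with the emitted blocks (which are themselves timeless).\<close>
datatype item = Tick (cells: "(nat \<times> nat) set") (wds: "nat set") | Emitted nat "nat list"

inductive exec :: "com \<Rightarrow> mem \<Rightarrow> item list \<Rightarrow> mem \<Rightarrow> bool" where
  Skip: "exec Skip m [Tick {} {}] m"
| Store: "exec (Store a i e) m
    [Tick ({(a, aval i m)} \<union> acells i m \<union> acells e m) (awords i m \<union> awords e m)]
    (m(a := (m a)(aval i m := aval e m)))"
| Seq: "exec c m tr m' \<Longrightarrow> exec c' m' tr' m'' \<Longrightarrow> exec (Seq c c') m (tr @ tr') m''"
| If_True: "bval b m \<Longrightarrow> exec c m tr m' \<Longrightarrow>
    exec (If b c c') m (Tick (bcells b m) (bwords b m) # tr) m'"
| If_False: "\<not> bval b m \<Longrightarrow> exec c' m tr m' \<Longrightarrow>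
    exec (If b c c') m (Tick (bcells b m) (bwords b m) # tr) m'"
| While_False: "\<not> bval b m \<Longrightarrow> exec (While b c) m [Tick (bcells b m) (bwords b m)] m"
| While_True: "bval b m \<Longrightarrow> exec c m tr m' \<Longrightarrow> exec (While b c) m' tr' m'' \<Longrightarrow>
    exec (While b c) m (Tick (bcells b m) (bwords b m) # tr @ tr') m''"
| Emit: "exec (Emit t a e) m
    (Tick (acells e m) (awords e m)
      # map (\<lambda>i. Tick {(a, i)} {i, m a i}) [0..<aval e m]
      @ [Emitted t (map (m a) [0..<aval e m])]) m"

lemma exec_deterministic:
  "exec c m tr m' \<Longrightarrow> exec c m tr' m'' \<Longrightarrow> tr' = tr \<and> m'' = m'"
proof (induction arbitrary: tr' m'' rule: exec.induct)
  case (Seq c m tr m' c' tr2 m2)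
  from Seq.prems show ?case
    by (cases rule: exec.cases) (use Seq.IH in blast)+
next
  case (While_True b m c tr m' tr2 m2)
  from While_True.prems show ?case
    by (cases rule: exec.cases) (use While_True.hyps While_True.IH in blast)+
next
  case (If_True b m c tr m' c')
  from If_True.prems show ?case
    by (cases rule: exec.cases) (use If_True.hyps If_True.IH in blast)+
next
  case (If_False b m c' tr m' c)
  from If_False.prems show ?case
    by (cases rule: exec.cases) (use If_False.hyps If_False.IH in blast)+
qed (auto elim: exec.cases)

definition emissions :: "item list \<Rightarrow> (nat \<times> nat list) list" where
  "emissions tr = concat (map (\<lambda>i. case i of Tick _ _ \<Rightarrow> [] | Emitted t ws \<Rightarrow> [(t, ws)]) tr)"

text \<open>The number of different cells accessed in the whole run, including the cells of the input.\<close>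
definition space :: "item list \<Rightarrow> nat" where
  "space tr = card (\<Union>{cells i | i. i \<in> set tr \<and> (\<exists>M W. i = Tick M W)})"

definition words :: "item list \<Rightarrow> nat set" where
  "words tr = \<Union>{wds i | i. i \<in> set tr \<and> (\<exists>M W. i = Tick M W)}"

text \<open>The waiting times in a run for the emissions with tag \<open>t\<close>: if there are \<open>k\<close> of them, then
  this list has length \<open>k + 1\<close>.  Entry \<open>0\<close> is the time until the first one, entry
  \<open>i\<close> with \<open>0 < i < k\<close> the time from the \<open>i\<close>-th to the next one, and entry \<open>k\<close> the time from the
  last one (from the start, for \<open>k = 0\<close>) to the end of the run.\<close>
fun waits :: "nat \<Rightarrow> item list \<Rightarrow> nat list" where
  "waits t [] = [0]"
| "waits t (Tick M W # tr) = Suc (hd (waits t tr)) # tl (waits t tr)"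
| "waits t (Emitted s ws # tr) = (if s = t then 0 # waits t tr else waits t tr)"


section \<open>Representation of inputs and outputs\<close>

text \<open>Variables are numbered from \<open>0\<close> on by \<open>e\<close>, and literals are coded accordingly.\<close>
primrec code :: "('v \<Rightarrow> nat) \<Rightarrow> 'v literal \<Rightarrow> nat" where
  "code e (Pos v) = 2 * e v"
| "code e (Neg v) = 2 * e v + 1"

text \<open>A clause-set with clauses of length at most two is written as a list of literal pairs, without
  repetition of clauses; the pair \<open>(a, a)\<close> stands for the unit-clause \<open>{a}\<close>.\<close>
definition presents :: "('v literal \<times> 'v literal) list \<Rightarrow> 'v clauses \<Rightarrow> bool" where
  "presents ps F \<longleftrightarrow>
     distinct (map (\<lambda>(a, b). {a, b}) ps) \<and> set (map (\<lambda>(a, b). {a, b}) ps) = F"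

definition array_of :: "nat list \<Rightarrow> nat \<Rightarrow> nat" where
  "array_of ws i = (if i < length ws then ws ! i else 0)"

text \<open>Array \<open>0\<close> holds the number of variables, the number of clauses and the start literal; arrays
  \<open>1\<close> and \<open>2\<close> hold the clauses, and array \<open>3\<close> the literals in increasing order.\<close>
definition input_mem ::
    "('v \<Rightarrow> nat) \<Rightarrow> ('v literal \<times> 'v literal) list \<Rightarrow> 'v literal list \<Rightarrow> 'v literal \<Rightarrow> 'v clauses \<Rightarrow> mem"
where
  "input_mem e ps ls x F = (\<lambda>a. array_of (
     if a = 0 then [nvars F, length ps, code e x]
     else if a = 1 then map (\<lambda>(p, q). code e p) ps
     else if a = 2 then map (\<lambda>(p, q). code e q) ps
     else if a = 3 then map (code e) ls
     else []))"

definition represents_input ::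
    "('v \<Rightarrow> nat) \<Rightarrow> ('v literal \<times> 'v literal) list \<Rightarrow> 'v literal list \<Rightarrow>
     'v clauses \<Rightarrow> ('v literal \<times> 'v literal) set \<Rightarrow> bool" where
  "represents_input e ps ls F L \<longleftrightarrow>
     bij_betw e (vars F) {..<nvars F} \<and> presents ps F \<and> increasing_listing L (lits F) ls"

definition dfs_tag :: nat where "dfs_tag = 0"
definition output_tag :: nat where "output_tag = 1"
definition print_tag :: nat where "print_tag = 2"

fun emits_event :: "('v \<Rightarrow> nat) \<Rightarrow> nat \<times> nat list \<Rightarrow> 'v event \<Rightarrow> bool" where
  "emits_event e (t, ws) (DFS_call P y) \<longleftrightarrow> t = dfs_tag \<and> ws = map (code e) (P @ [y])"
| "emits_event e (t, ws) (Output P) \<longleftrightarrow> t = output_tag \<and> ws = map (code e) P"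
| "emits_event e (t, ws) (Print F') \<longleftrightarrow> t = print_tag \<and>
     (\<exists>ps. presents ps F' \<and> ws = concat (map (\<lambda>(a, b). [code e a, code e b]) ps))"

text \<open>\<open>implements_enum p F x L tr e ps ls\<close>: on the given representation of the input, the program
  \<open>p\<close> terminates with run \<open>tr\<close>, and performs exactly the DFS-calls, OUTPUT-calls and printings
  of the procedure, in the same order.\<close>
definition implements_enum ::
    "com \<Rightarrow> 'v clauses \<Rightarrow> 'v literal \<Rightarrow> ('v literal \<times> 'v literal) set \<Rightarrow> item list \<Rightarrow>
     ('v \<Rightarrow> nat) \<Rightarrow> ('v literal \<times> 'v literal) list \<Rightarrow> 'v literal list \<Rightarrow> bool" where
  "implements_enum p F x L tr e ps ls \<longleftrightarrow>
     (\<exists>m es. exec p (input_mem e ps ls x F) tr m \<and> enum F x L es \<and>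
        list_all2 (emits_event e) (emissions tr) es)"

end

(*
  A minimally unsatisfiable subset containing the unit-clause {x} is the clause-set of a nearly
  regular path starting at x, and two such paths P, Q have the same clause-set only if Q = P or Q is
  the partner of P: at the first vertex where they diverge, the arc of Q must be the contraposition
  of an arc of P, which is possible only at the complement of the last vertex of P.  DFS never enters
  a dead end, since by contraposition a vertex continues to a nearly regular path exactly if the
  complement of x stays reachable from it.

  For the running time, DFS is run on an explicit stack of pending pairs (vertex, depth); the current
  path is truncated only when the next pair is popped, so that after the last output the stack
  is empty and the run ends at once.  The stack holds at most one entry per arc leaving the current
  path.  A step either outputs or extends the path and costs one linear-time backward search, hence
  O(n) steps lie between two outputs.  A path not printed is preceded by its partner, which was printed;
  so at most m of the outputs seen up to the time when m sets have been printed were ignored.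
*)
theory Submission
  imports Defs
begin

section \<open>Nearly regular paths and minimally unsatisfiable subsets\<close>

text \<open>Space is never counted directly. The address of every accessed cell is itself a word
  handled in the same time unit, so a bound on the words bounds the cells, up to the number of
  arrays. The program logic therefore carries only the invariant that all stored values are at most
  \<open>B\<close>, and linear space becomes the claim that queue and stack indices stay linear.

  The recursion of \<open>dfs\<close> has no counterpart in the syntax of the program, whose main
  part is a single loop. A call is matched with the stretch of iterations from popping its entry
  until the stack is back to what lay below that entry, and waiting times are composed along such
  stretches. This composition needs an output in every stretch: only then does a gap consist of the
  end of one call and the descent into the next, instead of accumulating over many fruitless calls.

  Times for printing are derived from times for outputs by counting outputs between prints. With at
  most \<open>k + 1\<close> outputs in a gap there are at most \<open>k + 2\<close> waits in it,
  which explains the factor 2 between the two bounds.\<close>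

lemma lneg_lneg [simp]: "lneg (lneg a) = a"
  by (cases a) auto

lemma lneg_neq [simp]: "lneg a \<noteq> a" "a \<noteq> lneg a"
  by (cases a; simp)+

lemma lneg_eq_iff [simp]: "lneg a = lneg b \<longleftrightarrow> a = b"
  by (metis lneg_lneg)

lemma map_lneg_lneg [simp]: "map (lneg \<circ> lneg) P = P"
  by (induction P) auto

lemma lvar_lneg [simp]: "lvar (lneg a) = lvar a"
  by (cases a) auto

lemma lneg_in_lits [simp]: "lneg a \<in> lits F \<longleftrightarrow> a \<in> lits F"
  by (simp add: lits_def)

lemma holds_lneg [simp]: "holds \<phi> (lneg a) \<longleftrightarrow> \<not> holds \<phi> a"
  by (cases a) auto

lemma in_clause_in_lits: "C \<in> F \<Longrightarrow> a \<in> C \<Longrightarrow> a \<in> lits F"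
  by (auto simp: lits_def vars_def)

lemma idg_iff: "(u, v) \<in> idg F \<longleftrightarrow> {lneg u, v} \<in> F"
proof
  assume "{lneg u, v} \<in> F"
  then show "(u, v) \<in> idg F"
    unfolding idg_def by (intro CollectI exI[of _ "lneg u"] exI[of _ v]) simp
qed (auto simp: idg_def)

lemma idg_contra: "(u, v) \<in> idg F \<Longrightarrow> (lneg v, lneg u) \<in> idg F"
  by (simp add: idg_iff insert_commute)

lemma idg_lits: "(u, v) \<in> idg F \<Longrightarrow> u \<in> lits F \<and> v \<in> lits F"
  using in_clause_in_lits[of "{lneg u, v}" F] by (fastforce simp: idg_iff)

lemma regular_iff: "regular P \<longleftrightarrow> (\<forall>a\<in>set P. lneg a \<notin> set P)"
  by (auto simp: regular_def compl_pairs_def)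

lemma regular_Nil [simp]: "regular []"
  by (simp add: regular_iff)

lemma regular_appendD: "regular (P @ Q) \<Longrightarrow> regular P \<and> regular Q"
  by (auto simp: regular_iff)

lemma regular_snoc: "regular P \<Longrightarrow> regular (P @ [w]) \<longleftrightarrow> lneg w \<notin> set P"
  by (auto simp: regular_iff)

lemma nearly_regular_Nil [simp]: "\<not> nearly_regular []"
  by (simp add: nearly_regular_def compl_pairs_def)

text \<open>For regular \<open>P\<close>, a complementary pair of \<open>P @ [w]\<close> must
  involve the new vertex, so the cardinality condition collapses to a membership test. In this shape
  DFS meets nearly regular paths: at the first failure of regularity.\<close>

lemma nearly_regular_snoc: "nearly_regular (P @ [w]) \<longleftrightarrow> regular P \<and> lneg w \<in> set P"
proof -
  have "compl_pairs (P @ [w]) = (if lneg w \<in> set P then {{w, lneg w}} else {})" if "regular P"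
    using that by (auto simp: compl_pairs_def regular_iff insert_commute)
  then show ?thesis by (auto simp: nearly_regular_def split: if_splits)
qed

lemma split_unique: "A @ u # B = A' @ u # B' \<Longrightarrow> distinct (A @ u # B) \<Longrightarrow> A = A' \<and> B = B'"
proof (induction A arbitrary: A')
  case Nil
  then show ?case by (cases A') auto
next
  case (Cons a A)
  then show ?case by (cases A') auto
qed

text \<open>Normal form for all path arguments below: \<open>u\<close> is the complement of the last
  vertex, \<open>A @ [u]\<close> the first part of the regular decomposition, and \<open>R\<close>
  the interior of the second part. \<open>R = []\<close> is the case of a unit as last arc.\<close>

lemma nr_paths_cases:
  assumes "P \<in> nr_paths F x"
  obtains A u R where "P = A @ u # R @ [lneg u]" "regular (A @ u # R)" "distinct P"
    "set P \<subseteq> lits F" "successively (\<lambda>a b. (a, b) \<in> idg F) P" "hd (A @ [u]) = x"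
proof -
  have P: "is_path F P" "hd P = x" "nearly_regular P"
    using assms by (auto simp: nr_paths_def)
  have "P \<noteq> []" using P(1) by (simp add: is_path_def)
  then obtain P' w where w: "P = P' @ [w]" by (metis append_butlast_last_id)
  with P have reg: "regular P'" and "lneg w \<in> set P'" by (auto simp: nearly_regular_snoc)
  then obtain A R where "P' = A @ lneg w # R" by (meson split_list)
  with w reg P show ?thesis by (intro that[of A "lneg w" R]) (auto simp: is_path_def hd_append)
qed

lemma nr_pathsI:
  assumes "P = A @ u # R @ [lneg u]" "regular (A @ u # R)" "distinct P"
    "successively (\<lambda>a b. (a, b) \<in> idg F) P" "hd (A @ [u]) = x"
  shows "P \<in> nr_paths F x"
proof -
  \<comment> \<open>Vertices lie in \<open>lits F\<close> because the ends of arcs do; a one-vertex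
    path has no arc, hence the bound on the length.\<close>
  have "set P \<subseteq> lits F" if "successively (\<lambda>a b. (a, b) \<in> idg F) P" "length P \<ge> 2" for P
    using that
  proof (induction P rule: induct_list012)
    case (3 a b P)
    show ?case
    proof (cases P)
      case Nil
      then show ?thesis using 3(3) by (auto dest: idg_lits)
    next
      case (Cons c P')
      then show ?thesis using 3 by (auto dest: idg_lits)
    qed
  qed auto
  moreover have "length P \<ge> 2" using assms(1) by simp
  moreover have "nearly_regular P"
    using assms(1,2) nearly_regular_snoc[of "A @ u # R" "lneg u"] by simp
  moreover have "P \<noteq> []" "hd P = x" using assms(1,5) by (auto simp: hd_append)
  ultimately show ?thesis using assms(3,4) by (simp add: nr_paths_def is_path_def)
qed

section \<open>The partner of a nearly regular path\<close>

lemma partner_split: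
  assumes "u \<notin> set A"
  shows "partner (A @ u # R @ [lneg u]) = A @ u # rev (map lneg R) @ [lneg u]"
proof -
  have "takeWhile (\<lambda>a. a \<noteq> u) (A @ u # R @ [lneg u]) = A"
    using assms by (subst takeWhile_append2) auto
  moreover have "dropWhile (\<lambda>a. a \<noteq> u) (A @ u # R @ [lneg u]) = u # R @ [lneg u]"
    using assms by (subst dropWhile_append2) auto
  ultimately show ?thesis
    by (simp add: partner_def path_comp_def reg_fst_def reg_snd_def contraposition_def)
qed

text \<open>Contraposing the part from \<open>u\<close> to \<open>lneg u\<close> gives again a part
  from \<open>u\<close> to \<open>lneg u\<close>, and its arcs exist since every arc occurs together
  with its contraposition. The new inner vertices are complements of \<open>R\<close>, which
  regularity of \<open>A @ u # R\<close> keeps off \<open>A\<close> and \<open>u\<close>.\<close>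

lemma partner_facts:
  assumes "P \<in> nr_paths F x" "P = A @ u # R @ [lneg u]"
  shows "partner P = A @ u # rev (map lneg R) @ [lneg u]" "partner P \<in> nr_paths F x"
proof -
  obtain A' u' R' where "P = A' @ u' # R' @ [lneg u']" and reg: "regular (A' @ u' # R')" and
    dis: "distinct P" and path: "successively (\<lambda>a b. (a, b) \<in> idg F) P" and hd: "hd (A' @ [u']) = x"
    using assms(1) by (rule nr_paths_cases)
  \<comment> \<open>The decomposition is unique: the last vertex determines \<open>u\<close>, and
    distinctness determines its position.\<close>
  then have "u' = u" using assms(2) by (metis append_Cons append_assoc last_snoc lneg_eq_iff)
  moreover from this have "A' = A \<and> R' = R"
    using dis assms(2) \<open>P = A' @ u' # R' @ [lneg u']\<close>
      split_unique[of A' u "R' @ [lneg u]" A "R @ [lneg u]"] by (metis append_same_eq)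
  ultimately have reg: "regular (A @ u # R)" and hd: "hd (A @ [u]) = x" using reg hd by auto
  show eq: "partner P = A @ u # rev (map lneg R) @ [lneg u]"
    using dis assms(2) partner_split by fastforce
  have A: "successively (\<lambda>a b. (a, b) \<in> idg F) (A @ [u])"
    using path assms(2) by (auto simp: successively_append_iff successively_Cons)
  have "successively (\<lambda>a b. (a, b) \<in> idg F) (u # R @ [lneg u])"
    using path assms(2) by (auto simp: successively_append_iff successively_Cons)
  then have "successively (\<lambda>a b. (lneg b, lneg a) \<in> idg F) (u # R @ [lneg u])"
    by (rule successively_mono) (auto intro: idg_contra)
  then have "successively (\<lambda>a b. (a, b) \<in> idg F) (rev (map lneg (u # R @ [lneg u])))"
    by (simp only: successively_rev successively_map)
  then have "successively (\<lambda>a b. (a, b) \<in> idg F) (u # rev (map lneg R) @ [lneg u])" by simp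
  with A have "successively (\<lambda>a b. (a, b) \<in> idg F) (partner P)"
    unfolding eq by (auto simp: successively_append_iff successively_Cons)
  moreover have "distinct (partner P)"
    using dis reg unfolding eq unfolding assms(2) regular_iff
    by (auto simp: distinct_map inj_on_def)
  moreover have "regular (A @ u # rev (map lneg R))"
    using reg dis unfolding assms(2) regular_iff by auto
  ultimately show "partner P \<in> nr_paths F x" using eq hd by (intro nr_pathsI)
qed

lemma partner_partner: "P \<in> nr_paths F x \<Longrightarrow> partner (partner P) = P"
proof -
  assume P: "P \<in> nr_paths F x"
  then obtain A u R where *: "P = A @ u # R @ [lneg u]" by (rule nr_paths_cases)
  show ?thesis
    using partner_facts(1)[OF partner_facts(2)[OF P *] partner_facts(1)[OF P *]] *
    by (simp add: rev_map)
qed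

section \<open>Clauses of a path and of its contraposition\<close>

lemma CL_Un: "CL (A \<union> B) = CL A \<union> CL B"
  by (auto simp: CL_def)

lemma path_arcs_Cons: "path_arcs (a # b # P) = insert (a, b) (path_arcs (b # P))"
  by (simp add: path_arcs_def)

lemma path_arcs_simps [simp]: "path_arcs [] = {}" "path_arcs [a] = {}"
  by (simp_all add: path_arcs_def)

lemma path_arcs_append: "path_arcs (P @ a # Q) = path_arcs (P @ [a]) \<union> path_arcs (a # Q)"
proof (induction P)
  case (Cons b P)
  then show ?case by (cases P) (auto simp: path_arcs_Cons)
qed simp

lemma path_arcs_snoc: "P \<noteq> [] \<Longrightarrow> path_arcs (P @ [b]) = insert (last P, b) (path_arcs P)"
  by (induction P rule: induct_list012) (auto simp: path_arcs_Cons)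

lemma path_arcs_conv: "(a, b) \<in> path_arcs P \<longleftrightarrow> (\<exists>D E. P = D @ a # b # E)"
proof
  assume "(a, b) \<in> path_arcs P"
  then show "\<exists>D E. P = D @ a # b # E"
  proof (induction P rule: induct_list012)
    case (3 c d P)
    then show ?case
      by (auto simp: path_arcs_Cons intro: exI[of _ "[]"]) (metis append_Cons)
  qed auto
next
  assume "\<exists>D E. P = D @ a # b # E"
  then show "(a, b) \<in> path_arcs P" by (auto simp: path_arcs_append[of _ a "b # _"] path_arcs_Cons)
qed

lemma successively_iff_path_arcs:
  "successively (\<lambda>a b. (a, b) \<in> r) P \<longleftrightarrow> path_arcs P \<subseteq> r"
  by (induction P rule: induct_list012) (auto simp: path_arcs_Cons)

text \<open>The arcs \<open>(a, b)\<close> and \<open>(lneg b, lneg a)\<close> stand for the same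
  clause \<open>{lneg a, b}\<close>. Hence a path and its partner have the same clauses.\<close>

lemma CL_path_arcs_contraposition: "CL (path_arcs (rev (map lneg P))) = CL (path_arcs P)"
proof -
  have arcs: "path_arcs (rev (map lneg P)) = (\<lambda>(a, b). (lneg b, lneg a)) ` path_arcs P"
  proof (induction P rule: induct_list012)
    case (3 a b P)
    have "path_arcs (rev (map lneg (a # b # P)))
        = path_arcs (rev (map lneg (b # P))) \<union> path_arcs [lneg b, lneg a]"
      using path_arcs_append[of "rev (map lneg P)" "lneg b" "[lneg a]"] by simp
    then show ?case using 3 by (simp add: path_arcs_Cons)
  qed auto
  have "CL ((\<lambda>(a, b). (lneg b, lneg a)) ` A) = CL A" for A :: "'a arcs"
  proof -
    have eq: "CL A = (\<lambda>(a, b). {lneg a, b}) ` A" for A :: "'a arcs"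
      by (auto simp: CL_def)
    show ?thesis unfolding eq image_image by (intro image_cong) auto
  qed
  then show ?thesis unfolding arcs .
qed

lemma path_clauses_partner: "P \<in> nr_paths F x \<Longrightarrow> path_clauses (partner P) = path_clauses P"
proof -
  assume P: "P \<in> nr_paths F x"
  then obtain A u R where *: "P = A @ u # R @ [lneg u]" by (rule nr_paths_cases)
  note eq = partner_facts(1)[OF P *]
  have "CL (path_arcs (u # rev (map lneg R) @ [lneg u])) = CL (path_arcs (u # R @ [lneg u]))"
    using CL_path_arcs_contraposition[of "u # R @ [lneg u]"] by simp
  then show ?thesis
    unfolding path_clauses_def eq unfolding * by (simp add: CL_Un hd_append
        path_arcs_append[of A u "R @ [lneg u]"] path_arcs_append[of A u "rev (map lneg R) @ [lneg u]"])
qed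

section \<open>Paths with equal clause-sets\<close>

lemma in_path_clauses_iff:
  "C \<in> path_clauses P \<longleftrightarrow> C = {hd P} \<or> (\<exists>a b. (a, b) \<in> path_arcs P \<and> C = {lneg a, b})"
  by (auto simp: path_clauses_def CL_def)

text \<open>Regularity breaks exactly at the last vertex of a nearly regular path; a proper
  extension would contain this break before its own last vertex.\<close>

lemma nr_path_prefix_free:
  assumes "P \<in> nr_paths F x" "P @ Q \<in> nr_paths G y"
  shows "Q = []"
proof (rule ccontr)
  assume "Q \<noteq> []"
  then have "butlast (P @ Q) = P @ butlast Q" by (simp add: butlast_append)
  moreover have "regular (butlast (P @ Q))" using assms(2) by (simp add: nr_paths_def nearly_regular_def)
  ultimately have "regular P" using regular_appendD by metis
  then show False using assms(1) by (auto simp: nr_paths_def nearly_regular_def regular_def)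
qed

lemma regular_butlast_nr: "P \<in> nr_paths F x \<Longrightarrow> regular (butlast P)"
  by (simp add: nr_paths_def nearly_regular_def)

lemma nr_paths_diverge:
  assumes "P \<in> nr_paths F x" "Q \<in> nr_paths G x" "P \<noteq> Q"
  obtains C a b P' Q' where "P = C @ a # P'" "Q = C @ b # Q'" "a \<noteq> b" "C \<noteq> []"
proof -
  have *: "(\<exists>R. Q = P @ R) \<or> (\<exists>R. P = Q @ R) \<or>
      (\<exists>C a b P' Q'. P = C @ a # P' \<and> Q = C @ b # Q' \<and> a \<noteq> b)" for P Q :: "'a literal list"
  proof (induction P arbitrary: Q)
    case (Cons a P)
    show ?case
    proof (cases Q)
      case (Cons b Q')
      then show ?thesis
      proof (cases "a = b")
        case True
        with Cons Cons.IH[of Q'] show ?thesis by simp (metis append_Cons)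
      next
        case False
        with Cons show ?thesis by (metis append_Nil)
      qed
    qed auto
  qed auto
  have hd: "hd P = x" "hd Q = x" using assms by (auto simp: nr_paths_def)
  have "\<not> (\<exists>R. Q = P @ R)" "\<not> (\<exists>R. P = Q @ R)"
    using assms nr_path_prefix_free by (metis append_Nil2)+
  with *[of Q P] obtain C a b P' Q' where C: "P = C @ a # P'" "Q = C @ b # Q'" "a \<noteq> b"
    by metis
  moreover have "C \<noteq> []" using C hd by auto
  ultimately show ?thesis using that by blast
qed

text \<open>Let \<open>c\<close> be the last common vertex and \<open>b\<close> the next one on
  \<open>Q\<close>. The clause \<open>{lneg c, b}\<close> must come from \<open>P\<close>. It is not
  the unit-clause, as the common prefix is regular, and it does not come from the arc
  \<open>(c, b)\<close>, as \<open>P\<close> leaves \<open>c\<close> differently. So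
  \<open>P\<close> has the arc \<open>(lneg b, lneg c)\<close>; but \<open>P\<close> contains both
  \<open>c\<close> and \<open>lneg c\<close> only for \<open>c = u\<close>, and then
  \<open>lneg b\<close> is the vertex before the last.\<close>

lemma same_clauses_divergence:
  assumes P: "P \<in> nr_paths F x" and Q: "Q \<in> nr_paths G x"
    and eq: "path_clauses P = path_clauses Q" and ne: "P \<noteq> Q"
    and split: "P = A @ u # R @ [lneg u]"
  shows "R \<noteq> [] \<and> (\<exists>Q'. Q = A @ u # lneg (last R) # Q')"
proof -
  obtain C a b P' Q' where C: "P = C @ a # P'" "Q = C @ b # Q'" "a \<noteq> b" "C \<noteq> []"
    using nr_paths_diverge[OF P Q ne] .
  obtain C0 c where c: "C = C0 @ [c]" using C(4) by (metis append_butlast_last_id)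
  have dis: "distinct P" using P by (auto simp: nr_paths_def is_path_def)
  have reg: "regular (A @ u # R)" using regular_butlast_nr[OF P] split by (simp add: butlast_append)
  have bl: "butlast P = A @ u # R" using split by (simp add: butlast_append)
  have CP: "set C \<subseteq> set (A @ u # R)" using bl C(1) by (metis append_is_Nil_conv butlast_append list.distinct(1) set_append sup.cobounded1)
  have hd: "hd P = hd C" using C by simp
  have "{lneg c, b} \<in> path_clauses Q"
    unfolding in_path_clauses_iff path_arcs_conv using C(2) c by auto
  then have "{lneg c, b} \<in> path_clauses P" using eq by simp
  then consider "{lneg c, b} = {hd P}" | p q where "(p, q) \<in> path_arcs P" "{lneg c, b} = {lneg p, q}"
    unfolding in_path_clauses_iff by blast
  then show ?thesis
  proof cases
    case 1
    then have "lneg c \<in> set C" "c \<in> set C" using hd C(4) c by (auto simp: hd_append split: if_splits)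
    then show ?thesis using CP reg unfolding regular_iff by blast
  next
    case 2
    obtain D E where DE: "P = D @ p # q # E" using 2(1) path_arcs_conv by metis
    from 2(2) consider "p = c" "q = b" | "q = lneg c" "b = lneg p" by (auto simp: doubleton_eq_iff)
    then show ?thesis
    proof cases
      case 1
      then have "D @ c # b # E = C0 @ c # a # P'" using DE C(1) c by simp
      then have "b = a" using split_unique[of D c "b # E" C0 "a # P'"] dis DE 1 by auto
      then show ?thesis using C(3) by simp
    next
      case 2
      have "c \<in> set (A @ u # R)" using CP c by auto
      then have "lneg c \<notin> set (A @ u # R)" using reg unfolding regular_iff by blast
      \<comment> \<open>\<open>lneg c\<close> avoids the regular part, so the arc into it is the
        last arc of \<open>P\<close>.\<close>
      then have "E = []" using bl DE 2(1) by (cases E rule: rev_cases) (auto simp: butlast_append dest!: arg_cong[where f = set])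
      then have "D @ [p, lneg c] = A @ u # R @ [lneg u]" using DE split 2 by metis
      then have "(D @ [p]) @ [lneg c] = (A @ u # R) @ [lneg u]"
        by (simp only: append_assoc append_Cons append_Nil)
      then have cu: "c = u" and Dp: "D @ [p] = A @ u # R" by (metis append1_eq_conv lneg_eq_iff)+
      have "A @ u # R @ [lneg u] = C0 @ u # a # P'" using C(1) c cu split by simp
      then have A: "A = C0" "R @ [lneg u] = a # P'"
        using split_unique[of A u "R @ [lneg u]" C0 "a # P'"] dis split by auto
      have "p = last (u # R)" using Dp by (metis last_appendR last_snoc list.distinct(1))
      \<comment> \<open>With \<open>R\<close> empty, \<open>p\<close> would be \<open>u\<close>, and
        both paths would continue with \<open>lneg u\<close>.\<close>
      moreover have "R \<noteq> []" using A(2) C(3) 2(2) calculation by auto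
      ultimately show ?thesis using C(2) A(1) c cu 2(2) by auto
    qed
  qed
qed

text \<open>If \<open>Q\<close> differs from both \<open>P\<close> and its partner, then divergence
  applies against each of them: behind \<open>u\<close>, the path \<open>Q\<close> must continue
  with \<open>lneg (last R)\<close> and also with \<open>hd R\<close>. Equality of these two
  literals contradicts the regularity of \<open>R\<close>.\<close>

lemma same_path_clauses:
  assumes P: "P \<in> nr_paths F x" and Q: "Q \<in> nr_paths G x" and eq: "path_clauses P = path_clauses Q"
  shows "Q = P \<or> Q = partner P"
proof (rule ccontr)
  assume ne: "\<not> ?thesis"
  obtain A u R where split: "P = A @ u # R @ [lneg u]" using P by (rule nr_paths_cases)
  note pf = partner_facts[OF P split]
  from same_clauses_divergence[OF P Q eq _ split] ne obtain Q1 where R: "R \<noteq> []" "Q = A @ u # lneg (last R) # Q1"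
    by auto
  moreover have "path_clauses (partner P) = path_clauses Q"
    using path_clauses_partner[OF P] eq by simp
  from same_clauses_divergence[OF pf(2) Q this _ pf(1)] ne obtain Q2
    where "Q = A @ u # lneg (last (rev (map lneg R))) # Q2" by auto
  ultimately have "hd R = lneg (last R)" by (simp add: last_rev hd_map)
  moreover have "regular (A @ u # R)" using regular_butlast_nr[OF P] split by (simp add: butlast_append)
  moreover have "hd R \<in> set R" "last R \<in> set R" using R(1) by simp_all
  ultimately show False unfolding regular_iff by simp
qed

section \<open>Minimally unsatisfiable subsets as clause-sets of paths\<close>

lemma path_arcs_lits: "(a, b) \<in> path_arcs P \<Longrightarrow> a \<in> set (butlast P) \<and> b \<in> set (tl P)"
  by (induction P rule: induct_list012) (auto simp: path_arcs_Cons)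

text \<open>The assignment makes \<open>A\<close> true and \<open>B\<close> false; a conflict would
  be a complementary pair inside one list or a literal common to both.\<close>

lemma holds_regular:
  assumes "regular (A @ B)" "distinct (A @ B)"
  shows "\<exists>\<phi>. (\<forall>a\<in>set A. holds \<phi> a) \<and> (\<forall>b\<in>set B. \<not> holds \<phi> b)"
proof -
  define \<phi> where "\<phi> v \<longleftrightarrow> Pos v \<in> set A \<or> Neg v \<in> set B" for v
  have reg: "Pos v \<in> set (A @ B) \<Longrightarrow> Neg v \<notin> set (A @ B)" for v
    using assms(1) unfolding regular_iff by (metis lneg.simps(1))
  have "holds \<phi> a" if "a \<in> set A" for a
    using that assms(2) reg[of "lvar a"] by (induction a) (auto simp: \<phi>_def)
  moreover have "\<not> holds \<phi> b" if "b \<in> set B" for b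
    using that assms(2) reg[of "lvar b"] by (induction b) (auto simp: \<phi>_def)
  ultimately show ?thesis by blast
qed

lemma satisfiable_mono: "satisfiable G \<Longrightarrow> F \<subseteq> G \<Longrightarrow> satisfiable F"
  unfolding satisfiable_def by (meson subsetD)

text \<open>Truth of the start vertex propagates along the arcs to both \<open>u\<close> and
  \<open>lneg u\<close>, hence unsatisfiability. Without the unit-clause, all vertices but the last
  can be made false; without the clause of an arc \<open>(p, q)\<close>, the vertices up to
  \<open>p\<close> are made true and those from \<open>q\<close> on, except the last, false.\<close>

lemma min_unsat_path_clauses:
  assumes P: "P \<in> nr_paths F x"
  shows "min_unsat (path_clauses P)"
  unfolding min_unsat_def
proof (intro conjI ballI notI)
  obtain A u R where split: "P = A @ u # R @ [lneg u]" using P by (rule nr_paths_cases)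
  have P0: "P \<noteq> []" using split by simp
  have dis: "distinct P" using P by (auto simp: nr_paths_def is_path_def)
  have reg: "regular (butlast P)" using regular_butlast_nr[OF P] .
  {
    assume "satisfiable (path_clauses P)"
    then obtain \<phi> where \<phi>: "\<forall>C\<in>path_clauses P. \<exists>a\<in>C. holds \<phi> a" by (auto simp: satisfiable_def)
    have arcs: "holds \<phi> a \<longrightarrow> holds \<phi> b" if "(a, b) \<in> path_arcs P" for a b
    proof -
      have "{lneg a, b} \<in> path_clauses P" using that in_path_clauses_iff by metis
      then show ?thesis using \<phi> by fastforce
    qed
    have hd: "holds \<phi> (hd P)" using \<phi> by (auto simp: in_path_clauses_iff)
    have all: "\<forall>a\<in>set Q. holds \<phi> a" if "Q \<noteq> []" "hd Q = hd P" "path_arcs Q \<subseteq> path_arcs P" for Q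
      using that
    proof (induction Q rule: rev_nonempty_induct)
      case (snoc b Q)
      then show ?case using arcs by (auto simp: path_arcs_snoc)
    qed (use hd in auto)
    from all[OF P0] have "holds \<phi> u" "holds \<phi> (lneg u)" using split by auto
    then show False by simp
  }
  fix C assume "C \<in> path_clauses P"
  then consider "C = {hd P}" | p q where "(p, q) \<in> path_arcs P" "C = {lneg p, q}"
    unfolding in_path_clauses_iff by blast
  then show "satisfiable (path_clauses P - {C})"
  proof cases
    case 1
    obtain \<phi> where \<phi>: "\<forall>b\<in>set (butlast P). \<not> holds \<phi> b"
      using holds_regular[of "[]" "butlast P"] reg dis by (auto simp: distinct_butlast)
    show ?thesis unfolding satisfiable_def
      using \<phi> 1 by (intro exI[of _ \<phi>]) (auto simp: in_path_clauses_iff dest!: path_arcs_lits)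
  next
    case 2
    then obtain D E where DE: "P = D @ p # q # E" using path_arcs_conv by metis
    have "butlast P = (D @ [p]) @ butlast (q # E)" using DE by (simp add: butlast_append)
    then obtain \<phi> where \<phi>: "\<forall>a\<in>set (D @ [p]). holds \<phi> a" "\<forall>b\<in>set (butlast (q # E)). \<not> holds \<phi> b"
      using holds_regular[of "D @ [p]" "butlast (q # E)"] reg dis by (metis distinct_butlast)
    have arcs: "path_arcs P = path_arcs (D @ [p]) \<union> insert (p, q) (path_arcs (q # E))"
      using path_arcs_append[of D p "q # E"] DE by (simp add: path_arcs_Cons)
    have "\<exists>a\<in>C'. holds \<phi> a" if "C' \<in> path_clauses P - {C}" for C'
    proof -
      from that consider "C' = {hd P}" | a b where "(a, b) \<in> path_arcs (D @ [p])" "C' = {lneg a, b}"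
        | a b where "(a, b) \<in> path_arcs (q # E)" "C' = {lneg a, b}"
        using 2 arcs by (auto simp: in_path_clauses_iff)
      then show ?thesis
      proof cases
        case 1
        then show ?thesis using \<phi>(1) DE by (cases D) auto
      next
        case 2
        then show ?thesis using \<phi>(1) path_arcs_lits[OF 2(1)]
          by (metis insertI1 insert_commute list.set_sel(2) list.sel(2))
      next
        case 3
        then show ?thesis using \<phi>(2) path_arcs_lits[OF 3(1)] by auto
      qed
    qed
    then show ?thesis unfolding satisfiable_def by blast
  qed
qed

lemma path_clauses_subset:
  assumes "P \<in> nr_paths F x" "{x} \<in> F"
  shows "path_clauses P \<subseteq> F"
proof -
  have "path_arcs P \<subseteq> idg F" "hd P = x"
    using assms(1) by (auto simp: nr_paths_def is_path_def successively_iff_path_arcs)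
  then show ?thesis using assms(2) unfolding in_path_clauses_iff subset_iff by (auto simp: idg_iff)
qed

lemma first_nonregular_prefix:
  "\<not> regular P \<Longrightarrow> \<exists>A w B. P = A @ w # B \<and> regular A \<and> \<not> regular (A @ [w])"
proof (induction P rule: rev_induct)
  case (snoc w P)
  then show ?case by (cases "regular P") fastforce+
qed simp

lemma rtrancl_distinct_path:
  assumes "(a, b) \<in> r\<^sup>*"
  shows "\<exists>P. P \<noteq> [] \<and> hd P = a \<and> last P = b \<and> distinct P \<and> successively (\<lambda>a b. (a, b) \<in> r) P"
  using assms
proof (induction rule: converse_rtrancl_induct)
  case base
  show ?case by (intro exI[of _ "[b]"]) simp
next
  case (step a c)
  then obtain P where P: "P \<noteq> []" "hd P = c" "last P = b" "distinct P"
    "successively (\<lambda>a b. (a, b) \<in> r) P" by blast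
  show ?case
  proof (cases "a \<in> set P")
    case True
    then obtain D E where "P = D @ a # E" by (meson split_list)
    with P show ?thesis by (intro exI[of _ "a # E"]) (auto simp: successively_append_iff)
  next
    case False
    with P step(1) show ?thesis by (intro exI[of _ "a # P"]) (auto simp: successively_Cons)
  qed
qed

text \<open>A simple path from \<open>x\<close> to \<open>lneg x\<close> is not regular, and its
  shortest non-regular prefix is nearly regular.\<close>

lemma nr_path_exists:
  assumes "(x, lneg x) \<in> (idg F)\<^sup>*"
  shows "nr_paths F x \<noteq> {}"
proof -
  obtain P where P: "P \<noteq> []" "hd P = x" "last P = lneg x" "distinct P"
    "successively (\<lambda>a b. (a, b) \<in> idg F) P" using rtrancl_distinct_path[OF assms] by blast
  have "\<not> regular P" using P(1-3) unfolding regular_iff by (metis hd_in_set last_in_set)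
  then obtain A w B where A: "P = A @ w # B" "regular A" "\<not> regular (A @ [w])"
    using first_nonregular_prefix by blast
  then have "lneg w \<in> set A" by (simp add: regular_snoc)
  then obtain A1 A2 where A12: "A = A1 @ lneg w # A2" by (meson split_list)
  have "A1 @ lneg w # A2 @ [lneg (lneg w)] \<in> nr_paths F x"
  proof (rule nr_pathsI[OF refl])
    have P': "P = (A1 @ lneg w # A2 @ [lneg (lneg w)]) @ B" using A(1) A12 by simp
    show "regular (A1 @ lneg w # A2)" using A(2) A12 by simp
    show "distinct (A1 @ lneg w # A2 @ [lneg (lneg w)])"
      using P(4) unfolding P' distinct_append by blast
    show "successively (\<lambda>a b. (a, b) \<in> idg F) (A1 @ lneg w # A2 @ [lneg (lneg w)])"
      using P(5) unfolding P' successively_append_iff[of _ "A1 @ lneg w # A2 @ [lneg (lneg w)]"] by blast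
    show "hd (A1 @ [lneg w]) = x" using P(2) unfolding P' by (cases A1) auto
  qed
  then show ?thesis by auto
qed

text \<open>Otherwise the set \<open>S\<close> of literals reachable from \<open>x\<close> has no
  complementary pair, as contraposition would turn one into a way from \<open>x\<close> to
  \<open>lneg x\<close>. Change an assignment satisfying the other clauses by making
  \<open>S\<close> true: if this falsifies the true literal \<open>a\<close> of a clause
  \<open>{a, b}\<close>, then \<open>lneg a\<close> is in \<open>S\<close>, and the arc
  \<open>(lneg a, b)\<close> puts \<open>b\<close> into \<open>S\<close>.\<close>

lemma unsat_reach:
  assumes unsat: "\<not> satisfiable F" and sat: "satisfiable (F - {{x}})"
    and card: "\<forall>C\<in>F. card C = 1 \<or> card C = 2"
  shows "(x, lneg x) \<in> (idg F)\<^sup>*"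
proof (rule ccontr)
  assume contr: "\<not> ?thesis"
  define S where "S = {a. (x, a) \<in> (idg F)\<^sup>*}"
  have contra: "(lneg b, lneg a) \<in> (idg F)\<^sup>*" if "(a, b) \<in> (idg F)\<^sup>*" for a b
    using that by (induction rule: rtrancl_induct) (auto intro: idg_contra converse_rtrancl_into_rtrancl)
  have S: "lneg a \<notin> S" if "a \<in> S" for a
  proof
    assume "lneg a \<in> S"
    then have "(a, lneg x) \<in> (idg F)\<^sup>*" using contra[of x "lneg a"] by (simp add: S_def)
    then show False using that contr rtrancl_trans[of x a "idg F" "lneg x"] by (simp add: S_def)
  qed
  obtain \<phi> where \<phi>: "\<forall>C\<in>F - {{x}}. \<exists>a\<in>C. holds \<phi> a" using sat by (auto simp: satisfiable_def)
  define \<psi> where "\<psi> v \<longleftrightarrow> Pos v \<in> S \<or> (\<phi> v \<and> Neg v \<notin> S)" for v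
  have \<psi>: "holds \<psi> a \<longleftrightarrow> a \<in> S \<or> (holds \<phi> a \<and> lneg a \<notin> S)" for a
    using S[of a] S[of "lneg a"] by (cases a) (auto simp: \<psi>_def)
  have "\<exists>a\<in>C. holds \<psi> a" if C: "C \<in> F" for C
  proof (cases "C = {x}")
    case True
    then show ?thesis by (simp add: \<psi> S_def)
  next
    case False
    then obtain a where a: "a \<in> C" "holds \<phi> a" using \<phi> C by blast
    show ?thesis
    proof (cases "lneg a \<in> S")
      case True
      obtain b where b: "C = {a, b}"
      proof -
        have "card C = 1 \<or> card C = 2" using card C by blast
        then show ?thesis using a(1) that by (auto simp: card_1_singleton_iff card_2_iff insert_commute)
      qed
      then have "(lneg a, b) \<in> idg F" using C by (simp add: idg_iff)
      then have "b \<in> S" using True unfolding S_def by auto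
      then show ?thesis using b by (auto simp: \<psi>)
    qed (use a \<psi> in auto)
  qed
  then show False using unsat unfolding satisfiable_def by blast
qed

text \<open>A minimally unsatisfiable \<open>F'\<close> contains the clauses of a path found in its
  own implication digraph. These are already unsatisfiable, so minimality forces equality.\<close>

lemma mus_with_eq:
  assumes card: "\<forall>C\<in>F. card C = 1 \<or> card C = 2" and x: "{x} \<in> F"
  shows "mus_with x F = path_clauses ` nr_paths F x"
proof (intro equalityI subsetI)
  fix F' assume "F' \<in> mus_with x F"
  then have F': "F' \<subseteq> F" "min_unsat F'" "{x} \<in> F'" by (auto simp: mus_with_def)
  have "(x, lneg x) \<in> (idg F')\<^sup>*"
    using F' card by (intro unsat_reach) (auto simp: min_unsat_def)
  then obtain P where P: "P \<in> nr_paths F' x" using nr_path_exists by blast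
  have sub: "path_clauses P \<subseteq> F'" using path_clauses_subset[OF P F'(3)] .
  have "path_clauses P = F'"
  proof (rule ccontr)
    assume "path_clauses P \<noteq> F'"
    then obtain C where "C \<in> F'" "C \<notin> path_clauses P" using sub by blast
    then have "satisfiable (F' - {C})" "path_clauses P \<subseteq> F' - {C}"
      using F'(2) sub by (auto simp: min_unsat_def)
    then have "satisfiable (path_clauses P)" by (metis satisfiable_mono)
    then show False using min_unsat_path_clauses[OF P] by (simp add: min_unsat_def)
  qed
  moreover have "P \<in> nr_paths F x"
  proof -
    have "idg F' \<subseteq> idg F" "lits F' \<subseteq> lits F" using F'(1) by (auto simp: idg_iff lits_def vars_def)
    then show ?thesis using P by (auto simp: nr_paths_def is_path_def successively_iff_path_arcs)
  qed
  ultimately show "F' \<in> path_clauses ` nr_paths F x" by blast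
next
  fix F' assume "F' \<in> path_clauses ` nr_paths F x"
  then obtain P where P: "P \<in> nr_paths F x" "F' = path_clauses P" by blast
  then have "{x} \<in> path_clauses P" by (auto simp: in_path_clauses_iff nr_paths_def)
  then show "F' \<in> mus_with x F"
    using P min_unsat_path_clauses[OF P(1)] path_clauses_subset[OF P(1) x] by (simp add: mus_with_def)
qed

section \<open>Reachability outside a prefix\<close>

lemma successively_rtrancl:
  "successively (\<lambda>a b. (a, b) \<in> r) W \<Longrightarrow> W \<noteq> [] \<Longrightarrow> set W \<subseteq> V \<Longrightarrow> (hd W, last W) \<in> (Restr r V)\<^sup>*"
proof (induction W rule: induct_list012)
  case (3 a b W)
  then show ?case by (auto intro: converse_rtrancl_into_rtrancl)
qed auto

text \<open>From its last vertex, a nearly regular path can be continued to \<open>lneg x\<close> by the contraposition of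
  its first part.\<close>
lemma nr_path_suffix_reach:
  assumes "C @ z # R \<in> nr_paths F x"
  shows "(z, lneg x) \<in> (Restr (idg F) (lits F - set C))\<^sup>*"
proof -
  let ?Q = "C @ z # R"
  obtain A u S where split: "?Q = A @ u # S @ [lneg u]" and reg: "regular (A @ u # S)" and dis: "distinct ?Q"
    and sub: "set ?Q \<subseteq> lits F" and path: "successively (\<lambda>a b. (a, b) \<in> idg F) ?Q" and hd: "hd (A @ [u]) = x"
    using assms by (rule nr_paths_cases)
  have bl: "butlast ?Q = A @ u # S" unfolding split by (simp add: butlast_append)
  have la: "last (z # R) = lneg u" using split by (metis last_appendR last_snoc append_Cons append_assoc list.distinct(1))
  have CA: "set C \<subseteq> set (A @ u # S)" unfolding bl[symmetric] by (auto simp: butlast_append)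
  let ?W = "(z # R) @ rev (map lneg A)"
  have "successively (\<lambda>a b. (a, b) \<in> idg F) (A @ [u])"
    using path unfolding split by (auto simp: successively_append_iff successively_Cons)
  then have "successively (\<lambda>a b. (lneg b, lneg a) \<in> idg F) (A @ [u])"
    by (rule successively_mono) (auto intro: idg_contra)
  then have "successively (\<lambda>a b. (a, b) \<in> idg F) (rev (map lneg (A @ [u])))"
    by (simp only: successively_rev successively_map)
  then have contra: "successively (\<lambda>a b. (a, b) \<in> idg F) (lneg u # rev (map lneg A))" by simp
  have "successively (\<lambda>a b. (a, b) \<in> idg F) (z # R)" using path by (auto simp: successively_append_iff)
  then have "successively (\<lambda>a b. (a, b) \<in> idg F) ?W"
    using contra la unfolding successively_append_iff by (auto simp: successively_Cons)
  moreover have "set ?W \<subseteq> lits F - set C"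
  proof -
    have "a \<notin> set C" if "a \<in> set (z # R)" for a using that dis by auto
    \<comment> \<open>\<open>A\<close> and \<open>C\<close> both lie in the regular part of the
      path, so no complement of a vertex of \<open>A\<close> is on \<open>C\<close>.\<close>
    moreover have "lneg a \<notin> set C" if "a \<in> set A" for a
      using that reg CA unfolding regular_iff by auto
    moreover have "set A \<subseteq> lits F" using sub unfolding split by auto
    ultimately show ?thesis using sub by auto
  qed
  moreover have "last ?W = lneg x" using la hd by (cases A) (auto simp: last_rev)
  ultimately show ?thesis using successively_rtrancl[of "idg F" ?W] by simp
qed

section \<open>Correctness of the procedure\<close>

lemma increasing_listing_unique:
  assumes "antisym L" "increasing_listing L S zs" "increasing_listing L S zs'"
  shows "zs = zs'"
  using assms(2,3)
proof (induction zs arbitrary: S zs')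
  case Nil
  then show ?case by (auto simp: increasing_listing_def)
next
  case (Cons z zs)
  then obtain z' zs'' where zs': "zs' = z' # zs''" by (cases zs') (auto simp: increasing_listing_def)
  have "z = z'"
  proof (rule ccontr)
    assume "z \<noteq> z'"
    then have "(z, z') \<in> L" "(z', z) \<in> L"
      using Cons.prems zs' by (auto simp: increasing_listing_def)
    then show False using \<open>z \<noteq> z'\<close> assms(1) by (auto dest: antisymD)
  qed
  moreover have "zs = zs''"
    using Cons.prems zs' calculation
    by (intro Cons.IH[of "S - {z}"]) (auto simp: increasing_listing_def)
  ultimately show ?case using zs' by simp
qed

lemma increasing_listing_exists:
  assumes lin: "linear_order_on V L" and "finite S" "S \<subseteq> V"
  shows "\<exists>zs. increasing_listing L S zs"
  using assms(2,3)
proof (induction S)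
  case empty
  show ?case by (intro exI[of _ "[]"]) (simp add: increasing_listing_def)
next
  case (insert a S)
  have trans: "trans L" and total: "total_on V L"
    using lin by (auto simp: order_on_defs)
  obtain zs where zs: "distinct zs" "set zs = S" "sorted_wrt (\<lambda>a b. (a, b) \<in> L) zs"
    using insert by (auto simp: increasing_listing_def)
  let ?l = "filter (\<lambda>z. (z, a) \<in> L) zs" and ?r = "filter (\<lambda>z. (z, a) \<notin> L) zs"
  have r: "(a, z) \<in> L" if "z \<in> set ?r" for z
    using that total insert zs(2) by (auto simp: total_on_def)
  have "sorted_wrt (\<lambda>a b. (a, b) \<in> L) (?l @ a # ?r)"
    using zs(3) r transD[OF trans] by (auto simp: sorted_wrt_append sorted_wrt_filter)
  moreover have "distinct (?l @ a # ?r)" "set (?l @ a # ?r) = insert a S"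
    using zs insert by auto
  ultimately show ?case unfolding increasing_listing_def by metis
qed

lemma dfs_deterministic:
  assumes "antisym L"
  shows "dfs F L x P y es \<Longrightarrow> dfs F L x P y es' \<Longrightarrow> es' = es"
    and "dfs_loop F L x P zs es \<Longrightarrow> dfs_loop F L x P zs es' \<Longrightarrow> es' = es"
proof (induction arbitrary: es' and es' rule: dfs_dfs_loop.inducts)
  case (dfs_output P y)
  from dfs_output(2,1) show ?case by (auto elim: dfs.cases)
next
  case (dfs_branch P y zs es)
  from dfs_branch.prems dfs_branch(1) obtain zs' es2
    where *: "increasing_listing L (candidates F (lneg x) (P @ [y]) y) zs'"
      "dfs_loop F L x (P @ [y]) zs' es2" "es' = DFS_call P y # es2"
    by (auto elim: dfs.cases)
  then have "zs' = zs" using increasing_listing_unique[OF assms dfs_branch(2) *(1)] by simp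
  then show ?case using * dfs_branch.IH by simp
next
  case (loop_done P)
  then show ?case by (auto elim: dfs_loop.cases)
next
  case (loop_next P z es zs es2)
  from loop_next.prems obtain es3 es4
    where "dfs F L x P z es3" "dfs_loop F L x P zs es4" "es' = es3 @ es4"
    by (auto elim: dfs_loop.cases)
  then show ?case using loop_next.IH by simp
qed

section \<open>Candidates and the absence of dead ends\<close>

lemma candidates_subset: "candidates F t P y \<subseteq> lits F - set P"
  by (auto simp: candidates_def)

lemma outputs_simps [simp]:
  "outputs [] = []" "outputs (es @ es') = outputs es @ outputs es'"
  "outputs (DFS_call P y # es) = outputs es" "outputs (Output P # es) = P # outputs es"
  "outputs (Print F # es) = outputs es"
  by (simp_all add: outputs_def)

lemma prints_simps [simp]:
  "prints [] = []" "prints (es @ es') = prints es @ prints es'"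
  "prints (DFS_call P y # es) = prints es" "prints (Output P # es) = prints es"
  "prints (Print F # es) = F # prints es"
  by (simp_all add: prints_def)

text \<open>Cutting a walk to \<open>t\<close> behind its last visit of \<open>y\<close> leaves a
  walk that avoids \<open>y\<close>.\<close>

lemma restricted_reach_step:
  assumes "(u, t) \<in> (Restr r V)\<^sup>*" "t \<noteq> y"
  shows "(u, t) \<in> (Restr r (V - {y}))\<^sup>* \<or>
    (\<exists>z. (y, z) \<in> r \<and> z \<in> V - {y} \<and> (z, t) \<in> (Restr r (V - {y}))\<^sup>*)"
  using assms(1)
proof (induction rule: converse_rtrancl_induct)
  case (step u v)
  show ?case
  proof (cases "v = y \<or> (v, t) \<notin> (Restr r (V - {y}))\<^sup>*")
    case True
    \<comment> \<open>\<open>y\<close> is not a vertex of the restricted digraph, so only the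
      trivial walk starts there, and \<open>t\<close> differs from \<open>y\<close>.\<close>
    have "(y, t) \<notin> (Restr r (V - {y}))\<^sup>*"
      using assms(2) by (auto elim: converse_rtranclE)
    then show ?thesis using True step by auto
  next
    case False
    then show ?thesis using step by (cases "u = y") (auto intro: converse_rtrancl_into_rtrancl)
  qed
qed simp

text \<open>The reachability tested for a candidate reproduces itself: a vertex that passed the
  test, and is not the target, has a candidate in turn. The time bound rests on this.\<close>

lemma candidates_nonempty:
  assumes "(y, t) \<in> (Restr (idg F) (lits F - set P))\<^sup>*" "t \<noteq> y"
  shows "candidates F t (P @ [y]) y \<noteq> {}"
proof -
  have V: "lits F - set (P @ [y]) = lits F - set P - {y}" by auto
  have "(y, t) \<notin> (Restr (idg F) (lits F - set (P @ [y])))\<^sup>*"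
    using assms(2) by (auto elim: converse_rtranclE)
  then obtain z where "(y, z) \<in> idg F" "z \<in> lits F - set (P @ [y])"
    "(z, t) \<in> (Restr (idg F) (lits F - set (P @ [y])))\<^sup>*"
    using restricted_reach_step[OF assms] unfolding V by auto
  then show ?thesis by (auto simp: candidates_def)
qed

fun event_tag :: "'v event \<Rightarrow> nat" where
  "event_tag (DFS_call P y) = dfs_tag"
| "event_tag (Output P) = output_tag"
| "event_tag (Print F) = print_tag"

lemma sorted_wrt_pair:
  assumes "sorted_wrt r xs" "distinct xs" "set xs = {a, b}" "a \<noteq> b" "\<not> r b a"
  shows "xs = [a, b]"
proof -
  have "length xs = 2" using assms(2-4) distinct_card[of xs] by simp
  then obtain c d where "xs = [c, d]" by (auto simp: length_Suc_conv numeral_2_eq_2)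
  then show ?thesis using assms by (auto simp: doubleton_eq_iff)
qed

section \<open>Outputs and prints of a run\<close>

locale instance_2cnf =
  fixes F :: "'v clauses" and x :: "'v literal" and L :: "('v literal \<times> 'v literal) set"
  assumes clause_set: "is_clause_set F" and sizes: "\<forall>C\<in>F. card C = 1 \<or> card C = 2"
    and unit: "{x} \<in> F" and lin: "linear_order_on (lits F) L"
begin

lemma finite_F [simp]: "finite F"
  using clause_set by (simp add: is_clause_set_def)

lemma finite_vars [simp]: "finite (vars F)"
  using clause_set by (auto simp: vars_def is_clause_set_def is_clause_def)

lemma lits_eq: "lits F = Pos ` vars F \<union> Neg ` vars F"
  unfolding lits_def
proof (intro equalityI subsetI)
  fix a assume "a \<in> {a. lvar a \<in> vars F}"
  then show "a \<in> Pos ` vars F \<union> Neg ` vars F" by (cases a) auto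
qed auto

lemma finite_lits [simp]: "finite (lits F)"
  by (simp add: lits_eq)

lemma x_lits [simp]: "x \<in> lits F"
  using unit in_clause_in_lits by fastforce

lemma antisym: "antisym L" and trans: "trans L" and total: "total_on (lits F) L"
  using lin by (auto simp: order_on_defs)

lemma pathlex_asym: "pathlex L P Q \<Longrightarrow> \<not> pathlex L Q P"
proof -
  have "asym (L - Id)" using antisym by (auto intro!: asymI dest: antisymD)
  then show "pathlex L P Q \<Longrightarrow> \<not> pathlex L Q P"
    unfolding pathlex_def using lexord_asymmetric by metis
qed

lemma dfs_exists:
  "distinct (P @ [y]) \<Longrightarrow> set (P @ [y]) \<subseteq> lits F \<Longrightarrow> \<exists>es. dfs F L x P y es"
proof (induction "card (lits F - set P)" arbitrary: P y rule: less_induct)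
  case less
  show ?case
  proof (cases "regular (P @ [y])")
    case True
    let ?S = "candidates F (lneg x) (P @ [y]) y"
    obtain zs where zs: "increasing_listing L ?S zs"
      using increasing_listing_exists[OF lin finite_subset, of ?S] candidates_subset[of F "lneg x" "P @ [y]" y]
      by (metis Diff_subset finite_lits subset_trans)
    have "\<exists>es. dfs F L x (P @ [y]) z es" if "z \<in> set zs" for z
    proof (rule less.hyps)
      have "lits F - set (P @ [y]) \<subset> lits F - set P" using less.prems by auto
      then show "card (lits F - set (P @ [y])) < card (lits F - set P)"
        by (intro psubset_card_mono) auto
      have "z \<in> lits F - set (P @ [y])"
        using that zs candidates_subset[of F "lneg x" "P @ [y]" y] unfolding increasing_listing_def by blast
      then show "distinct ((P @ [y]) @ [z])" "set ((P @ [y]) @ [z]) \<subseteq> lits F"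
        using less.prems by auto
    qed
    then have "\<exists>es. dfs_loop F L x (P @ [y]) zs es"
    proof (induction zs)
      case Nil
      show ?case using loop_done by blast
    next
      case (Cons z zs)
      then show ?case using loop_next by (metis list.set_intros)
    qed
    then show ?thesis using dfs_branch[OF True zs] by blast
  next
    case False
    then show ?thesis using dfs_output by blast
  qed
qed

lemma enum_ex1: "\<exists>!es. enum F x L es"
proof -
  have "\<exists>es. dfs F L x [] x es" by (rule dfs_exists) simp_all
  then show ?thesis using dfs_deterministic(1)[OF antisym] unfolding enum_def by (cases "(x, lneg x) \<in> (idg F)\<^sup>*") auto
qed

text \<open>Pruning loses no path: by \<open>nr_path_suffix_reach\<close> the next vertex of a
  nearly regular path always survives the reachability test.\<close>

lemma nr_path_candidate:
  assumes "C @ y # z # R \<in> nr_paths F x"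
  shows "z \<in> candidates F (lneg x) (C @ [y]) y"
proof -
  have "is_path F (C @ y # z # R)" using assms by (simp add: nr_paths_def)
  then have "(y, z) \<in> idg F" "z \<in> lits F - set (C @ [y])"
    by (auto simp: is_path_def successively_append_iff)
  moreover have "(z, lneg x) \<in> (Restr (idg F) (lits F - set (C @ [y])))\<^sup>*"
    using nr_path_suffix_reach[of "C @ [y]" z R] assms by simp
  ultimately show ?thesis by (simp add: candidates_def)
qed

lemma is_path_candidate:
  assumes "is_path F (P @ [y])" "z \<in> candidates F t (P @ [y]) y"
  shows "is_path F ((P @ [y]) @ [z])"
  using assms by (auto simp: is_path_def candidates_def successively_append_iff)

text \<open>A call delivers exactly the nearly regular paths that continue \<open>P @ [y]\<close>.
  Outputs of different siblings first differ in the sibling itself, so processing siblings in the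
  order \<open>L\<close> gives the pathlex order.\<close>

lemma dfs_outputs:
  shows "dfs F L x P y es \<Longrightarrow> is_path F (P @ [y]) \<Longrightarrow> hd (P @ [y]) = x \<Longrightarrow> regular P \<Longrightarrow>
      set (outputs es) = {Q \<in> nr_paths F x. \<exists>R. Q = P @ y # R} \<and>
      sorted_wrt (pathlex L) (outputs es)"
    and "dfs_loop F L x P zs es \<Longrightarrow> \<forall>z\<in>set zs. is_path F (P @ [z]) \<Longrightarrow> P \<noteq> [] \<Longrightarrow> hd P = x \<Longrightarrow>
      regular P \<Longrightarrow> distinct zs \<Longrightarrow> sorted_wrt (\<lambda>a b. (a, b) \<in> L) zs \<Longrightarrow>
      set (outputs es) = {Q \<in> nr_paths F x. \<exists>z\<in>set zs. \<exists>R. Q = P @ z # R} \<and>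
      sorted_wrt (pathlex L) (outputs es)"
proof (induction rule: dfs_dfs_loop.inducts)
  case (dfs_output P y)
  have "P @ [y] \<in> nr_paths F x"
    using dfs_output by (auto simp: nr_paths_def nearly_regular_snoc regular_snoc)
  moreover from this have "R = []" if "P @ y # R \<in> nr_paths F x" for R
    using nr_path_prefix_free[of "P @ [y]" F x R F x] that by simp
  ultimately have "{Q \<in> nr_paths F x. \<exists>R. Q = P @ y # R} = {P @ [y]}" by auto
  then show ?case by (simp add: output_run_def)
next
  case (dfs_branch P y zs es)
  have zs: "set zs = candidates F (lneg x) (P @ [y]) y" "distinct zs" "sorted_wrt (\<lambda>a b. (a, b) \<in> L) zs"
    using dfs_branch by (auto simp: increasing_listing_def)
  have "\<forall>z\<in>set zs. is_path F ((P @ [y]) @ [z])"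
    using is_path_candidate dfs_branch.prems(1) zs(1) by blast
  then have IH: "set (outputs es) = {Q \<in> nr_paths F x. \<exists>z\<in>set zs. \<exists>R. Q = (P @ [y]) @ z # R} \<and>
      sorted_wrt (pathlex L) (outputs es)"
    using dfs_branch zs by simp
  have "P @ [y] \<notin> nr_paths F x"
    using dfs_branch(1) by (auto simp: nr_paths_def nearly_regular_def regular_def)
  then have "{Q \<in> nr_paths F x. \<exists>R. Q = P @ y # R} = {Q \<in> nr_paths F x. \<exists>z\<in>set zs. \<exists>R. Q = (P @ [y]) @ z # R}"
    using nr_path_candidate unfolding zs by (auto simp: neq_Nil_conv) (metis list.exhaust)
  then show ?case using IH by simp
next
  case (loop_done P)
  then show ?case by simp
next
  case (loop_next P z es zs es')
  have IH1: "set (outputs es) = {Q \<in> nr_paths F x. \<exists>R. Q = P @ z # R}" "sorted_wrt (pathlex L) (outputs es)"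
    using loop_next by (auto simp: hd_append)
  have IH2: "set (outputs es') = {Q \<in> nr_paths F x. \<exists>z\<in>set zs. \<exists>R. Q = P @ z # R}"
    "sorted_wrt (pathlex L) (outputs es')"
    using loop_next by auto
  have "pathlex L Q Q'" if "Q \<in> set (outputs es)" "Q' \<in> set (outputs es')" for Q Q'
  proof -
    have "\<exists>R. Q = P @ z # R" "\<exists>z'\<in>set zs. \<exists>R. Q' = P @ z' # R"
      using that IH1(1) IH2(1) by auto
    then obtain R z' R' where "Q = P @ z # R" "z' \<in> set zs" "Q' = P @ z' # R'" by blast
    moreover have "(z, z') \<in> L - Id" using calculation loop_next.prems by auto
    ultimately show ?thesis by (simp add: pathlex_def lexord_append_leftI)
  qed
  then show ?case using IH1 IH2 by (auto simp: sorted_wrt_append)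
qed

text \<open>The second conjunct records how prints are interleaved with outputs, as a function of
  the printing decisions alone. It later converts waiting times for outputs into waiting times for
  prints.\<close>

lemma dfs_prints:
  shows "dfs F L x P y es \<Longrightarrow>
      prints es = map path_clauses (filter (output_prints L) (outputs es)) \<and>
      filter (\<lambda>t. t \<noteq> dfs_tag) (map event_tag es) = concat (map (\<lambda>b. if b then [output_tag, print_tag] else [output_tag])
        (map (output_prints L) (outputs es)))"
    and "dfs_loop F L x P zs es \<Longrightarrow>
      prints es = map path_clauses (filter (output_prints L) (outputs es)) \<and>
      filter (\<lambda>t. t \<noteq> dfs_tag) (map event_tag es) = concat (map (\<lambda>b. if b then [output_tag, print_tag] else [output_tag])
        (map (output_prints L) (outputs es)))"
  by (induction rule: dfs_dfs_loop.inducts)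
    (auto simp: output_run_def dfs_tag_def output_tag_def print_tag_def)

lemma enum_outputs:
  assumes "enum F x L es"
  shows "set (outputs es) = nr_paths F x" "sorted_wrt (pathlex L) (outputs es)"
    "prints es = map path_clauses (filter (output_prints L) (outputs es))"
    "filter (\<lambda>t. t \<noteq> dfs_tag) (map event_tag es) = concat (map (\<lambda>b. if b then [output_tag, print_tag] else [output_tag])
        (map (output_prints L) (outputs es)))"
proof -
  have "set (outputs es) = nr_paths F x \<and> sorted_wrt (pathlex L) (outputs es)"
  proof (cases "(x, lneg x) \<in> (idg F)\<^sup>*")
    case True
    have "\<exists>R. Q = x # R" if "Q \<in> nr_paths F x" for Q
      using that by (cases Q) (auto simp: nr_paths_def)
    then have "{Q \<in> nr_paths F x. \<exists>R. Q = [] @ x # R} = nr_paths F x" by auto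
    then show ?thesis
      using dfs_outputs(1)[of "[]" x es] True assms by (simp add: enum_def is_path_def)
  next
    case False
    \<comment> \<open>By \<open>nr_path_suffix_reach\<close> for the empty prefix, a nearly regular
      path would make \<open>lneg x\<close> reachable from \<open>x\<close>.\<close>
    have "Q \<notin> nr_paths F x" for Q
    proof
      assume Q: "Q \<in> nr_paths F x"
      then obtain R where "Q = [] @ x # R" by (cases Q) (auto simp: nr_paths_def)
      then have "(x, lneg x) \<in> (Restr (idg F) (lits F))\<^sup>*"
        using nr_path_suffix_reach[of "[]" x R F x] Q by simp
      then show False using False rtrancl_mono[of "Restr (idg F) (lits F)" "idg F"] by auto
    qed
    then show ?thesis using assms False by (auto simp: enum_def)
  qed
  then show "set (outputs es) = nr_paths F x" "sorted_wrt (pathlex L) (outputs es)" by auto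
  show "prints es = map path_clauses (filter (output_prints L) (outputs es))"
    "filter (\<lambda>t. t \<noteq> dfs_tag) (map event_tag es) = concat (map (\<lambda>b. if b then [output_tag, print_tag] else [output_tag])
        (map (output_prints L) (outputs es)))"
    using assms dfs_prints(1) unfolding enum_def by (auto split: if_splits)
qed

lemma distinct_outputs:
  assumes "enum F x L es"
  shows "distinct (outputs es)"
proof -
  have "distinct Ps" if "sorted_wrt (pathlex L) Ps" for Ps
    using that by (induction Ps) (auto dest: pathlex_asym)
  then show ?thesis using enum_outputs(2)[OF assms] .
qed

text \<open>The path and its partner share \<open>A @ [u]\<close> and continue with
  \<open>hd R\<close> and \<open>lneg (last R)\<close>, different literals by regularity, so the
  comparison is decided there. Distinctness makes the last arc a unit exactly for empty
  \<open>R\<close>.\<close>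

lemma output_prints_iff:
  assumes P: "P \<in> nr_paths F x" "P = A @ u # R @ [lneg u]"
  shows "output_prints L P \<longleftrightarrow> R = [] \<or> (hd R, lneg (last R)) \<in> L"
    and "R \<noteq> [] \<Longrightarrow> hd R \<noteq> lneg (last R)"
    and "R \<noteq> [] \<Longrightarrow> pathlex L P (partner P) \<longleftrightarrow> (hd R, lneg (last R)) \<in> L"
    and "R \<noteq> [] \<Longrightarrow> pathlex L (partner P) P \<longleftrightarrow> (lneg (last R), hd R) \<in> L"
proof -
  have reg: "regular (A @ u # R)" using regular_butlast_nr[OF P(1)] P(2) by (simp add: butlast_append)
  show ne: "hd R \<noteq> lneg (last R)" if "R \<noteq> []"
  proof -
    have "hd R \<in> set R" "last R \<in> set R" using that by simp_all
    then show ?thesis using reg unfolding regular_iff by auto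
  qed
  have lex: "pathlex L (C @ a # B) (C @ b # D) \<longleftrightarrow> (a, b) \<in> L" if "a \<noteq> b" for C a b B D
  proof -
    have "irrefl (L - Id)" by (auto simp: irrefl_def)
    then show ?thesis using that by (simp add: pathlex_def)
  qed
  have form: "P = (A @ [u]) @ hd R # (tl R @ [lneg u])"
    "partner P = (A @ [u]) @ lneg (last R) # (rev (map lneg (butlast R)) @ [lneg u])" if "R \<noteq> []"
  proof -
    have R: "R = hd R # tl R" "R = butlast R @ [last R]" using that by simp_all
    show "P = (A @ [u]) @ hd R # (tl R @ [lneg u])" using P(2) R(1) by (metis append_Cons append_assoc append_Nil)
    show "partner P = (A @ [u]) @ lneg (last R) # (rev (map lneg (butlast R)) @ [lneg u])"
      unfolding partner_facts(1)[OF P] by (subst R(2)) simp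
  qed
  show lex1: "pathlex L P (partner P) \<longleftrightarrow> (hd R, lneg (last R)) \<in> L" if "R \<noteq> []"
    using form[OF that] lex ne[OF that] by metis
  show "pathlex L (partner P) P \<longleftrightarrow> (lneg (last R), hd R) \<in> L" if "R \<noteq> []"
    using form[OF that] lex ne[OF that] by metis
  have "distinct P" using P by (auto simp: nr_paths_def is_path_def)
  then have "last (u # R) = u \<longleftrightarrow> R = []" using P(2) by auto
  moreover have "last P = lneg u" "last (butlast P) = last (u # R)" using P(2) by (auto simp: butlast_append)
  ultimately have "last_arc_unit P \<longleftrightarrow> R = []" by (auto simp: last_arc_unit_def)
  then show "output_prints L P \<longleftrightarrow> R = [] \<or> (hd R, lneg (last R)) \<in> L"
    using lex1 by (auto simp: output_prints_def)
qed

text \<open>Taking the partner swaps the two literals compared. By totality of \<open>L\<close> one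
  of the two paths is printed, and by antisymmetry not both, unless they coincide.\<close>

lemma output_prints_partner:
  assumes "P \<in> nr_paths F x"
  shows "\<not> output_prints L P \<Longrightarrow> pathlex L (partner P) P \<and> output_prints L (partner P)"
    and "output_prints L P \<Longrightarrow> partner P = P \<or> pathlex L P (partner P) \<and> \<not> output_prints L (partner P)"
proof -
  obtain A u R where P: "P = A @ u # R @ [lneg u]" using assms by (rule nr_paths_cases)
  note pf = partner_facts[OF assms P]
  note 1 = output_prints_iff[OF assms P] and 2 = output_prints_iff[OF pf(2) pf(1)]
  have sub: "set R \<subseteq> lits F" using assms P by (auto simp: nr_paths_def is_path_def)
  show "pathlex L (partner P) P \<and> output_prints L (partner P)" if "\<not> output_prints L P"
  proof -
    have R: "R \<noteq> []" "(hd R, lneg (last R)) \<notin> L" using that 1(1) by auto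
    then have "hd R \<in> lits F" "lneg (last R) \<in> lits F" using sub by (auto simp: subset_iff)
    then have "(lneg (last R), hd R) \<in> L" using R 1(2) total by (metis total_on_def)
    then show ?thesis using 1(4) 2(1) R by (simp add: hd_rev last_rev hd_map last_map)
  qed
  show "partner P = P \<or> pathlex L P (partner P) \<and> \<not> output_prints L (partner P)" if "output_prints L P"
  proof (cases "R = []")
    case True
    then show ?thesis using pf(1) P by simp
  next
    case False
    then have "(hd R, lneg (last R)) \<in> L" using that 1(1) by simp
    moreover from this have "(lneg (last R), hd R) \<notin> L" using 1(2)[OF False] antisym by (auto dest: antisymD)
    ultimately show ?thesis using False 1(3) 2(1) by (simp add: hd_rev last_rev hd_map last_map)
  qed
qed

text \<open>By \<open>same_path_clauses\<close> the only competitor is the partner, which comes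
  later if it differs.\<close>

lemma first_path_printed:
  assumes P: "P \<in> nr_paths F x" "output_prints L P"
  shows "first_path L F x (path_clauses P) = P"
  unfolding first_path_def
proof (rule the_equality)
  show "P \<in> nr_paths F x \<and> path_clauses P = path_clauses P \<and>
      (\<forall>Q\<in>nr_paths F x. path_clauses Q = path_clauses P \<longrightarrow> Q = P \<or> pathlex L P Q)"
    using P same_path_clauses[OF P(1)] output_prints_partner(2)[OF P] by metis
next
  fix Q assume Q: "Q \<in> nr_paths F x \<and> path_clauses Q = path_clauses P \<and>
      (\<forall>Q'\<in>nr_paths F x. path_clauses Q' = path_clauses P \<longrightarrow> Q' = Q \<or> pathlex L Q Q')"
  then have "P = Q \<or> pathlex L Q P" using P by blast
  then show "Q = P"
    using Q P same_path_clauses[OF P(1)] output_prints_partner(2)[OF P] pathlex_asym by metis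
qed

lemma enum_correct:
  assumes es: "enum F x L es"
  shows "distinct (outputs es) \<and> set (outputs es) = nr_paths F x \<and>
    sorted_wrt (pathlex L) (outputs es) \<and>
    distinct (prints es) \<and> set (prints es) = mus_with x F \<and>
    sorted_wrt (muslex_from L F x) (prints es) \<and>
    sorted_wrt (\<lambda>F' F''. least_unit L F' = x \<and> least_unit L F'' = x \<longrightarrow> muslex L F F' F'')
      (prints es) \<and>
    (\<forall>F'\<in>mus_with x F. \<exists>P. output_prints L P \<and>
       (filter (\<lambda>Q. path_clauses Q = F') (outputs es) = [P] \<or>
        (\<exists>P'. filter (\<lambda>Q. path_clauses Q = F') (outputs es) = [P, P'] \<and>
              \<not> output_prints L P')))"
proof (intro conjI ballI)
  note eo = enum_outputs[OF es]
  let ?S = "filter (output_prints L) (outputs es)"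
  show "distinct (outputs es)" using distinct_outputs[OF es] .
  show "set (outputs es) = nr_paths F x" "sorted_wrt (pathlex L) (outputs es)" using eo by auto
  have "inj_on path_clauses (set ?S)"
  proof (rule inj_onI)
    fix P Q assume "P \<in> set ?S" "Q \<in> set ?S" and eq: "path_clauses P = path_clauses Q"
    then have "P \<in> nr_paths F x" "output_prints L P" "Q \<in> nr_paths F x" "output_prints L Q"
      using eo(1) by auto
    then show "P = Q" using same_path_clauses[OF _ _ eq] output_prints_partner(2) by metis
  qed
  then show "distinct (prints es)" unfolding eo(3) distinct_map using distinct_outputs[OF es] by simp
  have sortedS: "sorted_wrt (pathlex L) ?S" using eo(2) by (rule sorted_wrt_filter)
  show muslex: "sorted_wrt (muslex_from L F x) (prints es)"
    unfolding eo(3) sorted_wrt_map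
    by (rule sorted_wrt_mono_rel[OF _ sortedS]) (use eo(1) in \<open>simp add: muslex_from_def first_path_printed\<close>)
  \<comment> \<open>Where both least unit-clauses are \<open>{x}\<close>, the two orders compare the
    same first paths.\<close>
  then show "sorted_wrt (\<lambda>F' F''. least_unit L F' = x \<and> least_unit L F'' = x \<longrightarrow> muslex L F F' F'') (prints es)"
    by (rule sorted_wrt_mono_rel[rotated]) (auto simp: muslex_def muslex_from_def)
  have main: "\<exists>P. P \<in> nr_paths F x \<and> output_prints L P \<and> path_clauses P = F'" if F': "F' \<in> mus_with x F" for F'
  proof -
    obtain P where "P \<in> nr_paths F x" "F' = path_clauses P"
      using F' unfolding mus_with_eq[OF sizes unit] by blast
    then show ?thesis
      using output_prints_partner(1)[of P] partner_facts(2) path_clauses_partner nr_paths_cases by metis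
  qed
  show "set (prints es) = mus_with x F"
  proof
    show "set (prints es) \<subseteq> mus_with x F" unfolding eo(3) mus_with_eq[OF sizes unit] using eo(1) by auto
    show "mus_with x F \<subseteq> set (prints es)" unfolding eo(3) using eo(1) main by fastforce
  qed
  fix F' assume "F' \<in> mus_with x F"
  then obtain P where P: "P \<in> nr_paths F x" "output_prints L P" "path_clauses P = F'" using main by blast
  let ?l = "filter (\<lambda>Q. path_clauses Q = F') (outputs es)"
  have part: "partner P \<in> nr_paths F x" using P(1) by (metis partner_facts(2) nr_paths_cases)
  have set: "set ?l = {P, partner P}"
  proof -
    have "Q \<in> set ?l \<longleftrightarrow> Q = P \<or> Q = partner P" for Q
      using eo(1) P part same_path_clauses[OF P(1), of Q F] path_clauses_partner[OF P(1)] by auto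
    then show ?thesis by auto
  qed
  have dis: "distinct ?l" using distinct_outputs[OF es] by simp
  show "\<exists>P. output_prints L P \<and> (?l = [P] \<or> (\<exists>P'. ?l = [P, P'] \<and> \<not> output_prints L P'))"
  proof (cases "partner P = P")
    case True
    then have "?l = [P]" using set dis by (cases ?l; cases "tl ?l") (auto simp: insert_eq_iff)
    then show ?thesis using P by blast
  next
    case False
    then have *: "pathlex L P (partner P)" "\<not> output_prints L (partner P)"
      using output_prints_partner(2)[OF P(1,2)] by auto
    have "?l = [P, partner P]"
      by (rule sorted_wrt_pair[OF sorted_wrt_filter[OF eo(2)] dis set]) (use False * pathlex_asym in auto)
    then show ?thesis using P * by blast
  qed
qed

text \<open>\<open>partner\<close> maps the ignored paths of an initial segment injectively to
  printed paths of the same segment, since the partner of an ignored path precedes it in the sorted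
  list.\<close>

lemma outputs_ballot:
  assumes es: "enum F x L es"
  shows "length (filter (\<lambda>P. \<not> output_prints L P) (take i (outputs es)))
    \<le> length (filter (output_prints L) (take i (outputs es)))"
proof -
  note eo = enum_outputs[OF es]
  let ?T = "take i (outputs es)"
  have dis: "distinct ?T" using distinct_outputs[OF es] by simp
  have sorted: "sorted_wrt (pathlex L) (?T @ drop i (outputs es))" using eo(2) by simp
  have sub: "set ?T \<subseteq> nr_paths F x" using eo(1) set_take_subset by fast
  let ?N = "{P \<in> set ?T. \<not> output_prints L P}" and ?Y = "{P \<in> set ?T. output_prints L P}"
  have "partner ` ?N \<subseteq> ?Y"
  proof
    fix Q assume "Q \<in> partner ` ?N"
    then obtain P where P: "P \<in> set ?T" "\<not> output_prints L P" "Q = partner P" by auto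
    then have PT: "P \<in> nr_paths F x" using sub by auto
    then have "pathlex L Q P" "output_prints L Q" using output_prints_partner(1) P by auto
    moreover have "Q \<in> nr_paths F x" using PT P(3) by (metis partner_facts(2) nr_paths_cases)
    then have "Q \<in> set (?T @ drop i (outputs es))" using eo(1) by simp
    \<comment> \<open>\<open>Q\<close> occurs among all outputs; in the dropped part it would come
      after \<open>P\<close>, against \<open>pathlex L Q P\<close>.\<close>
    ultimately show "Q \<in> ?Y" using sorted P(1) pathlex_asym unfolding sorted_wrt_append by (auto simp del: append_take_drop_id)
  qed
  moreover have "inj_on partner ?N" 
    by (rule inj_on_inverseI[of _ partner]) (use sub partner_partner in blast)
  ultimately have "card ?N \<le> card ?Y" 
    by (intro card_inj_on_le[of partner]) auto
  moreover have "length (filter p ?T) = card {P \<in> set ?T. p P}" for p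
    using distinct_card[OF distinct_filter[OF dis]] by (metis set_filter)
  ultimately show ?thesis by simp
qed

end

section \<open>Runs of while-programs\<close>

text \<open>The weights are chosen so that evaluation in a memory with values at most
  \<open>B\<close> produces only words up to the size times \<open>B\<close>. A constant
  \<open>k\<close> weighs \<open>k + 1\<close>, which suffices because \<open>B\<close> is
  positive.\<close>

primrec aexp_size :: "aexp \<Rightarrow> nat" where
  "aexp_size (Const k) = Suc k"
| "aexp_size (Cell a e) = Suc (aexp_size e)"
| "aexp_size (Add e e') = aexp_size e + aexp_size e'"
| "aexp_size (Sub e e') = aexp_size e + aexp_size e'"

primrec bexp_size :: "bexp \<Rightarrow> nat" where
  "bexp_size (Less e e') = aexp_size e + aexp_size e'"
| "bexp_size (Equal e e') = aexp_size e + aexp_size e'"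
| "bexp_size (Not b) = bexp_size b"
| "bexp_size (And b b') = bexp_size b + bexp_size b'"

primrec max_exp_size :: "com \<Rightarrow> nat" where
  "max_exp_size Skip = 0"
| "max_exp_size (Store a i e) = aexp_size i + aexp_size e"
| "max_exp_size (Seq c c') = max (max_exp_size c) (max_exp_size c')"
| "max_exp_size (If b c c') = max (bexp_size b) (max (max_exp_size c) (max_exp_size c'))"
| "max_exp_size (While b c) = max (bexp_size b) (max_exp_size c)"
| "max_exp_size (Emit t a e) = Suc (aexp_size e)"

primrec aexp_arrays :: "aexp \<Rightarrow> nat set" where
  "aexp_arrays (Const k) = {}"
| "aexp_arrays (Cell a e) = insert a (aexp_arrays e)"
| "aexp_arrays (Add e e') = aexp_arrays e \<union> aexp_arrays e'"
| "aexp_arrays (Sub e e') = aexp_arrays e \<union> aexp_arrays e'"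

primrec bexp_arrays :: "bexp \<Rightarrow> nat set" where
  "bexp_arrays (Less e e') = aexp_arrays e \<union> aexp_arrays e'"
| "bexp_arrays (Equal e e') = aexp_arrays e \<union> aexp_arrays e'"
| "bexp_arrays (Not b) = bexp_arrays b"
| "bexp_arrays (And b b') = bexp_arrays b \<union> bexp_arrays b'"

primrec arrays :: "com \<Rightarrow> nat set" where
  "arrays Skip = {}"
| "arrays (Store a i e) = insert a (aexp_arrays i \<union> aexp_arrays e)"
| "arrays (Seq c c') = arrays c \<union> arrays c'"
| "arrays (If b c c') = bexp_arrays b \<union> arrays c \<union> arrays c'"
| "arrays (While b c) = bexp_arrays b \<union> arrays c"
| "arrays (Emit t a e) = insert a (aexp_arrays e)"

primrec stored :: "com \<Rightarrow> nat set" where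
  "stored Skip = {}"
| "stored (Store a i e) = {a}"
| "stored (Seq c c') = stored c \<union> stored c'"
| "stored (If b c c') = stored c \<union> stored c'"
| "stored (While b c) = stored c"
| "stored (Emit t a e) = {}"

definition bounded :: "nat \<Rightarrow> mem \<Rightarrow> bool" where
  "bounded B m \<longleftrightarrow> 1 \<le> B \<and> (\<forall>a i. m a i \<le> B)"

lemma boundedD: "bounded B m \<Longrightarrow> m a i \<le> B" "bounded B m \<Longrightarrow> Suc 0 \<le> B" "bounded B m \<Longrightarrow> 0 < B"
  by (simp_all add: bounded_def)

lemma bounded_update: "bounded B m \<Longrightarrow> v \<le> B \<Longrightarrow> bounded B (m(a := (m a)(i := v)))"
  by (simp add: bounded_def)

lemma aval_in_awords: "aval e m \<in> awords e m"
  by (cases e) auto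

lemma awords_le: "bounded B m \<Longrightarrow> w \<in> awords e m \<Longrightarrow> w \<le> aexp_size e * B"
proof (induction e arbitrary: w)
  case (Const k)
  then show ?case using mult_le_mono2[of 1 B k] boundedD(2)[of B m] by (simp add: trans_le_add2)
next
  case (Cell a e)
  then show ?case using boundedD(1)[of B m a "aval e m"] by (auto intro: trans_le_add1 trans_le_add2)
next
  case (Add e e')
  have "aval e m \<le> aexp_size e * B" "aval e' m \<le> aexp_size e' * B"
    using Add aval_in_awords by blast+
  then show ?case using Add by (auto simp: add_mult_distrib intro: trans_le_add1 trans_le_add2 add_mono)
next
  case (Sub e e')
  have "aval e m \<le> aexp_size e * B" using Sub aval_in_awords by blast
  then show ?case using Sub by (auto simp: add_mult_distrib intro: trans_le_add1 trans_le_add2)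
qed

lemma bwords_le: "bounded B m \<Longrightarrow> w \<in> bwords b m \<Longrightarrow> w \<le> bexp_size b * B"
proof (induction b)
  case (Less e e')
  then show ?case using awords_le[of B m w e] awords_le[of B m w e']
    by (auto simp: add_mult_distrib intro: trans_le_add1 trans_le_add2)
next
  case (Equal e e')
  then show ?case using awords_le[of B m w e] awords_le[of B m w e']
    by (auto simp: add_mult_distrib intro: trans_le_add1 trans_le_add2)
qed (auto simp: add_mult_distrib intro: trans_le_add1 trans_le_add2)

lemma words_iff: "w \<in> words tr \<longleftrightarrow> (\<exists>M W. Tick M W \<in> set tr \<and> w \<in> W)"
proof
  assume "\<exists>M W. Tick M W \<in> set tr \<and> w \<in> W"
  then obtain M W where "Tick M W \<in> set tr" "w \<in> W" by blast
  then have "wds (Tick M W) \<in> {wds i | i. i \<in> set tr \<and> (\<exists>M W. i = Tick M W)}" "w \<in> wds (Tick M W)"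
    by blast (simp add: \<open>w \<in> W\<close>)
  then show "w \<in> words tr" unfolding words_def by blast
next
  assume "w \<in> words tr"
  then obtain i M W where "i \<in> set tr" "i = Tick M W" "w \<in> wds i" unfolding words_def by blast
  then show "\<exists>M W. Tick M W \<in> set tr \<and> w \<in> W" by (intro exI[of _ M] exI[of _ W]) simp
qed

lemma words_eq: "words tr = (\<Union>i\<in>set tr. case i of Tick M W \<Rightarrow> W | Emitted t ws \<Rightarrow> {})"
proof (intro equalityI subsetI)
  fix w assume "w \<in> (\<Union>i\<in>set tr. case i of Tick M W \<Rightarrow> W | Emitted t ws \<Rightarrow> {})"
  then obtain i where "i \<in> set tr" "w \<in> (case i of Tick M W \<Rightarrow> W | Emitted t ws \<Rightarrow> {})" by blast
  moreover from this(2) obtain M W where "i = Tick M W" "w \<in> W" by (auto split: item.splits)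
  ultimately show "w \<in> words tr" unfolding words_iff by blast
next
  fix w assume "w \<in> words tr"
  then obtain M W where "Tick M W \<in> set tr" "w \<in> W" unfolding words_iff by blast
  then show "w \<in> (\<Union>i\<in>set tr. case i of Tick M W \<Rightarrow> W | Emitted t ws \<Rightarrow> {})"
    by (intro UN_I[of "Tick M W"]) simp_all
qed

lemma words_Nil [simp]: "words [] = {}"
  by (simp add: words_def)

lemma words_Cons [simp]: "words (Tick M W # tr) = W \<union> words tr" "words (Emitted t ws # tr) = words tr"
  by (simp_all add: words_eq)

lemma words_append [simp]: "words (tr @ tr') = words tr \<union> words tr'"
  by (simp add: words_eq)

lemma words_emit: "words (map (\<lambda>i. Tick {(a, i)} {i, m a i}) xs) = set xs \<union> m a ` set xs"
  by (induction xs) auto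

text \<open>Total correctness with the trace visible to the postcondition. The memory bound, the
  bound on handled words and the frame of unwritten arrays are built in, so that the rules propagate
  them silently. The limit 16 on expression sizes is checked once for the whole program; its largest
  expression, the comparison of ranks, has size 14.\<close>

definition gwp :: "nat \<Rightarrow> com \<Rightarrow> (item list \<Rightarrow> mem \<Rightarrow> bool) \<Rightarrow> mem \<Rightarrow> bool" where
  "gwp B c Q m \<longleftrightarrow> (max_exp_size c \<le> 16 \<longrightarrow> bounded B m \<longrightarrow>
    (\<exists>tr m'. exec c m tr m' \<and> bounded B m' \<and> words tr \<subseteq> {..16 * B} \<and>
      (\<forall>a. a \<notin> stored c \<longrightarrow> m' a = m a) \<and> Q tr m'))"

lemma gwp_conseq:
  assumes "gwp B c Q m"
    "\<And>tr m'. Q tr m' \<Longrightarrow> bounded B m' \<Longrightarrow> \<forall>a. a \<notin> stored c \<longrightarrow> m' a = m a \<Longrightarrow> R tr m'"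
  shows "gwp B c R m"
  using assms unfolding gwp_def by meson

lemma words_le_mono: "(\<And>w. w \<in> S \<Longrightarrow> w \<le> k * B) \<Longrightarrow> k \<le> 16 \<Longrightarrow> S \<subseteq> {..16 * (B :: nat)}"
  by (meson atMost_iff le_trans mult_le_mono1 subsetI)

lemma gwp_Skip: "Q [Tick {} {}] m \<Longrightarrow> gwp B Skip Q m"
  unfolding gwp_def using exec.Skip by fastforce

lemma gwp_Store:
  assumes "bounded B m \<Longrightarrow> aval e m \<le> B"
    "Q [Tick ({(a, aval i m)} \<union> acells i m \<union> acells e m) (awords i m \<union> awords e m)] (m(a := (m a)(aval i m := aval e m)))"
  shows "gwp B (Store a i e) Q m"
proof -
  have "awords i m \<union> awords e m \<subseteq> {..16 * B}"
    if "bounded B m" "aexp_size i + aexp_size e \<le> 16"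
    using that awords_le[OF that(1)]
    by (intro words_le_mono[of _ "aexp_size i + aexp_size e"])
      (auto simp: add_mult_distrib intro: trans_le_add1 trans_le_add2)
  then show ?thesis unfolding gwp_def
    using assms exec.Store[of a i e m] bounded_update[of B m "aval e m" a "aval i m"]
    by (intro impI exI conjI) auto
qed

lemma gwp_Seq:
  assumes "gwp B c (\<lambda>tr m'. gwp B c' (\<lambda>tr' m''. Q (tr @ tr') m'') m') m"
  shows "gwp B (Seq c c') Q m"
  unfolding gwp_def
proof (intro impI)
  assume *: "max_exp_size (Seq c c') \<le> 16" "bounded B m"
  then obtain tr m' where 1: "exec c m tr m'" "bounded B m'" "words tr \<subseteq> {..16 * B}"
    "\<forall>a. a \<notin> stored c \<longrightarrow> m' a = m a" "gwp B c' (\<lambda>tr' m''. Q (tr @ tr') m'') m'"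
    using assms unfolding gwp_def[of B c] by auto
  then obtain tr' m'' where 2: "exec c' m' tr' m''" "bounded B m''" "words tr' \<subseteq> {..16 * B}"
    "\<forall>a. a \<notin> stored c' \<longrightarrow> m'' a = m' a" "Q (tr @ tr') m''"
    using * unfolding gwp_def by auto
  then show "\<exists>tr m'. exec (Seq c c') m tr m' \<and> bounded B m' \<and> words tr \<subseteq> {..16 * B} \<and>
      (\<forall>a. a \<notin> stored (Seq c c') \<longrightarrow> m' a = m a) \<and> Q tr m'"
    using 1 by (intro exI[of _ "tr @ tr'"] exI[of _ m'']) (auto intro: exec.Seq)
qed

lemma test_words_le: "bounded B m \<Longrightarrow> bexp_size b \<le> 16 \<Longrightarrow> bwords b m \<subseteq> {..16 * B}"
  using bwords_le by (intro words_le_mono) auto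

lemma gwp_If:
  assumes "bval b m \<Longrightarrow> gwp B c (\<lambda>tr. Q (Tick (bcells b m) (bwords b m) # tr)) m"
    "\<not> bval b m \<Longrightarrow> gwp B c' (\<lambda>tr. Q (Tick (bcells b m) (bwords b m) # tr)) m"
  shows "gwp B (If b c c') Q m"
  unfolding gwp_def
proof (intro impI)
  assume *: "max_exp_size (If b c c') \<le> 16" "bounded B m"
  note t = test_words_le[OF *(2), of b]
  show "\<exists>tr m'. exec (If b c c') m tr m' \<and> bounded B m' \<and> words tr \<subseteq> {..16 * B} \<and>
      (\<forall>a. a \<notin> stored (If b c c') \<longrightarrow> m' a = m a) \<and> Q tr m'"
  proof (cases "bval b m")
    case True
    from assms(1)[OF this] * obtain tr m' where "exec c m tr m'" "bounded B m'" "words tr \<subseteq> {..16 * B}"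
      "\<forall>a. a \<notin> stored c \<longrightarrow> m' a = m a" "Q (Tick (bcells b m) (bwords b m) # tr) m'"
      unfolding gwp_def by auto
    then show ?thesis using * t True
      by (intro exI[of _ "Tick (bcells b m) (bwords b m) # tr"] exI[of _ m']) (simp add: exec.If_True)
  next
    case False
    from assms(2)[OF this] * obtain tr m' where "exec c' m tr m'" "bounded B m'" "words tr \<subseteq> {..16 * B}"
      "\<forall>a. a \<notin> stored c' \<longrightarrow> m' a = m a" "Q (Tick (bcells b m) (bwords b m) # tr) m'"
      unfolding gwp_def by auto
    then show ?thesis using * t False
      by (intro exI[of _ "Tick (bcells b m) (bwords b m) # tr"] exI[of _ m']) (simp add: exec.If_False)
  qed
qed

definition emit_trace :: "nat \<Rightarrow> nat \<Rightarrow> aexp \<Rightarrow> mem \<Rightarrow> item list" where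
  "emit_trace t a e m = Tick (acells e m) (awords e m)
      # map (\<lambda>i. Tick {(a, i)} {i, m a i}) [0..<aval e m]
      @ [Emitted t (map (m a) [0..<aval e m])]"

lemma gwp_Emit:
  assumes "Q (emit_trace t a e m) m"
  shows "gwp B (Emit t a e) Q m"
  unfolding gwp_def
proof (intro impI)
  assume *: "max_exp_size (Emit t a e) \<le> 16" "bounded B m"
  have e: "aval e m \<le> 16 * B" "awords e m \<subseteq> {..16 * B}"
    using awords_le[OF *(2)] *(1) words_le_mono[of "awords e m" "aexp_size e" B] aval_in_awords[of e m] by auto
  have "m a i \<le> 16 * B" for i using boundedD(1)[OF *(2), of a i] by simp
  then have "words (emit_trace t a e m) \<subseteq> {..16 * B}"
    using e unfolding emit_trace_def words_Cons words_append words_emit by auto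
  then show "\<exists>tr m'. exec (Emit t a e) m tr m' \<and> bounded B m' \<and> words tr \<subseteq> {..16 * B} \<and>
      (\<forall>a'. a' \<notin> stored (Emit t a e) \<longrightarrow> m' a' = m a') \<and> Q tr m'"
    using assms * exec.Emit[of t a e m] unfolding emit_trace_def by blast
qed

section \<open>Silent commands with a clock\<close>

definition silent :: "item list \<Rightarrow> bool" where
  "silent tr \<longleftrightarrow> (\<forall>i\<in>set tr. \<exists>M W. i = Tick M W)"

lemma silent_simps [simp]:
  "silent []" "silent (Tick M W # tr) \<longleftrightarrow> silent tr" "silent (tr @ tr') \<longleftrightarrow> silent tr \<and> silent tr'"
  by (auto simp: silent_def)

text \<open>The last argument is a clock: silent runs are specified by what holds of the final memory and
  the time at which it is reached.\<close>
definition wp :: "nat \<Rightarrow> com \<Rightarrow> (mem \<Rightarrow> nat \<Rightarrow> bool) \<Rightarrow> mem \<Rightarrow> nat \<Rightarrow> bool" where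
  "wp B c Q m t \<longleftrightarrow> gwp B c (\<lambda>tr m'. silent tr \<and> Q m' (t + length tr)) m"

lemma wp_conseq:
  assumes "wp B c Q m t"
    "\<And>m' t'. Q m' t' \<Longrightarrow> bounded B m' \<Longrightarrow> \<forall>a. a \<notin> stored c \<longrightarrow> m' a = m a \<Longrightarrow> R m' t'"
  shows "wp B c R m t"
  using assms unfolding wp_def by (elim gwp_conseq) blast

lemma wp_Skip: "Q m (Suc t) \<Longrightarrow> wp B Skip Q m t"
  unfolding wp_def by (rule gwp_Skip) simp

lemma wp_Store:
  "(bounded B m \<Longrightarrow> aval e m \<le> B) \<Longrightarrow> Q (m(a := (m a)(aval i m := aval e m))) (Suc t) \<Longrightarrow>
    wp B (Store a i e) Q m t"
  unfolding wp_def by (rule gwp_Store) simp_all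

lemma wp_Seq: "wp B c (\<lambda>m' t'. wp B c' Q m' t') m t \<Longrightarrow> wp B (Seq c c') Q m t"
  unfolding wp_def by (intro gwp_Seq, elim gwp_conseq) (auto simp: add.assoc elim: gwp_conseq)

lemma wp_If:
  "(bval b m \<Longrightarrow> wp B c Q m (Suc t)) \<Longrightarrow> (\<not> bval b m \<Longrightarrow> wp B c' Q m (Suc t)) \<Longrightarrow>
    wp B (If b c c') Q m t"
  unfolding wp_def by (intro gwp_If) simp_all

text \<open>Termination needs no separate measure: the clock advances in each iteration, and the invariant
  bounds it.\<close>
lemma wp_While:
  assumes init: "I m0 t0"
    and clock: "\<And>m t. I m t \<Longrightarrow> t \<le> T"
    and body: "\<And>m t. I m t \<Longrightarrow> bounded B m \<Longrightarrow> \<forall>a. a \<notin> stored c \<longrightarrow> m a = m0 a \<Longrightarrow> bval b m \<Longrightarrow>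
      wp B c I m (Suc t)"
    and exit: "\<And>m t. I m t \<Longrightarrow> bounded B m \<Longrightarrow> \<forall>a. a \<notin> stored c \<longrightarrow> m a = m0 a \<Longrightarrow> \<not> bval b m \<Longrightarrow>
      Q m (Suc t)"
  shows "wp B (While b c) Q m0 t0"
proof -
  have "\<exists>tr m'. exec (While b c) m tr m' \<and> bounded B m' \<and> words tr \<subseteq> {..16 * B} \<and>
      (\<forall>a. a \<notin> stored c \<longrightarrow> m' a = m0 a) \<and> silent tr \<and> Q m' (t + length tr)"
    if "I m t" "bounded B m" "\<forall>a. a \<notin> stored c \<longrightarrow> m a = m0 a" "max_exp_size (While b c) \<le> 16" for m t
    using that
  proof (induction "Suc T - t" arbitrary: m t rule: less_induct)
    case less
    note t = test_words_le[OF less.prems(2), of b]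
    show ?case
    proof (cases "bval b m")
      case True
      then have "gwp B c (\<lambda>tr m'. silent tr \<and> I m' (Suc t + length tr)) m"
        using body[OF less.prems(1-3)] unfolding wp_def by simp
      then obtain tr m' where 1: "exec c m tr m'" "bounded B m'" "words tr \<subseteq> {..16 * B}"
        "\<forall>a. a \<notin> stored c \<longrightarrow> m' a = m a" "silent tr" "I m' (Suc t + length tr)"
        using less.prems unfolding gwp_def by auto
      have "\<exists>tr' m''. exec (While b c) m' tr' m'' \<and> bounded B m'' \<and> words tr' \<subseteq> {..16 * B} \<and>
          (\<forall>a. a \<notin> stored c \<longrightarrow> m'' a = m0 a) \<and> silent tr' \<and> Q m'' (Suc t + length tr + length tr')"
        using less.prems clock[OF less.prems(1)] 1 by (intro less.hyps) auto
      then obtain tr' m'' where 2: "exec (While b c) m' tr' m''" "bounded B m''" "words tr' \<subseteq> {..16 * B}"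
        "\<forall>a. a \<notin> stored c \<longrightarrow> m'' a = m0 a" "silent tr'" "Q m'' (Suc t + length tr + length tr')"
        by blast
      show ?thesis
        using exec.While_True[OF True 1(1) 2(1)] 1 2 t less.prems(4)
        by (intro exI[of _ "Tick (bcells b m) (bwords b m) # tr @ tr'"] exI[of _ m'']) (simp add: add.assoc)
    next
      case False
      then show ?thesis
        using exec.While_False[OF False] exit[OF less.prems(1-3)] less.prems t
        by (intro exI[of _ "[Tick (bcells b m) (bwords b m)]"] exI[of _ m]) simp
    qed
  qed
  then show ?thesis using init unfolding wp_def gwp_def by simp
qed

lemmas wp_intros = wp_Seq wp_Store wp_If wp_Skip

text \<open>Some iterations of the loop in continuation form: every complete run from
  \<open>m'\<close> extends to one from \<open>m\<close>. Calls of \<open>dfs\<close> correspond to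
  such stretches, not to complete executions of any command.\<close>

definition loop_steps :: "nat \<Rightarrow> bexp \<Rightarrow> com \<Rightarrow> mem \<Rightarrow> item list \<Rightarrow> mem \<Rightarrow> bool" where
  "loop_steps B b c m tr m' \<longleftrightarrow> bounded B m' \<and> words tr \<subseteq> {..16 * B} \<and>
    (\<forall>tr' m''. exec (While b c) m' tr' m'' \<longrightarrow> exec (While b c) m (tr @ tr') m'')"

lemma loop_steps_refl: "bounded B m \<Longrightarrow> loop_steps B b c m [] m"
  by (simp add: loop_steps_def)

lemma loop_steps_trans:
  "loop_steps B b c m tr m' \<Longrightarrow> loop_steps B b c m' tr' m'' \<Longrightarrow> loop_steps B b c m (tr @ tr') m''"
  by (simp add: loop_steps_def)

lemma loop_steps_body:
  assumes "gwp B c Q m" "bval b m" "bounded B m" "max_exp_size (While b c) \<le> 16"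
  shows "\<exists>tr m'. loop_steps B b c m (Tick (bcells b m) (bwords b m) # tr) m' \<and> Q tr m'"
proof -
  obtain tr m' where 1: "exec c m tr m'" "bounded B m'" "words tr \<subseteq> {..16 * B}" "Q tr m'"
    using assms unfolding gwp_def by auto
  then have "loop_steps B b c m (Tick (bcells b m) (bwords b m) # tr) m'"
    using test_words_le[OF assms(3), of b] assms(2,4) exec.While_True[OF assms(2) 1(1)]
    by (simp add: loop_steps_def)
  then show ?thesis using 1(4) by blast
qed

section \<open>Space from the size of words\<close>

lemma acells_subset: "acells e m \<subseteq> aexp_arrays e \<times> awords e m"
proof (induction e)
  case (Cell a e)
  then show ?case using aval_in_awords[of e m] by auto
qed auto

lemma bcells_subset: "bcells b m \<subseteq> bexp_arrays b \<times> bwords b m"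
proof (induction b)
  case (Less e e')
  then show ?case using acells_subset[of e m] acells_subset[of e' m] by auto
next
  case (Equal e e')
  then show ?case using acells_subset[of e m] acells_subset[of e' m] by auto
qed auto

text \<open>The index of each accessed cell is computed in the same time unit and hence is among its
  words; the array name is part of the program text.\<close>

lemma exec_cells:
  "exec c m tr m' \<Longrightarrow> Tick M W \<in> set tr \<Longrightarrow> M \<subseteq> arrays c \<times> W"
proof (induction arbitrary: M W rule: exec.induct)
  case (Store a i e m)
  then show ?case
    using acells_subset[of e m] acells_subset[of i m] aval_in_awords[of i m] by auto
next
  case (If_True b m c tr m' c')
  then show ?case using bcells_subset[of b m] by auto
next
  case (If_False b m c' tr m' c)
  then show ?case using bcells_subset[of b m] by auto
next
  case (While_False b m c)
  then show ?case using bcells_subset[of b m] by auto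
next
  case (While_True b m c tr m' tr' m'')
  then consider "M = bcells b m" "W = bwords b m" | "Tick M W \<in> set tr" | "Tick M W \<in> set tr'" by auto
  then show ?case
    using bcells_subset[of b m] While_True.IH by cases (simp, blast, simp, blast, simp)
next
  case (Emit t a e m)
  then show ?case using acells_subset[of e m] by auto
next
  case (Seq c m tr m' c' tr' m'')
  then consider "Tick M W \<in> set tr" | "Tick M W \<in> set tr'" by auto
  then show ?case using Seq.IH by cases (simp, blast)+
qed auto

lemma finite_arrays [simp]: "finite (arrays c)"
proof -
  have a: "finite (aexp_arrays e)" for e by (induction e) auto
  have b: "finite (bexp_arrays b)" for b by (induction b) (auto simp: a)
  show ?thesis by (induction c) (auto simp: a b)
qed

lemma space_le:
  assumes "exec c m tr m'" "words tr \<subseteq> {..W}"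
  shows "space tr \<le> card (arrays c) * Suc W"
proof -
  have "\<Union>{cells i | i. i \<in> set tr \<and> (\<exists>M W. i = Tick M W)} \<subseteq> arrays c \<times> {..W}"
  proof
    fix p assume "p \<in> \<Union>{cells i | i. i \<in> set tr \<and> (\<exists>M W. i = Tick M W)}"
    then obtain M V where "Tick M V \<in> set tr" "p \<in> M" by auto
    moreover from this have "V \<subseteq> {..W}" using assms(2) by (auto simp: words_iff subset_iff)
    ultimately show "p \<in> arrays c \<times> {..W}" using exec_cells[OF assms(1)] by blast
  qed
  then have "space tr \<le> card (arrays c \<times> {..W})"
    unfolding space_def by (intro card_mono) auto
  then show ?thesis by (simp add: card_cartesian_product)
qed

section \<open>Waiting times and gaps between prints\<close>

lemma waits_nonempty [simp]: "waits t tr \<noteq> []"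
  by (induction t tr rule: waits.induct) auto

text \<open>The open final wait of the first trace merges with the initial wait of the
  second.\<close>

lemma waits_append:
  "waits t (tr @ tr') = butlast (waits t tr) @ (last (waits t tr) + hd (waits t tr')) # tl (waits t tr')"
proof (induction t tr rule: waits.induct)
  case (2 t M W tr)
  then show ?case by (cases "waits t tr") (auto split: if_splits)
qed auto

lemma waits_silent [simp]: "silent tr \<Longrightarrow> waits t tr = [length tr]"
proof (induction tr)
  case (Cons i tr)
  then show ?case by (cases i) (auto simp: silent_def)
qed simp

lemma silent_emit: "silent (map (\<lambda>i. Tick {(a, i)} {i, m a i}) xs)"
  by (auto simp: silent_def)

lemma waits_emit_trace:
  "waits t (emit_trace s a e m) = (if s = t then [Suc (aval e m), 0] else [Suc (aval e m)])"
  unfolding emit_trace_def by (simp add: waits_append silent_emit)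

lemma emissions_simps [simp]:
  "emissions [] = []" "emissions (Tick M W # tr) = emissions tr"
  "emissions (Emitted t ws # tr) = (t, ws) # emissions tr"
  "emissions (tr @ tr') = emissions tr @ emissions tr'"
  by (auto simp: emissions_def)

lemma emissions_silent [simp]: "silent tr \<Longrightarrow> emissions tr = []"
  by (auto simp: emissions_def silent_def split: item.splits)

lemma emissions_emit_trace [simp]: "emissions (emit_trace t a e m) = [(t, map (m a) [0..<aval e m])]"
  unfolding emit_trace_def by (simp add: silent_emit)

text \<open>The analogue of \<open>waits print_tag\<close> in which the unit of time is one
  output.\<close>

fun output_gaps :: "nat list \<Rightarrow> nat list" where
  "output_gaps [] = [0]"
| "output_gaps (t # ts) =
    (if t = print_tag then 0 # output_gaps ts
     else if t = output_tag then Suc (hd (output_gaps ts)) # tl (output_gaps ts)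
     else output_gaps ts)"

lemma output_gaps_nonempty [simp]: "output_gaps ts \<noteq> []"
  by (induction ts) auto

text \<open>A gap between prints that contains \<open>g\<close> outputs is composed of at most
  \<open>g + 1\<close> waits for outputs. The sharper bound for the head, with the current wait in
  place of \<open>T\<close>, makes the induction pass a single tick.\<close>

lemma waits_print_le:
  assumes "\<forall>g\<in>set (waits output_tag tr). g \<le> T"
  shows "list_all2 (\<lambda>p g. p \<le> T * g + T) (tl (waits print_tag tr)) (tl (output_gaps (map fst (emissions tr)))) \<and>
    hd (waits print_tag tr) \<le> T * hd (output_gaps (map fst (emissions tr))) + hd (waits output_tag tr)"
  using assms
proof (induction tr)
  case (Cons i tr)
  obtain w ws where w: "waits output_tag tr = w # ws" by (cases "waits output_tag tr") auto
  obtain p ps where p: "waits print_tag tr = p # ps" by (cases "waits print_tag tr") auto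
  obtain g gs where g: "output_gaps (map fst (emissions tr)) = g # gs"
    by (cases "output_gaps (map fst (emissions tr))") auto
  have le: "\<forall>g\<in>set (waits output_tag tr). g \<le> T"
    using Cons.prems w by (cases i) (auto split: if_splits)
  then have wT: "w \<le> T" using w by simp
  note IH = Cons.IH[OF le, unfolded w p g list.sel]
  show ?case
  proof (cases i)
    case (Tick M W)
    show ?thesis unfolding Tick using IH w p g by simp
  next
    case (Emitted t v)
    consider "t = print_tag" | "t = output_tag" | "t \<noteq> print_tag" "t \<noteq> output_tag" by blast
    then show ?thesis
    proof cases
      case 1
      then show ?thesis unfolding Emitted using IH w p g wT by (simp add: print_tag_def output_tag_def)
    next
      case 2
      then show ?thesis unfolding Emitted using IH w p g wT by (simp add: print_tag_def output_tag_def)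
    next
      case 3
      then show ?thesis unfolding Emitted using IH w p g by simp
    qed
  qed
qed simp

lemma output_gaps_filter: "output_gaps (filter (\<lambda>t. t \<noteq> dfs_tag) ts) = output_gaps ts"
  by (induction ts) (auto simp: dfs_tag_def output_tag_def print_tag_def)

text \<open>\<open>j\<close> is a credit of ignored outputs: passing a printed one raises it,
  passing an ignored one consumes it. When gap \<open>k\<close> begins, the credit is at most
  \<open>j + k\<close>, and the gap may contain one further output, the printed one at its
  end.\<close>

lemma output_gaps_ballot:
  assumes "\<And>i. length (filter (\<lambda>b. \<not> b) (take i bs)) \<le> length (filter (\<lambda>b. b) (take i bs)) + j"
    "k < length (output_gaps (concat (map (\<lambda>b. if b then [output_tag, print_tag] else [output_tag]) bs)))"
  shows "output_gaps (concat (map (\<lambda>b. if b then [output_tag, print_tag] else [output_tag]) bs)) ! k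
    \<le> j + k + 1"
  using assms
proof (induction bs arbitrary: j k)
  case (Cons b bs)
  let ?g = "output_gaps (concat (map (\<lambda>b. if b then [output_tag, print_tag] else [output_tag]) bs))"
  show ?case
  proof (cases b)
    case True
    have "length (filter (\<lambda>b. \<not> b) (take i bs)) \<le> length (filter (\<lambda>b. b) (take i bs)) + Suc j" for i
      using Cons.prems(1)[of "Suc i"] True by simp
    from Cons.IH[OF this, of "k - 1"] show ?thesis
      using True Cons.prems(2) by (cases k) (auto simp: print_tag_def output_tag_def)
  next
    case False
    have j: "1 \<le> j" using Cons.prems(1)[of 1] False by simp
    have "length (filter (\<lambda>b. \<not> b) (take i bs)) \<le> length (filter (\<lambda>b. b) (take i bs)) + (j - 1)" for i
      using Cons.prems(1)[of "Suc i"] False j by simp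
    from Cons.IH[OF this, of k] show ?thesis
      using False Cons.prems(2) j by (cases ?g; cases k) (auto simp: print_tag_def output_tag_def)
  qed
qed simp

section \<open>The program\<close>

abbreviation (input) scalar :: "nat \<Rightarrow> aexp" where "scalar a \<equiv> Cell a (Const 0)"
abbreviation (input) assign :: "nat \<Rightarrow> aexp \<Rightarrow> com" where "assign a e \<equiv> Store a (Const 0) e"
abbreviation (input) incr :: "nat \<Rightarrow> com" where "incr a \<equiv> assign a (Add (scalar a) (Const 1))"
abbreviation (input) seq :: "com \<Rightarrow> com \<Rightarrow> com" (infixr ";;" 60) where "c ;; c' \<equiv> Seq c c'"

text \<open>Array names; 0 to 3 hold the input. \<open>LIT\<close>, \<open>OTH\<close>,
  \<open>NXT\<close> and \<open>HEAD\<close> form adjacency lists of clause occurrences;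
  \<open>VIS\<close> and \<open>QUE\<close> serve the search; \<open>POS\<close> maps a literal to
  its one-based position on the path in \<open>PATH\<close>; \<open>CAND\<close> marks candidates;
  \<open>ST\<close> and \<open>SD\<close> hold the pending vertices with their depths. From 20 on
  only cell 0 is used.\<close>

abbreviation (input) "LS \<equiv> 3 :: nat"
abbreviation (input) "NEG \<equiv> 4 :: nat"
abbreviation (input) "RANK \<equiv> 5 :: nat"
abbreviation (input) "LIT \<equiv> 6 :: nat"
abbreviation (input) "OTH \<equiv> 7 :: nat"
abbreviation (input) "NXT \<equiv> 8 :: nat"
abbreviation (input) "HEAD \<equiv> 9 :: nat"
abbreviation (input) "VIS \<equiv> 10 :: nat"
abbreviation (input) "QUE \<equiv> 11 :: nat"
abbreviation (input) "POS \<equiv> 12 :: nat"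
abbreviation (input) "PATH \<equiv> 13 :: nat"
abbreviation (input) "PRT \<equiv> 14 :: nat"
abbreviation (input) "CAND \<equiv> 15 :: nat"
abbreviation (input) "ST \<equiv> 16 :: nat"
abbreviation (input) "SD \<equiv> 17 :: nat"
abbreviation (input) "CNT \<equiv> 20 :: nat"
abbreviation (input) "CUR \<equiv> 21 :: nat"
abbreviation (input) "QH \<equiv> 22 :: nat"
abbreviation (input) "QT \<equiv> 23 :: nat"
abbreviation (input) "SP \<equiv> 24 :: nat"
abbreviation (input) "LEV \<equiv> 25 :: nat"
abbreviation (input) "DEP \<equiv> 26 :: nat"
abbreviation (input) "TOP \<equiv> 27 :: nat"
abbreviation (input) "PRE \<equiv> 28 :: nat"

abbreviation (input) "num_vars \<equiv> Cell 0 (Const 0)"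
abbreviation (input) "num_clauses \<equiv> Cell 0 (Const 1)"
abbreviation (input) "start \<equiv> Cell 0 (Const 2)"
abbreviation (input) "num_lits \<equiv> Add num_vars num_vars"

text \<open>Expressions offer no parity or division, so complements of literal codes are
  tabulated.\<close>

definition init_neg :: com where
  "init_neg = assign CNT (Const 0) ;;
    While (Less (scalar CNT) num_vars)
      (Store NEG (Add (scalar CNT) (scalar CNT)) (Add (Add (scalar CNT) (scalar CNT)) (Const 1)) ;;
       Store NEG (Add (Add (scalar CNT) (scalar CNT)) (Const 1)) (Add (scalar CNT) (scalar CNT)) ;;
       incr CNT)"

definition init_rank :: com where
  "init_rank = assign CNT (Const 0) ;;
    While (Less (scalar CNT) num_lits) (Store RANK (Cell LS (scalar CNT)) (scalar CNT) ;; incr CNT)"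

text \<open>A clause occupies two slots, one for each of its literals, at a distance equal to the
  number of clauses. A unit-clause is thus listed twice under its literal.\<close>

definition init_slots :: com where
  "init_slots = assign CNT (Const 0) ;;
    While (Less (scalar CNT) num_clauses)
      (incr CNT ;;
       Store LIT (scalar CNT) (Cell 1 (Sub (scalar CNT) (Const 1))) ;;
       Store OTH (scalar CNT) (Cell 2 (Sub (scalar CNT) (Const 1))) ;;
       Store LIT (Add (scalar CNT) num_clauses) (Cell 2 (Sub (scalar CNT) (Const 1))) ;;
       Store OTH (Add (scalar CNT) num_clauses) (Cell 1 (Sub (scalar CNT) (Const 1))))"

definition init_chains :: com where
  "init_chains = assign CUR (Const 0) ;;
    While (Less (scalar CUR) (Add num_clauses num_clauses))
      (incr CUR ;;
       Store NXT (scalar CUR) (Cell HEAD (Cell LIT (scalar CUR))) ;;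
       Store HEAD (Cell LIT (scalar CUR)) (scalar CUR))"

definition init :: com where
  "init = init_neg ;; init_rank ;; init_slots ;; init_chains ;; Store PRT (Const 0) start"

text \<open>Linked lists: address \<open>0\<close> is the end, so clause occurrences are numbered from \<open>1\<close> on.\<close>
fun chain :: "(nat \<Rightarrow> nat) \<Rightarrow> nat \<Rightarrow> nat list \<Rightarrow> bool" where
  "chain nxt h [] \<longleftrightarrow> h = 0"
| "chain nxt h (s # ss) \<longleftrightarrow> h = s \<and> s \<noteq> 0 \<and> chain nxt (nxt s) ss"

lemma chain_cong: "(\<And>s. s \<in> set ss \<Longrightarrow> nxt s = nxt' s) \<Longrightarrow> chain nxt h ss \<longleftrightarrow> chain nxt' h ss"
  by (induction ss arbitrary: h) auto

section \<open>Coded instances and their memory\<close>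

locale coded_instance = instance_2cnf +
  fixes e ps ls
  assumes rep: "represents_input e ps ls F L"
begin

abbreviation "cd \<equiv> code e"
abbreviation "n \<equiv> nvars F"

lemma e_bij: "bij_betw e (vars F) {..<n}" and presents: "presents ps F"
  and listing: "increasing_listing L (lits F) ls"
  using rep by (auto simp: represents_input_def)

lemma cd_less: "a \<in> lits F \<Longrightarrow> cd a < 2 * n"
proof -
  assume "a \<in> lits F"
  then have "e (lvar a) < n" using e_bij by (auto simp: lits_def bij_betw_def)
  then show ?thesis by (cases a) auto
qed

lemma cd_eq_iff [simp]: "a \<in> lits F \<Longrightarrow> b \<in> lits F \<Longrightarrow> cd a = cd b \<longleftrightarrow> a = b"
proof -
  assume *: "a \<in> lits F" "b \<in> lits F"
  then have "e (lvar a) = e (lvar b) \<longleftrightarrow> lvar a = lvar b"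
    using e_bij by (auto simp: lits_def bij_betw_def inj_on_def)
  moreover have "2 * i \<noteq> Suc (2 * j)" "Suc (2 * i) \<noteq> 2 * j" for i j :: nat by presburger+
  ultimately show ?thesis by (induction a; induction b) auto
qed

lemma cd_cases:
  assumes "a \<in> lits F"
  obtains v where "v < n" "cd a = 2 * v" "cd (lneg a) = 2 * v + 1"
    | v where "v < n" "cd a = 2 * v + 1" "cd (lneg a) = 2 * v"
proof -
  have "e (lvar a) < n" using e_bij assms by (auto simp: lits_def bij_betw_def)
  then show ?thesis using that by (cases a) auto
qed

lemma card_lits: "card (lits F) = 2 * n"
proof -
  have "card (lits F) = card (Pos ` vars F) + card (Neg ` vars F)"
    unfolding lits_eq by (intro card_Un_disjoint) auto
  then show ?thesis by (simp add: card_image inj_on_def nvars_def)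
qed

lemma ls: "length ls = 2 * n" "set ls = lits F" "distinct ls"
  using listing card_lits distinct_card[of ls] by (auto simp: increasing_listing_def)

lemma ls_lits: "i < 2 * n \<Longrightarrow> ls ! i \<in> lits F"
  using ls by (metis nth_mem)

lemma length_ps: "length ps = card F"
  using presents distinct_card[of "map (\<lambda>(a, b). {a, b}) ps"] by (auto simp: presents_def)

lemma nocc_ge: "n \<le> nocc F" "length ps \<le> nocc F" "1 \<le> n" "1 \<le> nocc F"
proof -
  have "card (\<Union>F) \<le> nocc F" unfolding nocc_def
    by (intro card_Union_le_sum_card) 
  moreover have fin: "finite (\<Union>F)" using clause_set by (auto simp: is_clause_set_def is_clause_def)
  then have "n \<le> card (\<Union>F)" unfolding nvars_def vars_def by (rule card_image_le)
  ultimately show "n \<le> nocc F" by simp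
  have "(\<Sum>C\<in>F. 1) \<le> nocc F" unfolding nocc_def using sizes by (intro sum_mono) auto
  then show "length ps \<le> nocc F" using length_ps by simp
  have "vars F \<noteq> {}" using x_lits by (auto simp: lits_def)
  then show "1 \<le> n" unfolding nvars_def by (simp add: Suc_le_eq card_gt_0_iff)
  with \<open>n \<le> nocc F\<close> show "1 \<le> nocc F" by simp
qed

text \<open>An upper bound for all stored values: literal codes stay below \<open>2 * n\<close>,
  slot numbers reach twice the number of clauses, and the stack height at most one more than that.
  Both \<open>n\<close> and the number of clauses are at most \<open>nocc F\<close>.\<close>

definition B :: nat where "B = 4 * nocc F"

lemma B_ge: "2 * n \<le> B" "length ps + length ps \<le> B" "Suc n \<le> B" "4 \<le> B"
  using nocc_ge by (simp_all add: B_def)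

definition slots :: "('a literal \<times> 'a literal) list" where
  "slots = ps @ map prod.swap ps"

text \<open>Occurrences are prepended to their chains, hence \<open>rev\<close>; \<open>k\<close> is
  the progress of the loop that builds the chains. Slot numbers are one-based, hence
  \<open>s - 1\<close>.\<close>

definition occs :: "nat \<Rightarrow> 'a literal \<Rightarrow> nat list" where
  "occs k a = rev (filter (\<lambda>s. fst (slots ! (s - 1)) = a) [1..<Suc k])"

abbreviation "occ \<equiv> occs (length slots)"

lemma length_slots: "length slots = length ps + length ps"
  by (simp add: slots_def)

lemma slots_lits:
  assumes "i < length slots"
  shows "fst (slots ! i) \<in> lits F" "snd (slots ! i) \<in> lits F"
proof -
  have "slots ! i \<in> set slots" using assms by simp
  then have "\<exists>a b. (a, b) \<in> set ps \<and> (slots ! i = (a, b) \<or> slots ! i = (b, a))"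
    unfolding slots_def set_append set_map Un_iff by (metis imageE prod.collapse swap_simp)
  then obtain a b where "(a, b) \<in> set ps" "slots ! i = (a, b) \<or> slots ! i = (b, a)" by blast
  moreover from this have "{a, b} \<in> F" using presents by (force simp: presents_def)
  ultimately show "fst (slots ! i) \<in> lits F" "snd (slots ! i) \<in> lits F"
    using in_clause_in_lits[of "{a, b}" F] by auto
qed

lemma occs_bounds: "s \<in> set (occs k a) \<Longrightarrow> 0 < s \<and> s \<le> k"
  by (auto simp: occs_def)

lemma occs_Suc: "occs (Suc k) a = (if fst (slots ! k) = a then Suc k # occs k a else occs k a)"
  by (simp add: occs_def)

lemma occ_neighbours: "(\<exists>s\<in>set (occ a). snd (slots ! (s - 1)) = b) \<longleftrightarrow> {a, b} \<in> F"
proof -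
  have "(\<exists>s\<in>set (occ a). snd (slots ! (s - 1)) = b) \<longleftrightarrow> (a, b) \<in> set slots"
  proof
    assume "(a, b) \<in> set slots"
    then obtain i where "i < length slots" "slots ! i = (a, b)" by (auto simp: in_set_conv_nth)
    then have "Suc i \<in> set (occ a)" "snd (slots ! (Suc i - 1)) = b" by (auto simp: occs_def simp del: upt_Suc)
    then show "\<exists>s\<in>set (occ a). snd (slots ! (s - 1)) = b" by blast
  next
    assume "\<exists>s\<in>set (occ a). snd (slots ! (s - 1)) = b"
    then obtain s where "1 \<le> s" "s < Suc (length slots)" "fst (slots ! (s - 1)) = a" "snd (slots ! (s - 1)) = b"
      by (auto simp: occs_def)
    then have "slots ! (s - 1) = (a, b)" "s - 1 < length slots" by (auto simp: prod_eq_iff)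
    then show "(a, b) \<in> set slots" by (metis nth_mem)
  qed
  also have "\<dots> \<longleftrightarrow> (a, b) \<in> set ps \<or> (b, a) \<in> set ps" unfolding slots_def by force
  also have "\<dots> \<longleftrightarrow> {a, b} \<in> (\<lambda>(a, b). {a, b}) ` set ps"
    by (force simp: doubleton_eq_iff)
  finally show ?thesis using presents by (simp add: presents_def)
qed

text \<open>Each occurrence is listed under exactly one literal. This count makes the search linear
  and also bounds the stack.\<close>

lemma sum_length_occs: "k \<le> length slots \<Longrightarrow> (\<Sum>a\<in>lits F. length (occs k a)) = k"
proof (induction k)
  case (Suc k)
  have "(\<Sum>a\<in>lits F. length (occs (Suc k) a))
      = (\<Sum>a\<in>lits F. length (occs k a) + (if fst (slots ! k) = a then 1 else 0))"
    by (intro sum.cong) (auto simp: occs_Suc)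
  also have "\<dots> = Suc k" using Suc slots_lits[of k] by (simp add: sum.distrib)
  finally show ?case .
qed (simp add: occs_def)

definition static :: "mem \<Rightarrow> bool" where
  "static m \<longleftrightarrow> m 0 0 = n \<and> m 0 1 = length ps \<and> m 0 2 = cd x \<and>
    (\<forall>i<2 * n. m LS i = cd (ls ! i)) \<and>
    (\<forall>a\<in>lits F. m NEG (cd a) = cd (lneg a)) \<and>
    (\<forall>i<2 * n. m RANK (cd (ls ! i)) = i) \<and>
    (\<forall>i<length slots. m OTH (Suc i) = cd (snd (slots ! i))) \<and>
    (\<forall>a\<in>lits F. chain (m NXT) (m HEAD (cd a)) (occ a))"

section \<open>Initialisation\<close>

lemma wp_init_neg:
  assumes "m 0 0 = n"
  shows "wp B init_neg (\<lambda>m' t'. (\<forall>a\<in>lits F. m' NEG (cd a) = cd (lneg a)) \<and> t' \<le> t + 4 * n + 2) m t"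
  unfolding init_neg_def
  apply (intro wp_intros)
   apply simp
  \<comment> \<open>As in all counting loops below, the invariant bounds the clock plus the cost of
    the remaining iterations: here four ticks each, one test and three stores.\<close>
  apply (rule wp_While[where I = "\<lambda>m' t'. m' CNT 0 \<le> n \<and>
      (\<forall>i<m' CNT 0. m' NEG (2 * i) = 2 * i + 1 \<and> m' NEG (2 * i + 1) = 2 * i) \<and>
      t' + 4 * (n - m' CNT 0) \<le> t + 1 + 4 * n" and T = "t + 1 + 4 * n"])
     apply simp
    apply simp
   apply (intro wp_intros)
      apply (use B_ge assms in \<open>auto simp: less_Suc_eq mult_2\<close>)[4]
  subgoal premises prems for m' t'
  proof -
    have "m' CNT 0 = n" using prems assms by simp
    then have "m' NEG (cd a) = cd (lneg a)" if "a \<in> lits F" for a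
      using that prems(1) by (auto elim!: cd_cases[of a])
    then show ?thesis using prems by auto
  qed
  done

lemma wp_init_rank:
  assumes "m 0 0 = n" and LS: "\<forall>i<2 * n. m LS i = cd (ls ! i)"
  shows "wp B init_rank (\<lambda>m' t'. (\<forall>i<2 * n. m' RANK (cd (ls ! i)) = i) \<and> t' \<le> t + 6 * n + 2) m t"
  unfolding init_rank_def
  apply (intro wp_intros)
   apply simp
  apply (rule wp_While[where I = "\<lambda>m' t'. m' CNT 0 \<le> 2 * n \<and>
      (\<forall>i<m' CNT 0. m' RANK (cd (ls ! i)) = i) \<and>
      t' + 3 * (2 * n - m' CNT 0) \<le> t + 1 + 6 * n" and T = "t + 1 + 6 * n"])
     apply simp
    apply simp
   apply (intro wp_intros)
  subgoal using B_ge assms by auto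
  subgoal using B_ge assms by auto
  subgoal premises prems for m' t'
  proof -
    have k: "m' CNT 0 < 2 * n" using prems assms by simp
    have "cd (ls ! i) = cd (ls ! m' CNT 0) \<longleftrightarrow> i = m' CNT 0" if "i < Suc (m' CNT 0)" for i
      using that k ls_lits ls nth_eq_iff_index_eq[of ls i "m' CNT 0"] by simp
    then show ?thesis using prems k LS by (auto simp: less_Suc_eq)
  qed
  subgoal using assms by auto
  done

lemma wp_init_slots:
  assumes "m 0 1 = length ps" "\<forall>i<length ps. m 1 i = cd (fst (ps ! i))" "\<forall>i<length ps. m 2 i = cd (snd (ps ! i))"
  shows "wp B init_slots (\<lambda>m' t'. (\<forall>i<length slots. m' LIT (Suc i) = cd (fst (slots ! i)) \<and>
      m' OTH (Suc i) = cd (snd (slots ! i))) \<and> t' \<le> t + 6 * length ps + 2) m t"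
  unfolding init_slots_def
  apply (intro wp_intros)
   apply simp
  apply (rule wp_While[where I = "\<lambda>m' t'. m' CNT 0 \<le> length ps \<and>
      (\<forall>i<m' CNT 0. m' LIT (Suc i) = cd (fst (ps ! i)) \<and> m' OTH (Suc i) = cd (snd (ps ! i)) \<and>
        m' LIT (Suc (i + length ps)) = cd (snd (ps ! i)) \<and> m' OTH (Suc (i + length ps)) = cd (fst (ps ! i))) \<and>
      t' + 6 * (length ps - m' CNT 0) \<le> t + 1 + 6 * length ps" and T = "t + 1 + 6 * length ps"])
     apply simp
    apply simp
   apply (intro wp_intros)
  subgoal using B_ge assms by auto
  subgoal premises prems for m' t' using boundedD(1)[OF prems(2), of 1] by simp
  subgoal premises prems for m' t' using boundedD(1)[OF prems(2), of 2] by simp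
  subgoal premises prems for m' t' using boundedD(1)[OF prems(2), of 2] by simp
  subgoal premises prems for m' t' using boundedD(1)[OF prems(2), of 1] by simp
  subgoal using assms by (auto simp: less_Suc_eq)
  subgoal premises prems for m' t'
  proof -
    have k: "m' CNT 0 = length ps" using prems assms by simp
    have "m' LIT (Suc i) = cd (fst (slots ! i)) \<and> m' OTH (Suc i) = cd (snd (slots ! i))" if "i < length slots" for i
    proof (cases "i < length ps")
      case True
      then show ?thesis using prems(1) k by (simp add: slots_def nth_append)
    next
      case False
      then obtain j where "i = j + length ps" by (metis add.commute le_Suc_ex not_less)
      then show ?thesis using that prems(1) k by (auto simp: slots_def nth_append)
    qed
    then show ?thesis using prems by auto
  qed
  done

lemma wp_init_chains:
  assumes "m 0 1 = length ps" and LIT: "\<forall>i<length slots. m LIT (Suc i) = cd (fst (slots ! i))"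
    and "\<forall>i. m HEAD i = 0"
  shows "wp B init_chains (\<lambda>m' t'. (\<forall>a\<in>lits F. chain (m' NXT) (m' HEAD (cd a)) (occ a)) \<and>
      t' \<le> t + 8 * length ps + 2) m t"
  unfolding init_chains_def
  apply (intro wp_intros)
   apply simp
  apply (rule wp_While[where I = "\<lambda>m' t'. m' CUR 0 \<le> length slots \<and>
      (\<forall>a\<in>lits F. chain (m' NXT) (m' HEAD (cd a)) (occs (m' CUR 0) a)) \<and>
      t' + 4 * (length slots - m' CUR 0) \<le> t + 1 + 8 * length ps" and T = "t + 1 + 8 * length ps"])
  subgoal using assms by (simp add: occs_def length_slots)
    apply simp
   apply (intro wp_intros)
  subgoal using B_ge assms by (auto simp: length_slots)
  subgoal premises prems for m' t' using boundedD(1)[OF prems(2)] by simp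
  subgoal premises prems for m' t' using B_ge prems assms by (auto simp: length_slots)
  subgoal premises prems for m' t'
  proof -
    let ?k = "m' CUR 0"
    have k: "?k < length slots" using prems assms by (simp add: length_slots)
    let ?b = "fst (slots ! ?k)"
    have b: "?b \<in> lits F" using slots_lits[OF k] by simp
    have lit: "m' LIT (Suc ?k) = cd ?b" using prems LIT k by simp
    \<comment> \<open>The written cell has number \<open>Suc ?k\<close>, beyond all cells of the
      existing chains, so these are unaffected.\<close>
    let ?nxt = "(m' NXT)(Suc ?k := m' HEAD (cd ?b))"
    have cong: "chain ?nxt h (occs ?k a) \<longleftrightarrow> chain (m' NXT) h (occs ?k a)" for h a
      by (rule chain_cong) (use occs_bounds in fastforce)
    have "chain ?nxt (if a = ?b then Suc ?k else m' HEAD (cd a)) (occs (Suc ?k) a)" if "a \<in> lits F" for a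
      using prems(1) that b by (auto simp: occs_Suc cong)
    moreover have "4 * (length slots - ?k) = 4 * (length slots - Suc ?k) + 4" using k by simp
    then have "t' + 4 + 4 * (length slots - Suc ?k) \<le> t + 1 + 8 * length ps" using prems(1) by linarith
    ultimately show ?thesis using prems k lit b by (simp add: if_distrib[of "\<lambda>h. chain _ h _"])
  qed
  subgoal premises prems for m' t'
  proof -
    have "m' CUR 0 = length slots" using prems assms by (simp add: length_slots)
    then show ?thesis using prems by simp
  qed
  done

lemma input_mem_simps:
  "input_mem e ps ls x F 0 0 = n" "input_mem e ps ls x F 0 (Suc 0) = length ps" "input_mem e ps ls x F 0 2 = cd x"
  "i < length ps \<Longrightarrow> input_mem e ps ls x F 1 i = cd (fst (ps ! i))"
  "i < length ps \<Longrightarrow> input_mem e ps ls x F 2 i = cd (snd (ps ! i))"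
  "i < 2 * n \<Longrightarrow> input_mem e ps ls x F 3 i = cd (ls ! i)"
  "3 < a \<Longrightarrow> input_mem e ps ls x F a i = 0"
  using ls by (auto simp: input_mem_def array_of_def split: prod.split)

lemma bounded_input: "bounded B (input_mem e ps ls x F)"
  unfolding bounded_def
proof (intro conjI allI)
  show "1 \<le> B" using B_ge by simp
  fix a i
  have *: "array_of ws i \<le> B" if "\<forall>w\<in>set ws. w \<le> B" for ws
    using that by (simp add: array_of_def)
  have ps: "cd p \<le> B \<and> cd q \<le> B" if "(p, q) \<in> set ps" for p q
    using that presents in_clause_in_lits[of "{p, q}" F] B_ge(1) cd_less[of p] cd_less[of q]
    by (force simp: presents_def)
  have lits: "cd a \<le> B" if "a \<in> lits F" for a using cd_less[OF that] B_ge(1) by simp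
  show "input_mem e ps ls x F a i \<le> B"
    unfolding input_mem_def by (rule *) (use ps lits B_ge ls(2) in auto)
qed

lemma wp_init:
  assumes "m = input_mem e ps ls x F"
  shows "wp B init (\<lambda>m' t'. static m' \<and> m' PRT 0 = cd x \<and> t' \<le> t + 10 * n + 14 * length ps + 9) m t"
  unfolding init_def
  apply (rule wp_Seq, rule wp_conseq[OF wp_init_neg])
  subgoal using assms input_mem_simps by simp
  apply (rule wp_Seq, rule wp_conseq[OF wp_init_rank])
  subgoal using assms input_mem_simps by (simp add: init_neg_def)
  subgoal using assms input_mem_simps by (simp add: init_neg_def)
  apply (rule wp_Seq, rule wp_conseq[OF wp_init_slots])
  subgoal using assms input_mem_simps by (simp add: init_neg_def init_rank_def)
  subgoal using assms input_mem_simps by (simp add: init_neg_def init_rank_def)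
  subgoal using assms input_mem_simps by (simp add: init_neg_def init_rank_def)
  apply (rule wp_Seq, rule wp_conseq[OF wp_init_chains])
  subgoal using assms input_mem_simps by (simp add: init_neg_def init_rank_def init_slots_def)
  subgoal by simp
  subgoal using assms input_mem_simps by (simp add: init_neg_def init_rank_def init_slots_def)
  apply (rule wp_Store)
  subgoal premises prems using boundedD(1)[OF prems(13)] by simp
  subgoal premises prems
    using prems assms input_mem_simps
    by (simp add: static_def init_neg_def init_rank_def init_slots_def init_chains_def)
  done

end

text \<open>An arc \<open>(a, b)\<close> comes from the clause \<open>{lneg a, b}\<close>, so the
  in-neighbours of \<open>b\<close> are the complements of the other literals in the clauses of
  \<open>b\<close>. One set of chains thus serves both directions of the digraph.\<close>

definition scan :: com where
  "scan = While (Less (Const 0) (scalar CUR))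
    (assign PRE (Cell NEG (Cell OTH (scalar CUR))) ;;
     If (And (Equal (Cell VIS (scalar PRE)) (Const 0)) (Equal (Cell POS (scalar PRE)) (Const 0)))
       (Store VIS (scalar PRE) (Const 1) ;; Store QUE (scalar QT) (scalar PRE) ;; incr QT)
       Skip ;;
     assign CUR (Cell NXT (scalar CUR)))"

text \<open>Searching backwards from \<open>lneg x\<close> settles reachability for all
  out-neighbours at once; the test of \<open>POS\<close> in \<open>scan\<close> confines the search
  to vertices off the path.\<close>

definition search :: com where
  "search = assign CNT (Const 0) ;;
    While (Less (scalar CNT) num_lits) (Store VIS (scalar CNT) (Const 0) ;; incr CNT) ;;
    Store VIS (Cell NEG start) (Const 1) ;; Store QUE (Const 0) (Cell NEG start) ;;
    assign QH (Const 0) ;; assign QT (Const 1) ;;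
    While (Less (scalar QH) (scalar QT))
      (assign CUR (Cell HEAD (Cell QUE (scalar QH))) ;; incr QH ;; scan)"

definition mark :: com where
  "mark = assign CUR (Cell HEAD (Cell NEG (scalar TOP))) ;;
    While (Less (Const 0) (scalar CUR))
      (If (Less (Const 0) (Cell VIS (Cell OTH (scalar CUR))))
         (Store CAND (Cell OTH (scalar CUR)) (Const 1)) Skip ;;
       assign CUR (Cell NXT (scalar CUR)))"

text \<open>Running through \<open>LS\<close> downwards leaves the least candidate on top, without
  any sorting. Marks instead of a list of candidates also merge repeated occurrences, and they are
  erased on the way.\<close>

definition push :: com where
  "push = assign CNT num_lits ;;
    While (Less (Const 0) (scalar CNT))
      (assign CNT (Sub (scalar CNT) (Const 1)) ;;
       If (Less (Const 0) (Cell CAND (Cell LS (scalar CNT))))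
         (Store CAND (Cell LS (scalar CNT)) (Const 0) ;;
          Store ST (scalar SP) (Cell LS (scalar CNT)) ;;
          Store SD (scalar SP) (scalar DEP) ;;
          incr SP)
         Skip)"

context coded_instance
begin

section \<open>The backward search\<close>

lemma static_cong:
  "m' 0 = m 0 \<Longrightarrow> m' LS = m LS \<Longrightarrow> m' NEG = m NEG \<Longrightarrow> m' RANK = m RANK \<Longrightarrow> m' OTH = m OTH \<Longrightarrow>
    m' NXT = m NXT \<Longrightarrow> m' HEAD = m HEAD \<Longrightarrow> static m' \<longleftrightarrow> static m"
  by (simp add: static_def)

lemma staticD:
  assumes "static m"
  shows "m 0 0 = n" "m 0 (Suc 0) = length ps" "m 0 2 = cd x" "i < 2 * n \<Longrightarrow> m LS i = cd (ls ! i)"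
    "a \<in> lits F \<Longrightarrow> m NEG (cd a) = cd (lneg a)" "i < 2 * n \<Longrightarrow> m RANK (cd (ls ! i)) = i"
    "i < length slots \<Longrightarrow> m OTH (Suc i) = cd (snd (slots ! i))"
    "a \<in> lits F \<Longrightarrow> chain (m NXT) (m HEAD (cd a)) (occ a)"
  using assms by (simp_all add: static_def)

definition backward :: "'a literal set \<Rightarrow> 'a literal set" where
  "backward V = {a. (a, lneg x) \<in> (Restr (idg F) (lits F - V))\<^sup>*}"

lemma backward_subset:
  assumes "lneg x \<notin> V"
  shows "backward V \<subseteq> lits F - V"
proof
  fix a assume "a \<in> backward V"
  then have "(a, lneg x) \<in> (Restr (idg F) (lits F - V))\<^sup>*" by (simp add: backward_def)
  then show "a \<in> lits F - V" using assms by (cases rule: converse_rtranclE) auto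
qed

lemma candidates_eq:
  "lneg x \<notin> set P \<Longrightarrow> candidates F (lneg x) P z = {a. (z, a) \<in> idg F \<and> a \<in> backward (set P)}"
  using backward_subset[of "set P"] by (auto simp: candidates_def backward_def)

definition avoids :: "'a literal set \<Rightarrow> mem \<Rightarrow> bool" where
  "avoids V m \<longleftrightarrow> (\<forall>a\<in>lits F. m POS (cd a) = 0 \<longleftrightarrow> a \<notin> V)"

text \<open>\<open>qs\<close> includes the entries already taken out, so its elements are precisely
  the visited vertices; \<open>QH\<close> separates the expanded ones.\<close>

definition queue :: "'a literal set \<Rightarrow> 'a literal list \<Rightarrow> mem \<Rightarrow> bool" where
  "queue V qs m \<longleftrightarrow> distinct qs \<and> set qs \<subseteq> backward V \<and> lneg x \<in> set qs \<and> m QT 0 = length qs \<and>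
    (\<forall>i<length qs. m QUE i = cd (qs ! i)) \<and>
    (\<forall>a\<in>lits F. m VIS (cd a) = (if a \<in> set qs then 1 else 0))"

lemma queue_push:
  assumes "queue V qs m" "a \<in> lits F" "a \<notin> V" "a \<notin> set qs" "(a, b) \<in> idg F" "b \<in> set qs" "lneg x \<notin> V"
    "m' QT 0 = Suc (length qs)" "m' QUE = (m QUE)(length qs := cd a)" "m' VIS = (m VIS)(cd a := 1)"
  shows "queue V (qs @ [a]) m'"
proof -
  have b: "b \<in> backward V" using assms(1,6) by (auto simp: queue_def)
  then have "b \<in> lits F - V" using backward_subset[OF assms(7)] by auto
  then have "a \<in> backward V"
    using b assms(2,3,5) unfolding backward_def by (auto intro: converse_rtrancl_into_rtrancl)
  then show ?thesis using assms by (auto simp: queue_def nth_append less_Suc_eq)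
qed

lemma distinct_lits_length: "distinct qs \<Longrightarrow> set qs \<subseteq> lits F \<Longrightarrow> length qs \<le> 2 * n"
  using card_mono[of "lits F" "set qs"] distinct_card[of qs] card_lits by simp

lemma wp_scan:
  assumes st: "static m" and av: "avoids V m" and xV: "lneg x \<notin> V" and q: "queue V qs m"
    and ch: "chain (m NXT) (m CUR 0) (occ b)" and b: "b \<in> set qs"
  shows "wp B scan (\<lambda>m' t'. (\<exists>new. queue V (qs @ new) m' \<and>
      (\<forall>a. (a, b) \<in> idg F \<longrightarrow> a \<in> V \<or> a \<in> set (qs @ new))) \<and>
    t' \<le> t + 7 * length (occ b) + 1) m t"
  unfolding scan_def
\<comment> \<open>An occurrence costs at most seven ticks: two tests, three stores for a newly
  visited vertex, and the assignments of \<open>PRE\<close> and \<open>CUR\<close>. The list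
  \<open>don\<close> holds the occurrences already scanned.\<close>
proof (rule wp_While[where I = "\<lambda>m' t'. \<exists>new don rest. occ b = don @ rest \<and>
      chain (m NXT) (m' CUR 0) rest \<and> queue V (qs @ new) m' \<and>
      (\<forall>s\<in>set don. lneg (snd (slots ! (s - 1))) \<in> V \<union> set (qs @ new)) \<and>
      t' + 7 * length rest \<le> t + 7 * length (occ b)" and T = "t + 7 * length (occ b)"], goal_cases)
  case 1
  show ?case using q ch by (intro exI[of _ "[]"] exI[of _ "occ b"]) simp
next
  case (2 m' t')
  then show ?case by auto
next
  case (3 m' t')
  have fr: "m' NXT = m NXT" "m' OTH = m OTH" "m' NEG = m NEG" "m' POS = m POS" using 3(3) by simp_all
  obtain new don rest where inv: "occ b = don @ rest" "chain (m NXT) (m' CUR 0) rest" "queue V (qs @ new) m'"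
    "\<forall>s\<in>set don. lneg (snd (slots ! (s - 1))) \<in> V \<union> set (qs @ new)"
    "t' + 7 * length rest \<le> t + 7 * length (occ b)"
    using 3(1) by blast
  obtain s rest' where rest: "rest = s # rest'" using inv(2) 3(4) by (cases rest) auto
  have s: "m' CUR 0 = s" "chain (m NXT) (m NXT s) rest'" using inv(2) rest by auto
  have "s \<in> set (occ b)" using inv(1) rest by simp
  then have s0: "0 < s" "s \<le> length slots" using occs_bounds by auto
  then obtain i where i: "s = Suc i" "i < length slots" by (cases s) auto
  let ?a = "lneg (snd (slots ! i))"
  have a: "?a \<in> lits F" using slots_lits[OF i(2)] by simp
  have pre: "m NEG (m OTH s) = cd ?a" using staticD(7)[OF st i(2)] staticD(5)[OF st] slots_lits[OF i(2)] i by simp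
  have "{b, snd (slots ! i)} \<in> F" using occ_neighbours[of b "snd (slots ! i)"] \<open>s \<in> set (occ b)\<close> i by fastforce
  then have arc: "(?a, b) \<in> idg F" by (simp add: idg_iff insert_commute)
  have vis: "m' VIS (cd ?a) = 0 \<longleftrightarrow> ?a \<notin> set (qs @ new)" using inv(3) a by (auto simp: queue_def)
  have pos: "m POS (cd ?a) = 0 \<longleftrightarrow> ?a \<notin> V" using av a by (simp add: avoids_def)
  have bd: "m' i j \<le> B" for i j using boundedD(1)[OF 3(2)] .
  have qt: "m' QT 0 = length (qs @ new)" using inv(3) by (simp add: queue_def)
  have new: "queue V (qs @ new @ [?a]) m2"
    if "?a \<notin> set (qs @ new)" "?a \<notin> V" "m2 QT 0 = Suc (length (qs @ new))"
      "m2 QUE = (m' QUE)(length (qs @ new) := cd ?a)" "m2 VIS = (m' VIS)(cd ?a := 1)" for m2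
    using queue_push[OF inv(3) a that(2,1) arc _ xV that(3-5)] b by simp
  \<comment> \<open>A new vertex together with the queue is a distinct list of literals, so the
    queue never outgrows \<open>2 * n\<close>.\<close>
  have len: "Suc (length (qs @ new)) \<le> B" if *: "?a \<notin> set (qs @ new)"
  proof -
    have "distinct ((qs @ new) @ [?a])" "set ((qs @ new) @ [?a]) \<subseteq> lits F"
      using inv(3) * a backward_subset[OF xV] by (auto simp: queue_def)
    from distinct_lits_length[OF this] show ?thesis using B_ge(1) by simp
  qed
  show ?case
    apply (intro wp_intros)
    subgoal using bd by simp
    subgoal using boundedD(2)[OF 3(2)] by simp
    subgoal using bd by simp
    subgoal using len vis pre s qt fr by simp
    subgoal using bd by simp
    subgoal
      apply (rule exI[of _ "new @ [?a]"], rule exI[of _ "don @ [s]"], rule exI[of _ rest'], intro conjI)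
      subgoal using inv rest by simp
      subgoal using s fr by simp
      subgoal by (rule new) (use vis pos pre s fr qt in simp_all)
      subgoal using inv(4) i by auto
      subgoal using inv(5) rest by simp
      done
    subgoal using bd by simp
    subgoal
      apply (rule exI[of _ new], rule exI[of _ "don @ [s]"], rule exI[of _ rest'], intro conjI)
      subgoal using inv rest by simp
      subgoal using s fr by simp
      subgoal using inv(3) by (simp add: queue_def)
      subgoal using inv(4) i vis pos pre s fr by auto
      subgoal using inv(5) rest by simp
      done
    done
next
  case (4 m' t')
  then obtain new don rest where inv: "occ b = don @ rest" "chain (m NXT) (m' CUR 0) rest" "queue V (qs @ new) m'"
    "\<forall>s\<in>set don. lneg (snd (slots ! (s - 1))) \<in> V \<union> set (qs @ new)"
    "t' + 7 * length rest \<le> t + 7 * length (occ b)"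
    by blast
  have "rest = []" using inv(2) 4(4) by (cases rest) auto
  have "a \<in> V \<or> a \<in> set (qs @ new)" if "(a, b) \<in> idg F" for a
  proof -
    have "{b, lneg a} \<in> F" using that by (simp add: idg_iff insert_commute)
    then obtain s where "s \<in> set (occ b)" "snd (slots ! (s - 1)) = lneg a" using occ_neighbours by blast
    then show ?thesis using inv(1,4) \<open>rest = []\<close> by fastforce
  qed
  then show ?case using inv by auto
qed

lemma wp_search:
  assumes st: "static m" and av: "avoids V m" and xV: "lneg x \<notin> V"
  shows "wp B search (\<lambda>m' t'. (\<forall>a\<in>lits F. m' VIS (cd a) = (if a \<in> backward V then 1 else 0)) \<and>
    t' \<le> t + 14 * n + 14 * length ps + 7) m t"
  unfolding search_def
  apply (intro wp_intros)
  subgoal by simp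
  apply (rule wp_While[where I = "\<lambda>m' t'. m' CNT 0 \<le> 2 * n \<and> (\<forall>i<m' CNT 0. m' VIS i = 0) \<and>
      t' + 3 * (2 * n - m' CNT 0) \<le> t + 1 + 6 * n" and T = "t + 1 + 6 * n"])
  subgoal by simp
  subgoal by simp
  subgoal
    apply (intro wp_intros)
    subgoal by simp
    subgoal using staticD(1)[OF st] B_ge by auto
    subgoal using staticD(1)[OF st] by (auto simp: less_Suc_eq)
    done
  subgoal premises prems for m1 t1
  proof -
    have fr: "m1 0 = m 0" "m1 LS = m LS" "m1 NEG = m NEG" "m1 RANK = m RANK" "m1 OTH = m OTH" "m1 NXT = m NXT"
        "m1 HEAD = m HEAD" "m1 POS = m POS"
      using prems(3) by simp_all
    have st1: "static m1" using st fr static_cong by metis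
    have bd: "m1 i j \<le> B" for i j using boundedD(1)[OF prems(2)] .
    have neg: "m1 NEG (cd x) = cd (lneg x)" using staticD(5)[OF st1] by simp
    have vis: "m1 VIS (cd a) = 0" if "a \<in> lits F" for a
      using prems(1,4) cd_less[OF that] staticD(1)[OF st1] by simp
    have t1: "t1 \<le> t + 1 + 6 * n" using prems(1) by simp
    \<comment> \<open>Cost of the vertices still to be expanded: seven ticks per occurrence, and
      four for the test of the outer loop, its two assignments and the final test of
      \<open>scan\<close>.\<close>
    let ?pot = "\<lambda>Q. \<Sum>b\<in>lits F - Q. 7 * length (occ b) + 4"
    have pot0: "?pot {} = 14 * length ps + 8 * n"
    proof -
      have "?pot {} = 7 * (\<Sum>b\<in>lits F. length (occ b)) + 4 * card (lits F)"
        by (simp add: sum.distrib sum_distrib_left)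
      then show ?thesis using sum_length_occs[of "length slots"] card_lits length_slots by simp
    qed
    show ?thesis
      apply (intro wp_intros)
      subgoal using boundedD(2)[OF prems(2)] by simp
      subgoal using bd by simp
      subgoal by simp
      subgoal using boundedD(2)[OF prems(2)] by simp
      apply (rule wp_While[where I = "\<lambda>m' t'. \<exists>qs k. queue V qs m' \<and> m' QH 0 = k \<and> k \<le> length qs \<and>
          (\<forall>b\<in>set (take k qs). \<forall>a. (a, b) \<in> idg F \<longrightarrow> a \<in> V \<or> a \<in> set qs) \<and>
          t' + ?pot (set (take k qs)) \<le> t + 6 * n + 6 + ?pot {}" and T = "t + 6 * n + 6 + ?pot {}"])
      subgoal
        apply (rule exI[of _ "[lneg x]"], rule exI[of _ 0])
        using neg vis t1 staticD(3)[OF st1] by (auto simp: queue_def backward_def)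
      subgoal by auto
      subgoal premises pr for m' t'
      proof -
        obtain qs k where inv: "queue V qs m'" "m' QH 0 = k" "k \<le> length qs"
          "\<forall>b\<in>set (take k qs). \<forall>a. (a, b) \<in> idg F \<longrightarrow> a \<in> V \<or> a \<in> set qs"
          "t' + ?pot (set (take k qs)) \<le> t + 6 * n + 6 + ?pot {}"
          using pr(1) by blast
        have fr': "m' 0 = m 0" "m' LS = m LS" "m' NEG = m NEG" "m' RANK = m RANK" "m' OTH = m OTH" "m' NXT = m NXT"
          "m' HEAD = m HEAD" "m' POS = m POS"
          using pr(3) fr by (simp_all add: scan_def)
        have k: "k < length qs" using pr(4) inv(1,2) by (simp add: queue_def)
        let ?b = "qs ! k"
        have qsl: "distinct qs" "set qs \<subseteq> lits F" using inv(1) backward_subset[OF xV] by (auto simp: queue_def)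
        have bq: "?b \<in> set qs" using k by simp
        then have bl: "?b \<in> lits F" using qsl by auto
        have kB: "Suc k \<le> B" using distinct_lits_length[OF qsl] k B_ge(1) by simp
        have que: "m' QUE k = cd ?b" using inv(1) k by (simp add: queue_def)
        have bt: "?b \<notin> set (take k qs)"
          using qsl(1) k by (auto simp: in_set_conv_nth nth_eq_iff_index_eq)
        have pot: "?pot (set (take k qs)) = ?pot (set (take (Suc k) qs)) + (7 * length (occ ?b) + 4)"
        proof -
          have "lits F - set (take k qs) = insert ?b (lits F - set (take (Suc k) qs))"
            using k bl bt by (auto simp: take_Suc_conv_app_nth)
          moreover have "?b \<notin> lits F - set (take (Suc k) qs)" using k by (simp add: take_Suc_conv_app_nth)
          ultimately show ?thesis by simp
        qed
        show ?thesis
          apply (intro wp_Seq wp_Store)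
          subgoal using boundedD(1)[OF pr(2)] by simp
          subgoal using kB inv(2) by simp
          apply (rule wp_conseq[OF wp_scan[where V = V and qs = qs and b = ?b]])
          subgoal by (subst static_cong[of _ m]) (use st fr' in simp_all)
          subgoal using av fr' by (simp add: avoids_def)
          subgoal using xV .
          subgoal using inv(1) by (simp add: queue_def)
          subgoal using inv(2) que staticD(8)[OF st bl] fr' by simp
          subgoal using bq .
          subgoal premises p for m2 t2
          proof -
            obtain new where new: "queue V (qs @ new) m2"
              "\<forall>a. (a, ?b) \<in> idg F \<longrightarrow> a \<in> V \<or> a \<in> set (qs @ new)"
              "t2 \<le> Suc (Suc (Suc t')) + 7 * length (occ ?b) + 1"
              using p(1) by auto
            have qh: "m2 QH 0 = Suc k" using p(3) inv(2) by (simp add: scan_def)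
            have tk: "take (Suc k) (qs @ new) = take k qs @ [?b]" "take (Suc k) qs = take k qs @ [?b]"
              using k by (simp_all add: take_Suc_conv_app_nth)
            show ?thesis
              apply (rule exI[of _ "qs @ new"], rule exI[of _ "Suc k"])
              using new qh k inv(4,5) pot unfolding tk by auto
          qed
          done
      qed
      subgoal premises pr for m' t'
      proof -
        obtain qs k where inv: "queue V qs m'" "m' QH 0 = k" "k \<le> length qs"
          "\<forall>b\<in>set (take k qs). \<forall>a. (a, b) \<in> idg F \<longrightarrow> a \<in> V \<or> a \<in> set qs"
          "t' + ?pot (set (take k qs)) \<le> t + 6 * n + 6 + ?pot {}"
          using pr(1) by blast
        have k: "k = length qs" using pr(4) inv(1-3) by (simp add: queue_def)
        \<comment> \<open>With all queued vertices expanded, \<open>qs\<close> is closed under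
          in-neighbours outside \<open>V\<close>.\<close>
        have "a \<in> set qs" if "(a, lneg x) \<in> (Restr (idg F) (lits F - V))\<^sup>*" for a
          using that
        proof (induction rule: converse_rtrancl_induct)
          case base
          then show ?case using inv(1) by (simp add: queue_def)
        next
          case (step a b)
          then show ?case using inv(4) k by auto
        qed
        then have "set qs = backward V" using inv(1) by (auto simp: backward_def queue_def)
        then show ?thesis using inv(1,5) pot0 by (simp add: queue_def)
      qed
      done
  qed
  done

end

text \<open>Array \<open>PRT\<close> holds \<open>x\<close> followed by \<open>p, lneg p\<close> for each vertex \<open>p\<close> of the current path, and thus starts
  with the clause pairs \<open>(x, x), (lneg p\<^sub>0, p\<^sub>1), (lneg p\<^sub>1, p\<^sub>2), \<dots>\<close> to be printed.\<close>
definition pop :: com where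
  "pop = assign SP (Sub (scalar SP) (Const 1)) ;;
    assign TOP (Cell ST (scalar SP)) ;;
    assign LEV (Cell SD (scalar SP)) ;;
    While (Less (scalar LEV) (scalar DEP))
      (assign DEP (Sub (scalar DEP) (Const 1)) ;; Store POS (Cell PATH (scalar DEP)) (Const 0)) ;;
    Store PATH (scalar LEV) (scalar TOP) ;;
    assign DEP (Add (scalar LEV) (Const 1)) ;;
    Store POS (scalar TOP) (scalar DEP) ;;
    Store PRT (Add (Add (scalar LEV) (scalar LEV)) (Const 1)) (scalar TOP) ;;
    Store PRT (Add (Add (scalar LEV) (scalar LEV)) (Const 2)) (Cell NEG (scalar TOP))"

context coded_instance
begin

section \<open>Candidates, stack and current path\<close>

lemma length_occ: "length (occ a) \<le> 2 * length ps"
proof -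
  have "length (occ a) \<le> length [1..<Suc (length slots)]"
    unfolding occs_def length_rev by (rule length_filter_le)
  then show ?thesis by (simp add: length_slots del: upt_Suc)
qed

lemma wp_mark:
  assumes st: "static m" and z: "z \<in> lits F" "m TOP 0 = cd z" and xV: "lneg x \<notin> V"
    and vis: "\<forall>a\<in>lits F. m VIS (cd a) = (if a \<in> backward V then 1 else 0)"
    and cand: "\<forall>a\<in>lits F. m CAND (cd a) = 0"
  shows "wp B mark (\<lambda>m' t'. (\<forall>a\<in>lits F. m' CAND (cd a) = (if (z, a) \<in> idg F \<and> a \<in> backward V then 1 else 0)) \<and>
    t' \<le> t + 8 * length ps + 2) m t"
  unfolding mark_def
  apply (intro wp_Seq wp_Store)
  subgoal premises p using boundedD(1)[OF p] by simp
proof (rule wp_While[where I = "\<lambda>m' t'. \<exists>don rest. occ (lneg z) = don @ rest \<and>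
      chain (m NXT) (m' CUR 0) rest \<and>
      (\<forall>a\<in>lits F. m' CAND (cd a) = (if a \<in> backward V \<and> (\<exists>s\<in>set don. snd (slots ! (s - 1)) = a) then 1 else 0)) \<and>
      t' + 4 * length rest \<le> t + 1 + 4 * length (occ (lneg z))" and T = "t + 1 + 4 * length (occ (lneg z))"], goal_cases)
  case 1
  show ?case
    apply (rule exI[of _ "[]"], rule exI[of _ "occ (lneg z)"])
    using cand z staticD(5,8)[OF st] by simp
next
  case (2 m' t')
  then show ?case by auto
next
  case (3 m' t')
  have fr: "m' NXT = m NXT" "m' OTH = m OTH" "m' NEG = m NEG" "m' VIS = m VIS" using 3(3) by simp_all
  obtain don rest where inv: "occ (lneg z) = don @ rest" "chain (m NXT) (m' CUR 0) rest"
    "\<forall>a\<in>lits F. m' CAND (cd a) = (if a \<in> backward V \<and> (\<exists>s\<in>set don. snd (slots ! (s - 1)) = a) then 1 else 0)"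
    "t' + 4 * length rest \<le> t + 1 + 4 * length (occ (lneg z))"
    using 3(1) by blast
  obtain s rest' where rest: "rest = s # rest'" using inv(2) 3(4) by (cases rest) auto
  have s: "m' CUR 0 = s" "chain (m NXT) (m NXT s) rest'" using inv(2) rest by auto
  have "s \<in> set (occ (lneg z))" using inv(1) rest by simp
  then have s0: "0 < s" "s \<le> length slots" using occs_bounds by auto
  then obtain i where i: "s = Suc i" "i < length slots" by (cases s) auto
  let ?a = "snd (slots ! i)"
  have a: "?a \<in> lits F" using slots_lits[OF i(2)] by simp
  have oth: "m' OTH s = cd ?a" using staticD(7)[OF st i(2)] i fr by simp
  have bd: "m' i j \<le> B" for i j using boundedD(1)[OF 3(2)] .
  show ?case
    apply (intro wp_intros)
    subgoal using boundedD(2)[OF 3(2)] by simp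
    subgoal using bd by simp
    subgoal
      apply (rule exI[of _ "don @ [s]"], rule exI[of _ rest'], intro conjI)
      subgoal using inv rest by simp
      subgoal using s fr by simp
      subgoal using inv(3) i oth s fr vis a by (auto split: if_splits)
      subgoal using inv(4) rest by simp
      done
    subgoal using bd by simp
    subgoal
      apply (rule exI[of _ "don @ [s]"], rule exI[of _ rest'], intro conjI)
      subgoal using inv rest by simp
      subgoal using s fr by simp
      subgoal using inv(3) i oth s fr vis a by (auto split: if_splits)
      subgoal using inv(4) rest by simp
      done
    done
next
  case (4 m' t')
  then obtain don rest where inv: "occ (lneg z) = don @ rest" "chain (m NXT) (m' CUR 0) rest"
    "\<forall>a\<in>lits F. m' CAND (cd a) = (if a \<in> backward V \<and> (\<exists>s\<in>set don. snd (slots ! (s - 1)) = a) then 1 else 0)"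
    "t' + 4 * length rest \<le> t + 1 + 4 * length (occ (lneg z))"
    by blast
  have "rest = []" using inv(2) 4(4) by (cases rest) auto
  then have "(\<exists>s\<in>set don. snd (slots ! (s - 1)) = a) \<longleftrightarrow> (z, a) \<in> idg F" for a
    using occ_neighbours[of "lneg z" a] inv(1) by (simp add: idg_iff)
  then show ?case using inv length_occ[of "lneg z"] by auto
qed

text \<open>The list has the top first whereas the array grows upwards, hence
  \<open>rev\<close>.\<close>

definition stack :: "('a literal \<times> nat) list \<Rightarrow> mem \<Rightarrow> bool" where
  "stack st m \<longleftrightarrow> m SP 0 = length st \<and>
    (\<forall>i<length st. m ST i = cd (fst (rev st ! i)) \<and> m SD i = snd (rev st ! i))"

lemma stack_push:
  assumes "stack st m" "m' SP 0 = Suc (length st)" "m' ST = (m ST)(length st := cd a)"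
    "m' SD = (m SD)(length st := d)"
  shows "stack ((a, d) # st) m'"
  using assms by (auto simp: stack_def nth_append less_Suc_eq)

lemma wp_push:
  assumes st: "static m" and C: "C \<subseteq> lits F"
    and cand: "\<forall>a\<in>lits F. m CAND (cd a) = (if a \<in> C then 1 else 0)"
    and stk: "stack st m" and len: "length st + card C \<le> B" and d: "m DEP 0 = d"
  shows "wp B push (\<lambda>m' t'. stack (map (\<lambda>z. (z, d)) (filter (\<lambda>z. z \<in> C) ls) @ st) m' \<and>
    (\<forall>a\<in>lits F. m' CAND (cd a) = 0) \<and> t' \<le> t + 14 * n + 2) m t"
  unfolding push_def
  apply (intro wp_Seq wp_Store)
  subgoal using B_ge(1) staticD(1)[OF st] by simp
\<comment> \<open>Seven ticks per literal: two tests, the decrement and four stores for a candidate.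
  The counter runs downwards and so is itself the number of remaining iterations.\<close>
proof (rule wp_While[where I = "\<lambda>m' t'. m' CNT 0 \<le> 2 * n \<and>
      stack (map (\<lambda>z. (z, d)) (filter (\<lambda>z. z \<in> C) (drop (m' CNT 0) ls)) @ st) m' \<and>
      (\<forall>a\<in>lits F. m' CAND (cd a) = (if a \<in> C \<and> a \<notin> set (drop (m' CNT 0) ls) then 1 else 0)) \<and>
      t' + 7 * m' CNT 0 \<le> t + 1 + 14 * n" and T = "t + 1 + 14 * n"], goal_cases)
  case 1
  show ?case using staticD(1)[OF st] ls(1) cand stk by (simp add: stack_def)
next
  case (2 m' t')
  then show ?case by simp
next
  case (3 m' t')
  have fr: "m' 0 = m 0" "m' LS = m LS" "m' DEP = m DEP" using 3(3) by simp_all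
  obtain j where j: "m' CNT 0 = Suc j" using 3(4) by (cases "m' CNT 0") auto
  let ?fil = "\<lambda>i. map (\<lambda>z. (z, d)) (filter (\<lambda>z. z \<in> C) (drop i ls))"
  have inv: "stack (?fil (Suc j) @ st) m'"
    "\<forall>a\<in>lits F. m' CAND (cd a) = (if a \<in> C \<and> a \<notin> set (drop (Suc j) ls) then 1 else 0)"
    "t' + 7 * Suc j \<le> t + 1 + 14 * n" and jn: "Suc j \<le> 2 * n"
    using 3(1) j by auto
  let ?b = "ls ! j"
  have b: "?b \<in> lits F" using ls_lits jn by simp
  have lsj: "m' LS j = cd ?b" using staticD(4)[OF st, of j] jn fr by simp
  have drop: "drop j ls = ?b # drop (Suc j) ls" using jn ls(1) by (simp add: Cons_nth_drop_Suc)
  have bnot: "?b \<notin> set (drop (Suc j) ls)" using ls(3) drop by (metis distinct.simps(2) distinct_drop)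
  have bd: "m' i j \<le> B" for i j using boundedD(1)[OF 3(2)] .
  have sp: "m' SP 0 = length (?fil (Suc j) @ st)" using inv(1) by (simp add: stack_def)
  have spB: "Suc (length (?fil (Suc j) @ st)) \<le> B" if "?b \<in> C"
  proof -
    have "distinct (?b # filter (\<lambda>z. z \<in> C) (drop (Suc j) ls))" using bnot ls(3) by simp
    moreover have "set (?b # filter (\<lambda>z. z \<in> C) (drop (Suc j) ls)) \<subseteq> C" using that by auto
    moreover have "finite C" using C finite_lits by (rule finite_subset)
    ultimately have "length (?b # filter (\<lambda>z. z \<in> C) (drop (Suc j) ls)) \<le> card C"
      by (metis card_mono distinct_card)
    then show ?thesis using len by simp
  qed
  show ?case
    apply (intro wp_intros)
    subgoal using bd[of CNT 0] by simp
    subgoal by simp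
    subgoal using bd by simp
    subgoal using bd by simp
    subgoal using spB inv(2) lsj sp j b bnot by (simp split: if_splits)
    subgoal
    proof (simp only: fun_upd_same fun_upd_other, intro conjI, goal_cases)
      case 1
      then show ?case using j jn by simp
    next
      case 2
      then have bC: "?b \<in> C" using inv(2) lsj j b by (simp split: if_splits)
      have "stack ((?b, d) # ?fil (Suc j) @ st) mm"
        if "mm SP 0 = Suc (length (?fil (Suc j) @ st))" "mm ST = (m' ST)(length (?fil (Suc j) @ st) := cd ?b)"
          "mm SD = (m' SD)(length (?fil (Suc j) @ st) := d)" for mm
        using stack_push[OF inv(1) that] .
      then show ?case using drop bC sp lsj fr d j by simp
    next
      case 3
      then show ?case using inv(2) lsj j b bnot drop by auto
    next
      case 4
      then show ?case using inv(3) j by simp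
    qed
    subgoal
    proof (simp only: fun_upd_same fun_upd_other, intro conjI, goal_cases)
      case 1
      then show ?case using j jn by simp
    next
      case 2
      then have bC: "?b \<notin> C" using inv(2) lsj j b bnot by (simp split: if_splits)
      then show ?case using inv(1) drop j by (simp add: stack_def)
    next
      case 3
      then have bC: "?b \<notin> C" using inv(2) lsj j b bnot by (simp split: if_splits)
      then show ?case using inv(2) j drop by auto
    next
      case 4
      then show ?case using inv(3) j by simp
    qed
    done
next
  case (4 m' t')
  then show ?case using ls(2) by auto
qed

text \<open>Zero in \<open>POS\<close> means off the path, which is why positions are one-based.
  Stale entries of \<open>PATH\<close> and \<open>PRT\<close> beyond the depth are harmless, but
  \<open>POS\<close> is consulted for arbitrary literals and must be cleared.\<close>

definition current :: "'a literal list \<Rightarrow> mem \<Rightarrow> bool" where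
  "current P m \<longleftrightarrow> distinct P \<and> set P \<subseteq> lits F \<and> m DEP 0 = length P \<and>
    (\<forall>i<length P. m PATH i = cd (P ! i) \<and> m POS (cd (P ! i)) = Suc i) \<and>
    (\<forall>a\<in>lits F - set P. m POS (cd a) = 0) \<and> m PRT 0 = cd x \<and>
    (\<forall>i<length P. m PRT (2 * i + 1) = cd (P ! i) \<and> m PRT (2 * i + 2) = cd (lneg (P ! i)))"

lemma current_avoids: "current P m \<Longrightarrow> avoids (set P) m"
  unfolding current_def avoids_def by (auto simp: in_set_conv_nth)

lemma current_pop:
  assumes "current (P @ [y]) m" "m' DEP 0 = length P" "m' PATH = m PATH" "m' POS = (m POS)(cd y := 0)"
    "m' PRT = m PRT"
  shows "current P m'"
proof -
  have y: "y \<notin> set P" "y \<in> lits F" "set P \<subseteq> lits F" using assms(1) by (auto simp: current_def)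
  then have "cd (P ! i) \<noteq> cd y" if "i < length P" for i
    using that by (metis cd_eq_iff nth_mem subsetD)
  then show ?thesis using assms y
    by (auto simp: current_def nth_append less_Suc_eq)
qed

lemma current_push:
  assumes "current P m" "y \<in> lits F" "y \<notin> set P" "m' DEP 0 = Suc (length P)"
    "m' PATH = (m PATH)(length P := cd y)" "m' POS = (m POS)(cd y := Suc (length P))"
    "m' PRT = (m PRT)(2 * length P + 1 := cd y, 2 * length P + 2 := cd (lneg y))"
  shows "current (P @ [y]) m'"
proof -
  have "cd (P ! i) \<noteq> cd y" if "i < length P" for i
    using that assms(1-3) by (metis cd_eq_iff current_def nth_mem subsetD)
  moreover have "2 * i \<noteq> Suc (2 * j)" "Suc (2 * i) \<noteq> 2 * j" for i j :: nat by presburger+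
  ultimately show ?thesis using assms
    by (auto simp: current_def nth_append less_Suc_eq)
qed

text \<open>\<open>J\<close> is the tail of the abandoned branch, removed at three ticks per vertex,
  at most \<open>6 * n\<close> in total. The remaining nine ticks are eight stores and the exit
  test.\<close>

lemma wp_pop:
  assumes st: "static m" and cur: "current (P @ J) m" and stk: "stack ((y, length P) # st) m"
    and y: "y \<in> lits F" "y \<notin> set P"
  shows "wp B pop (\<lambda>m' t'. current (P @ [y]) m' \<and> stack st m' \<and> m' TOP 0 = cd y \<and>
    t' \<le> t + 6 * n + 9) m t"
proof -
  have "length (P @ J) \<le> 2 * n" using cur by (intro distinct_lits_length) (auto simp: current_def)
  then have J: "length J \<le> 2 * n" by simp
  have "length (P @ [y]) \<le> 2 * n" using cur y by (intro distinct_lits_length) (auto simp: current_def)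
  then have PB: "Suc (length P) \<le> B" using B_ge(1) by simp
  have top: "m SP 0 = Suc (length st)" "m ST (length st) = cd y" "m SD (length st) = length P"
    using stk by (auto simp: stack_def nth_append)
  have stk': "\<forall>i<length st. m ST i = cd (fst (rev st ! i)) \<and> m SD i = snd (rev st ! i)"
    using stk by (auto simp: stack_def nth_append)
  show ?thesis
    unfolding pop_def
    apply (intro wp_Seq wp_Store)
    subgoal premises p using boundedD(1)[OF p, of SP 0] by simp
    subgoal premises p using boundedD(1)[OF p, of ST] by simp
    subgoal premises p using boundedD(1)[OF p, of SD] by simp
    apply (rule wp_While[where I = "\<lambda>m' t'. (\<exists>J'. current (P @ J') m' \<and> t' + 3 * length J' \<le> t + 3 + 3 * length J)"
        and T = "t + 3 + 3 * length J"])
    subgoal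
      apply (rule exI[of _ J])
      using cur by (simp add: current_def)
    subgoal by auto
    subgoal premises p for m' t'
    proof -
      obtain J' where J': "current (P @ J') m'" "t' + 3 * length J' \<le> t + 3 + 3 * length J"
        using p(1) by blast
      have "J' \<noteq> []" using p(3,4) J'(1) top by (auto simp: current_def)
      then obtain J'' w where w: "J' = J'' @ [w]" by (metis append_butlast_last_id)
      have len: "m' DEP 0 = Suc (length (P @ J''))" "m' PATH (length (P @ J'')) = cd w"
        using J'(1) w by (auto simp: current_def nth_append)
      show ?thesis
        apply (intro wp_intros)
        subgoal using boundedD(1)[OF p(2), of DEP 0] by simp
        subgoal by simp
        subgoal
          apply (rule exI[of _ J''], rule conjI)
           apply (rule current_pop[of "P @ J''" w m'])
          using J' w len by simp_all
        done
    qed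
    subgoal premises p for m' t'
    proof -
      obtain J' where J': "current (P @ J') m'" "t' + 3 * length J' \<le> t + 3 + 3 * length J"
        using p(1) by blast
      have "J' = []" using p(3,4) J'(1) top by (auto simp: current_def)
      then have cur': "current P m'" using J' by simp
      have fr: "m' LEV 0 = length P" "m' TOP 0 = cd y" "m' NEG = m NEG" "m' SP 0 = length st" "m' ST = m ST" "m' SD = m SD"
        using p(3) top by simp_all
      have bd: "m' i j \<le> B" for i j using boundedD(1)[OF p(2)] .
      have neg: "m NEG (cd y) = cd (lneg y)" using staticD(5)[OF st y(1)] .
      show ?thesis
        apply (intro wp_intros)
        subgoal using bd by simp
        subgoal using PB fr by simp
        subgoal using PB fr by simp
        subgoal using bd by simp
        subgoal using bd by simp
        subgoal
          apply (intro conjI)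
          subgoal
            apply (rule current_push[OF cur' y])
            using fr neg by (simp_all add: mult_2)
          subgoal using fr stk' by (simp add: stack_def)
          subgoal using fr by simp
          subgoal using J' J by simp
          done
        done
    qed
    done
qed

section \<open>Ranks and printed words\<close>

lemma rank_le:
  assumes st: "static m" and ab: "a \<in> lits F" "b \<in> lits F"
  shows "m RANK (cd a) \<le> m RANK (cd b) \<longleftrightarrow> (a, b) \<in> L"
proof -
  obtain i j where ij: "i < 2 * n" "ls ! i = a" "j < 2 * n" "ls ! j = b"
    using ab ls by (metis in_set_conv_nth)
  have rank: "m RANK (cd a) = i" "m RANK (cd b) = j" using staticD(6)[OF st] ij by auto
  have sorted: "(ls ! k, ls ! l) \<in> L" if "k < l" "l < 2 * n" for k l
    using listing that ls(1) by (auto simp: increasing_listing_def sorted_wrt_iff_nth_less)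
  have refl: "(a, a) \<in> L" using lin ab by (auto simp: order_on_defs refl_on_def)
  show ?thesis
  proof (cases i j rule: linorder_cases)
    case less
    then show ?thesis using rank sorted[of i j] ij by auto
  next
    case equal
    then show ?thesis using rank refl ij by auto
  next
    case greater
    then have "(b, a) \<in> L" "a \<noteq> b" using sorted ij rank by auto
    then show ?thesis using greater rank antisym by (auto dest: antisymD)
  qed
qed

lemma print_words:
  assumes "Q \<noteq> []" "w 0 = cd (hd Q)"
    "\<forall>i<length Q. w (2 * i + 1) = cd (Q ! i) \<and> w (2 * i + 2) = cd (lneg (Q ! i))"
  shows "map w [0..<length Q + length Q] =
    concat (map (\<lambda>(a, b). [cd a, cd b]) ((hd Q, hd Q) # zip (map lneg (butlast Q)) (tl Q)))"
  using assms
proof (induction Q rule: rev_nonempty_induct)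
  case (snoc y Q)
  obtain Q' v where Q: "Q = Q' @ [v]" using snoc.hyps by (metis append_butlast_last_id)
  have IH: "map w [0..<length Q + length Q] =
    concat (map (\<lambda>(a, b). [cd a, cd b]) ((hd Q, hd Q) # zip (map lneg (butlast Q)) (tl Q)))"
  proof (rule snoc.IH)
    show "w 0 = cd (hd Q)" using snoc by simp
    show "\<forall>i<length Q. w (2 * i + 1) = cd (Q ! i) \<and> w (2 * i + 2) = cd (lneg (Q ! i))"
      using snoc.prems(2) by (auto simp: nth_append)
  qed
  have "w (length Q + length Q) = cd (lneg v)" "w (Suc (length Q + length Q)) = cd y"
    using snoc.prems(2)[rule_format, of "length Q'"] snoc.prems(2)[rule_format, of "length Q"] Q
    by (auto simp: nth_append mult_2)
  moreover have "zip (map lneg (butlast (Q @ [y]))) (tl (Q @ [y]))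
      = zip (map lneg (butlast Q)) (tl Q) @ [(lneg v, y)]"
  proof (cases Q')
    case (Cons c Q'')
    have "butlast (Q @ [y]) = butlast Q @ [v]" "tl (Q @ [y]) = tl Q @ [y]"
      using Q Cons by (simp_all add: butlast_append)
    moreover have "map lneg Q = map lneg (butlast Q) @ [lneg v]" using Q by simp
    ultimately show ?thesis
      using zip_append[of "map lneg (butlast Q)" "tl Q" "[lneg v]" "[y]"] by simp
  qed (simp add: Q)
  ultimately show ?case using IH snoc.hyps by simp
qed simp

lemma zip_butlast: "zip (butlast Q) (tl Q) = zip Q (tl Q)"
proof (cases Q rule: rev_cases)
  case (snoc Q' v)
  have "zip (Q' @ [v]) zs = zip Q' zs" if "length zs \<le> length Q'" for zs
    using that by (simp add: zip_append1)
  from this[of "tl Q"] show ?thesis using snoc by simp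
qed simp

text \<open>Only the absence of repeated clauses needs an argument. Two arcs with the same clause
  are equal or contrapositions of each other; in the second case each head is the complement of an
  earlier vertex, hence both are the last vertex, and the arcs coincide. The unit-clause differs
  from all of them, as the start vertex is no head.\<close>

lemma presents_path_clauses:
  assumes Q: "Q \<in> nr_paths F x"
  shows "presents ((hd Q, hd Q) # zip (map lneg (butlast Q)) (tl Q)) (path_clauses Q)"
proof -
  have dis: "distinct Q" and ne: "Q \<noteq> []" using Q by (auto simp: nr_paths_def is_path_def)
  have reg: "regular (butlast Q)" using regular_butlast_nr[OF Q] .
  let ?f = "\<lambda>(a, b). {lneg a, b}"
  have eq: "map (\<lambda>(a, b). {a, b}) (zip (map lneg (butlast Q)) (tl Q)) = map ?f (zip (butlast Q) (tl Q))"
    unfolding zip_map1 map_map by (intro map_cong) auto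
  have arcs: "path_arcs Q = set (zip (butlast Q) (tl Q))" unfolding path_arcs_def zip_butlast ..
  have lastQ: "lneg a = last Q" if "a \<in> set (butlast Q)" "lneg a \<in> set (tl Q)" for a
  proof -
    have "lneg a \<notin> set (butlast Q)" using that(1) reg unfolding regular_iff by blast
    moreover have "lneg a \<in> set (butlast Q @ [last Q])" using that(2) ne by (simp add: list.set_sel(2))
    ultimately show ?thesis by simp
  qed
  have inj: "inj_on ?f (path_arcs Q)"
  proof (rule inj_onI, clarify)
    fix a b c d assume *: "(a, b) \<in> path_arcs Q" "(c, d) \<in> path_arcs Q" "{lneg a, b} = {lneg c, d}"
    note l = path_arcs_lits[OF *(1)] path_arcs_lits[OF *(2)]
    from *(3) consider "a = c" "b = d" | "lneg a = d" "b = lneg c" by (auto simp: doubleton_eq_iff)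
    then show "a = c \<and> b = d"
    proof cases
      case 2
      then have "d = last Q" "b = last Q" using lastQ l by auto
      then have "lneg a = lneg c" using 2 by simp
      then show ?thesis using 2 by simp
    qed simp
  qed
  have "distinct (map ?f (zip (butlast Q) (tl Q)))"
    using inj dis unfolding distinct_map arcs by (simp add: distinct_zipI1 distinct_butlast)
  moreover have "{hd Q} \<notin> ?f ` path_arcs Q"
  proof
    assume "{hd Q} \<in> ?f ` path_arcs Q"
    then obtain a b where "(a, b) \<in> path_arcs Q" "{hd Q} = {lneg a, b}" by auto
    then have "hd Q \<in> set (tl Q)" using path_arcs_lits by blast
    then show False using dis ne by (metis distinct.simps(2) list.collapse)
  qed
  moreover have "path_clauses Q = insert {hd Q} (?f ` path_arcs Q)"
  proof -
    have "CL (path_arcs Q) = ?f ` path_arcs Q" by (auto simp: CL_def)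
    then show ?thesis by (simp add: path_clauses_def)
  qed
  ultimately show ?thesis unfolding presents_def using eq arcs by simp
qed

end

text \<open>A path and its partner differ immediately behind the complement of the last vertex (unless the
  last arc is a unit), so that OUTPUT needs a single comparison of ranks.\<close>
definition dfs_step :: com where
  "dfs_step = pop ;; Emit dfs_tag PATH (scalar DEP) ;;
    If (Less (Const 0) (Cell POS (Cell NEG (scalar TOP))))
      (Emit output_tag PATH (scalar DEP) ;;
       If (Not (Less (Cell RANK (Cell NEG (Cell PATH (Sub (scalar DEP) (Const 2)))))
                     (Cell RANK (Cell PATH (Cell POS (Cell NEG (scalar TOP)))))))
         (Emit print_tag PRT (Add (scalar DEP) (scalar DEP))) Skip)
      (search ;; mark ;; push)"

definition first_search :: com where
  "first_search = init ;; search ;;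
    If (Less (Const 0) (Cell VIS start))
      (Store ST (Const 0) start ;; Store SD (Const 0) (Const 0) ;; assign SP (Const 1)) Skip"

definition enum_program :: com where
  "enum_program = first_search ;; While (Less (Const 0) (scalar SP)) dfs_step"

lemma gwp_of_wp: "wp B c Q m 0 \<Longrightarrow> gwp B c (\<lambda>tr m'. silent tr \<and> Q m' (length tr)) m"
  by (simp add: wp_def)

text \<open>The form of the list forces at least one output in the stretch. When two stretches are
  joined, only the sum of the final wait and the next initial wait is then new.\<close>

definition paced :: "item list \<Rightarrow> nat \<Rightarrow> nat \<Rightarrow> nat \<Rightarrow> bool" where
  "paced tr a T d \<longleftrightarrow> (\<exists>a' ws d'. waits output_tag tr = a' # ws @ [d'] \<and> a' \<le> a \<and> d' \<le> d \<and> (\<forall>w\<in>set ws. w \<le> T))"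

lemma paced_append:
  assumes "paced tr a T d" "paced tr' a' T d'" "d + a' \<le> T"
  shows "paced (tr @ tr') a T d'"
proof -
  obtain b ws c where 1: "waits output_tag tr = b # ws @ [c]" "b \<le> a" "c \<le> d" "\<forall>w\<in>set ws. w \<le> T"
    using assms(1) by (auto simp: paced_def)
  obtain b' ws' c' where 2: "waits output_tag tr' = b' # ws' @ [c']" "b' \<le> a'" "c' \<le> d'" "\<forall>w\<in>set ws'. w \<le> T"
    using assms(2) by (auto simp: paced_def)
  have "waits output_tag (tr @ tr') = b # (ws @ (c + b') # ws') @ [c']"
    using 1(1) 2(1) by (simp add: waits_append butlast_append)
  then show ?thesis unfolding paced_def using 1 2 assms(3)
    by (intro exI[of _ b] exI[of _ "ws @ (c + b') # ws'"] exI[of _ c']) auto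
qed

lemma paced_prefix:
  assumes "waits output_tag tr = [k]" "paced tr' a T d"
  shows "paced (tr @ tr') (k + a) T d"
proof -
  obtain b ws c where 1: "waits output_tag tr' = b # ws @ [c]" "b \<le> a" "c \<le> d" "\<forall>w\<in>set ws. w \<le> T"
    using assms(2) by (auto simp: paced_def)
  then have "waits output_tag (tr @ tr') = (k + b) # ws @ [c]"
    using assms(1) by (simp add: waits_append)
  then show ?thesis unfolding paced_def using 1
    by (intro exI[of _ "k + b"] exI[of _ ws] exI[of _ c]) auto
qed

context coded_instance
begin

section \<open>Single steps of the main loop\<close>

definition machine_inv :: "'a literal list \<Rightarrow> ('a literal \<times> nat) list \<Rightarrow> mem \<Rightarrow> bool" where
  "machine_inv P st m \<longleftrightarrow> static m \<and> current P m \<and> stack st m \<and> (\<forall>a\<in>lits F. m CAND (cd a) = 0)"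

lemma current_words: "current P m \<Longrightarrow> map (m PATH) [0..<length P] = map cd P"
  by (intro nth_equalityI) (auto simp: current_def)

lemma current_length: "current P m \<Longrightarrow> length P \<le> 2 * n"
  by (intro distinct_lits_length) (auto simp: current_def)

lemma gwp_pop:
  assumes "machine_inv (P @ J) ((y, length P) # st) m" "y \<in> lits F" "y \<notin> set P"
  shows "gwp B pop (\<lambda>tr m'. silent tr \<and> length tr \<le> 6 * n + 9 \<and> machine_inv (P @ [y]) st m' \<and> m' TOP 0 = cd y) m"
proof -
  have "static m" "current (P @ J) m" "stack ((y, length P) # st) m" "\<forall>a\<in>lits F. m CAND (cd a) = 0"
    using assms(1) by (auto simp: machine_inv_def)
  note wp = wp_pop[OF this(1-3) assms(2,3), of 0]
  show ?thesis
  proof (rule gwp_conseq[OF gwp_of_wp[OF wp]])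
    fix tr m'
    assume *: "silent tr \<and> current (P @ [y]) m' \<and> stack st m' \<and> m' TOP 0 = cd y \<and> length tr \<le> 0 + 6 * n + 9"
      "\<forall>a. a \<notin> stored pop \<longrightarrow> m' a = m a"
    have fr: "m' 0 = m 0" "m' LS = m LS" "m' NEG = m NEG" "m' RANK = m RANK" "m' OTH = m OTH" "m' NXT = m NXT"
      "m' HEAD = m HEAD" "m' CAND = m CAND"
      using *(2) by (simp_all add: pop_def)
    have "static m'" using \<open>static m\<close> by (subst static_cong[of _ m]) (use fr in simp_all)
    then show "silent tr \<and> length tr \<le> 6 * n + 9 \<and> machine_inv (P @ [y]) st m' \<and> m' TOP 0 = cd y"
      using * fr \<open>\<forall>a\<in>lits F. m CAND (cd a) = 0\<close> by (simp add: machine_inv_def)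
  qed
qed

text \<open>The one-based position of \<open>u\<close> is the zero-based index of the vertex behind
  \<open>u\<close>, and \<open>DEP - 2\<close> that of the vertex before the last. If the last arc
  is a unit, both compared literals are \<open>lneg u\<close>, so the same test accepts and no case
  distinction is programmed.\<close>

lemma rank_test:
  assumes st: "static m" and cur: "current (P @ [y]) m" and top: "m TOP 0 = cd y"
    and Q: "P @ [y] \<in> nr_paths F x"
  shows "\<not> m RANK (m NEG (m PATH (m DEP 0 - 2))) < m RANK (m PATH (m POS (m NEG (m TOP 0))))
    \<longleftrightarrow> output_prints L (P @ [y])"
proof -
  obtain A u R where split: "P @ [y] = A @ u # R @ [lneg u]" using Q by (rule nr_paths_cases)
  then have yu: "y = lneg u" and P: "P = A @ u # R" by (metis append_Cons append_assoc last_snoc, metis append_Cons append_assoc butlast_snoc)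
  have sub: "set (P @ [y]) \<subseteq> lits F" using cur by (simp add: current_def)
  have lastl: "last (u # R) \<in> lits F" 
    using sub P last_in_set[of "u # R"] by (auto simp del: last.simps last_in_set)
  have hdl: "hd (R @ [lneg u]) \<in> lits F" using sub unfolding split by (cases R) auto
  have dep: "m DEP 0 = Suc (length P)" using cur by (simp add: current_def)
  have "m PATH (length P - 1) = cd ((P @ [y]) ! (length P - 1))" "P \<noteq> []"
    using cur P by (simp_all add: current_def)
  then have "m PATH (length P - 1) = cd (last P)" by (simp add: nth_append last_conv_nth)
  then have 1: "m NEG (m PATH (m DEP 0 - 2)) = cd (lneg (last (u # R)))"
    using dep P lastl staticD(5)[OF st, of "last (u # R)"] by (simp del: last.simps) 
  have len: "length A < length (P @ [y])" "Suc (length A) < length (P @ [y])" using P by simp_all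
  have "m POS (cd ((P @ [y]) ! length A)) = Suc (length A)"
    using cur len(1) unfolding current_def by blast
  moreover have "(P @ [y]) ! length A = u" using split by simp
  moreover have ul: "u \<in> lits F" using sub P by simp
  moreover have "m NEG (m TOP 0) = cd u" using top yu staticD(5)[OF st, of "lneg u"] ul by simp
  moreover have "m PATH (Suc (length A)) = cd ((P @ [y]) ! Suc (length A))"
    using cur len(2) unfolding current_def by blast
  moreover have "(P @ [y]) ! Suc (length A) = hd (R @ [lneg u])" unfolding split by (cases R) (auto simp: nth_append)
  ultimately have 2: "m PATH (m POS (m NEG (m TOP 0))) = cd (hd (R @ [lneg u]))" by simp
  have "\<not> m RANK (cd (lneg (last (u # R)))) < m RANK (cd (hd (R @ [lneg u])))
    \<longleftrightarrow> (hd (R @ [lneg u]), lneg (last (u # R))) \<in> L"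
    using rank_le[OF st hdl, of "lneg (last (u # R))"] lastl by (simp add: not_less del: last.simps)
  moreover have "\<dots> \<longleftrightarrow> output_prints L (P @ [y])"
  proof (cases "R = []")
    case True
    have "(lneg u, lneg u) \<in> L" using lin ul by (auto simp: order_on_defs refl_on_def)
    then show ?thesis using output_prints_iff(1)[OF Q split] True by simp
  next
    case False
    then show ?thesis using output_prints_iff(1)[OF Q split] by simp
  qed
  ultimately show ?thesis unfolding 1 2 by simp
qed

text \<open>Up to the output: \<open>6 * n + 9\<close> for \<open>pop\<close>, two emissions of at
  most \<open>2 * n + 1\<close> ticks, and one test. Behind it: the rank test, and at most
  \<open>4 * n + 1\<close> ticks for printing.\<close>

lemma gwp_step_output:
  assumes machine_inv: "machine_inv (P @ J) ((y, length P) # st) m" and Q: "P @ [y] \<in> nr_paths F x"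
  shows "gwp B dfs_step (\<lambda>tr m'. machine_inv (P @ [y]) st m' \<and>
    list_all2 (emits_event e) (emissions tr) (DFS_call P y # output_run L (P @ [y])) \<and>
    (\<exists>a d. waits output_tag tr = [a, d] \<and> a \<le> 10 * n + 12 \<and> d \<le> 4 * n + 2)) m"
proof -
  have path: "distinct (P @ [y])" "set (P @ [y]) \<subseteq> lits F" "hd (P @ [y]) = x" "lneg y \<in> set P"
    using Q by (auto simp: nr_paths_def is_path_def nearly_regular_snoc)
  show ?thesis
    unfolding dfs_step_def
  proof (intro gwp_Seq, rule gwp_conseq[OF gwp_pop[OF machine_inv]], goal_cases)
    case 1
    then show ?case using path by simp
  next
    case 2
    then show ?case using path by simp
  next
    case (3 tr m')
    then have st: "static m'" and cur: "current (P @ [y]) m'" and top: "m' TOP 0 = cd y"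
      and tr: "silent tr" "length tr \<le> 6 * n + 9" and machine_inv': "machine_inv (P @ [y]) st m'"
      by (auto simp: machine_inv_def)
    have dep: "m' DEP 0 = length (P @ [y])" using cur by (simp add: current_def)
    have len: "length (P @ [y]) \<le> 2 * n" using current_length[OF cur] .
    have neg: "m' NEG (cd y) = cd (lneg y)" using staticD(5)[OF st] path by simp
    have pos: "0 < m' POS (cd (lneg y))"
      using path current_avoids[OF cur] by (auto simp: avoids_def)
    have words: "map (m' PATH) [0..<m' DEP 0] = map cd (P @ [y])"
      using current_words[OF cur] dep by simp
    have print: "emits_event e (print_tag, map (m' PRT) [0..<m' DEP 0 + m' DEP 0]) (Print (path_clauses (P @ [y])))"
    proof -
      let ?ps = "(hd (P @ [y]), hd (P @ [y])) # zip (map lneg (butlast (P @ [y]))) (tl (P @ [y]))"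
      have "map (m' PRT) [0..<length (P @ [y]) + length (P @ [y])] = concat (map (\<lambda>(a, b). [cd a, cd b]) ?ps)"
        by (rule print_words) (use cur path(3) in \<open>simp_all add: current_def\<close>)
      then show ?thesis using presents_path_clauses[OF Q] unfolding dep emits_event.simps by blast
    qed
    note rank = rank_test[OF st cur top Q]
    show ?case
      apply (intro gwp_Seq gwp_Emit gwp_If)
      subgoal
        using tr machine_inv' words print rank len dep
        by (simp add: output_run_def waits_append waits_emit_trace dfs_tag_def output_tag_def print_tag_def)
      subgoal
        apply (rule gwp_Skip)
        using tr machine_inv' words rank len dep
        by (simp add: output_run_def waits_append waits_emit_trace dfs_tag_def output_tag_def print_tag_def)
      subgoal using neg pos top by simp
      done
  qed
qed

text \<open>The sum of \<open>6 * n + 9\<close> for \<open>pop\<close>, \<open>2 * n + 1\<close> for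
  the emission, one test, and \<open>28 * n + 22 * length ps + 11\<close> for \<open>search\<close>,
  \<open>mark\<close> and \<open>push\<close> together.\<close>

definition branch_time :: nat where "branch_time = 36 * n + 22 * length ps + 22"

lemma gwp_step_branch:
  assumes machine_inv: "machine_inv (P @ J) ((y, length P) # st) m"
    and path: "is_path F (P @ [y])" "hd (P @ [y]) = x" "regular (P @ [y])"
    and zs: "increasing_listing L (candidates F (lneg x) (P @ [y]) y) zs"
    and len: "length st + length zs \<le> B"
  shows "gwp B dfs_step (\<lambda>tr m'. machine_inv (P @ [y]) (map (\<lambda>z. (z, Suc (length P))) zs @ st) m' \<and>
    list_all2 (emits_event e) (emissions tr) [DFS_call P y] \<and>
    (\<exists>a. waits output_tag tr = [a] \<and> a \<le> branch_time)) m"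
proof -
  let ?V = "set (P @ [y])"
  let ?C = "candidates F (lneg x) (P @ [y]) y"
  have y: "y \<in> lits F" "y \<notin> set P" using path(1) by (auto simp: is_path_def)
  have "x \<in> ?V" using path(2) by (metis hd_in_set snoc_eq_iff_butlast)
  then have xV: "lneg x \<notin> ?V" using path(3) unfolding regular_iff by blast
  have ny: "lneg y \<notin> ?V" using path(3) unfolding regular_iff by simp
  have C: "?C = {a. (y, a) \<in> idg F \<and> a \<in> backward ?V}" by (rule candidates_eq[OF xV])
  have CF: "?C \<subseteq> lits F" using candidates_subset[of F "lneg x" "P @ [y]" y] by auto
  have cardC: "card ?C = length zs" using zs distinct_card[of zs] by (simp add: increasing_listing_def)
  \<comment> \<open>Both are increasing listings of the candidates, so \<open>push\<close> stacks
    exactly the list \<open>zs\<close> of the procedure.\<close>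
  have fil: "filter (\<lambda>z. z \<in> ?C) ls = zs"
  proof (rule increasing_listing_unique[OF antisym _ zs])
    show "increasing_listing L ?C (filter (\<lambda>z. z \<in> ?C) ls)"
      using listing CF unfolding increasing_listing_def by (auto simp: sorted_wrt_filter)
  qed
  show ?thesis
    unfolding dfs_step_def
  proof (intro gwp_Seq, rule gwp_conseq[OF gwp_pop[OF machine_inv y]], goal_cases)
    case (1 tr m')
    then have st: "static m'" and cur: "current (P @ [y]) m'" and top: "m' TOP 0 = cd y"
      and tr: "silent tr" "length tr \<le> 6 * n + 9" and stk: "stack st m'"
      and cand: "\<forall>a\<in>lits F. m' CAND (cd a) = 0"
      by (auto simp: machine_inv_def)
    have dep: "m' DEP 0 = length (P @ [y])" using cur by (simp add: current_def)
    have plen: "length (P @ [y]) \<le> 2 * n" using current_length[OF cur] .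
    have neg: "m' NEG (cd y) = cd (lneg y)" using staticD(5)[OF st] y by simp
    have pos: "m' POS (cd (lneg y)) = 0"
      using ny y current_avoids[OF cur] by (simp add: avoids_def)
    have words: "map (m' PATH) [0..<m' DEP 0] = map cd (P @ [y])"
      using current_words[OF cur] dep by simp
    have wp: "wp B (search ;; mark ;; push) (\<lambda>m2 t. machine_inv (P @ [y]) (map (\<lambda>z. (z, Suc (length P))) zs @ st) m2 \<and>
        t \<le> 28 * n + 22 * length ps + 11) m' 0"
      apply (rule wp_Seq, rule wp_conseq[OF wp_search[OF st current_avoids[OF cur] xV]])
      subgoal premises p1 for m1 t1
      proof -
        have fr1: "m1 0 = m' 0" "m1 LS = m' LS" "m1 NEG = m' NEG" "m1 RANK = m' RANK" "m1 OTH = m' OTH" "m1 NXT = m' NXT"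
          "m1 HEAD = m' HEAD" "m1 CAND = m' CAND" "m1 POS = m' POS" "m1 PATH = m' PATH" "m1 PRT = m' PRT"
          "m1 ST = m' ST" "m1 SD = m' SD" "m1 SP = m' SP" "m1 DEP = m' DEP" "m1 TOP = m' TOP"
          using p1(3) by (simp_all add: search_def scan_def)
        have st1: "static m1" using st by (subst static_cong[of _ m']) (use fr1 in simp_all)
        show ?thesis
          apply (rule wp_Seq, rule wp_conseq[OF wp_mark[OF st1 y(1) _ xV]])
          subgoal using top fr1 by simp
          subgoal using p1(1) by simp
          subgoal using cand fr1 by simp
          subgoal premises p2 for m2 t2
          proof -
            have fr2: "m2 0 = m1 0" "m2 LS = m1 LS" "m2 NEG = m1 NEG" "m2 RANK = m1 RANK" "m2 OTH = m1 OTH" "m2 NXT = m1 NXT"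
              "m2 HEAD = m1 HEAD" "m2 POS = m1 POS" "m2 PATH = m1 PATH" "m2 PRT = m1 PRT"
              "m2 ST = m1 ST" "m2 SD = m1 SD" "m2 SP = m1 SP" "m2 DEP = m1 DEP"
              using p2(3) by (simp_all add: mark_def)
            have st2: "static m2" using st1 by (subst static_cong[of _ m1]) (use fr2 in simp_all)
            have cand2: "\<forall>a\<in>lits F. m2 CAND (cd a) = (if a \<in> ?C then 1 else 0)"
              using p2(1) unfolding C by simp
            have stk2: "stack st m2" using stk fr1 fr2 by (simp add: stack_def)
            show ?thesis
              apply (rule wp_conseq[OF wp_push[OF st2 CF cand2 stk2, of "Suc (length P)"]])
              subgoal using len cardC by simp
              subgoal using dep fr1 fr2 by simp
              subgoal premises p3 for m3 t3
              proof -
                have fr3: "m3 0 = m2 0" "m3 LS = m2 LS" "m3 NEG = m2 NEG" "m3 RANK = m2 RANK" "m3 OTH = m2 OTH" "m3 NXT = m2 NXT"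
                  "m3 HEAD = m2 HEAD" "m3 POS = m2 POS" "m3 PATH = m2 PATH" "m3 PRT = m2 PRT" "m3 DEP = m2 DEP"
                  using p3(3) by (simp_all add: push_def)
                have "static m3" using st2 by (subst static_cong[of _ m2]) (use fr3 in simp_all)
                moreover have "current (P @ [y]) m3"
                  using cur fr1 fr2 fr3 by (simp add: current_def)
                ultimately show ?thesis using p1(1) p2(1) p3(1) fil unfolding machine_inv_def by simp
              qed
              done
          qed
          done
      qed
      done
    show ?case
      apply (intro gwp_Seq[of B "Emit dfs_tag PATH (scalar DEP)"] gwp_Emit gwp_If)
      subgoal using neg pos top by simp
      apply (rule gwp_conseq[OF gwp_of_wp[OF wp]])
      using tr words plen dep
      by (simp add: waits_append waits_emit_trace dfs_tag_def output_tag_def branch_time_def)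
  qed
qed

text \<open>Budget for pending entries: one for the start vertex, and the listed out-arcs of each
  path vertex \<open>v\<close>, that is, the occurrences of \<open>lneg v\<close>. Extending the
  path by \<open>y\<close> raises it by enough for the candidates of \<open>y\<close>.\<close>

definition capacity :: "'a literal set \<Rightarrow> nat" where
  "capacity V = Suc (\<Sum>v\<in>V. length (occ (lneg v)))"

lemma capacity_le: "V \<subseteq> lits F \<Longrightarrow> capacity V \<le> B"
proof -
  assume "V \<subseteq> lits F"
  then have "(\<Sum>v\<in>V. length (occ (lneg v))) \<le> (\<Sum>v\<in>lits F. length (occ (lneg v)))"
    by (intro sum_mono2) auto
  also have "\<dots> = (\<Sum>v\<in>lits F. length (occ v))"
    by (rule sum.reindex_bij_witness[of _ lneg lneg]) auto
  also have "\<dots> = length ps + length ps" using sum_length_occs[of "length slots"] length_slots by simp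
  finally show ?thesis using nocc_ge unfolding capacity_def B_def by simp
qed

lemma card_candidates: "card (candidates F t P y) \<le> length (occ (lneg y))"
proof -
  have "candidates F t P y \<subseteq> (\<lambda>s. snd (slots ! (s - 1))) ` set (occ (lneg y))"
  proof
    fix z assume "z \<in> candidates F t P y"
    then have "{lneg y, z} \<in> F" by (simp add: candidates_def idg_iff)
    then show "z \<in> (\<lambda>s. snd (slots ! (s - 1))) ` set (occ (lneg y))"
      using occ_neighbours[of "lneg y" z] by (auto simp del: One_nat_def)
  qed
  then have "card (candidates F t P y) \<le> card (set (occ (lneg y)))"
    by (meson List.finite_set card_image_le card_mono finite_imageI le_trans)
  then show ?thesis using card_length le_trans by blast
qed

abbreviation "pending \<equiv> Less (Const 0) (scalar SP)"

lemma dfs_step_size: "max_exp_size (While pending dfs_step) \<le> 16"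
  by (simp add: dfs_step_def pop_def search_def scan_def mark_def push_def dfs_tag_def output_tag_def print_tag_def)

text \<open>Time until the first output of a call with path \<open>P\<close>: at most one branching
  step and one loop test for each vertex that may still be added. As \<open>P\<close> has at most
  \<open>2 * n\<close> vertices, there is always room for the final output step.\<close>

abbreviation descent :: "'a literal list \<Rightarrow> nat" where
  "descent P \<equiv> (2 * n + 2 - length P) * Suc branch_time"
abbreviation "rest_time \<equiv> 4 * n + 2"
abbreviation "pace \<equiv> rest_time + (2 * n + 2) * Suc branch_time"
abbreviation "reaches P y \<equiv> (y, lneg x) \<in> (Restr (idg F) (lits F - set P))\<^sup>*"

text \<open>The simulation. A call starts with its entry on top of the stack and ends when only
  \<open>st\<close> remains, whatever tails \<open>J\<close> and \<open>J'\<close> of the path are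
  left over from earlier branches. Since calls leave such tails behind, the invariant mentions the
  path only up to an arbitrary extension of \<open>P\<close>.\<close>

lemma dfs_steps:
  shows "dfs F L x P y es \<Longrightarrow> is_path F (P @ [y]) \<Longrightarrow> hd (P @ [y]) = x \<Longrightarrow> regular P \<Longrightarrow> reaches P y \<Longrightarrow>
      Suc (length st) \<le> capacity (set P) \<Longrightarrow> machine_inv (P @ J) ((y, length P) # st) m \<Longrightarrow> bounded B m \<Longrightarrow>
      \<exists>tr m' J'. loop_steps B pending dfs_step m tr m' \<and> machine_inv (P @ J') st m' \<and>
        list_all2 (emits_event e) (emissions tr) es \<and> paced tr (descent P) pace rest_time"
    and "dfs_loop F L x P zs es \<Longrightarrow> \<forall>z\<in>set zs. is_path F (P @ [z]) \<and> reaches P z \<Longrightarrow> P \<noteq> [] \<Longrightarrow> hd P = x \<Longrightarrow>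
      regular P \<Longrightarrow> length st + length zs \<le> capacity (set P) \<Longrightarrow>
      machine_inv (P @ J) (map (\<lambda>z. (z, length P)) zs @ st) m \<Longrightarrow> bounded B m \<Longrightarrow>
      \<exists>tr m' J'. loop_steps B pending dfs_step m tr m' \<and> machine_inv (P @ J') st m' \<and>
        list_all2 (emits_event e) (emissions tr) es \<and>
        (if zs = [] then tr = [] else paced tr (descent P) pace rest_time)"
proof (induction arbitrary: st J m and st J m rule: dfs_dfs_loop.inducts)
  case (dfs_output P y)
  have Q: "P @ [y] \<in> nr_paths F x"
    using dfs_output by (auto simp: nr_paths_def nearly_regular_snoc regular_snoc)
  have "bval pending m" using dfs_output by (simp add: machine_inv_def stack_def)
  then obtain tr m' where 1: "loop_steps B pending dfs_step m (Tick (bcells pending m) (bwords pending m) # tr) m'"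
    "machine_inv (P @ [y]) st m'" "list_all2 (emits_event e) (emissions tr) (DFS_call P y # output_run L (P @ [y]))"
    "\<exists>a d. waits output_tag tr = [a, d] \<and> a \<le> 10 * n + 12 \<and> d \<le> 4 * n + 2"
    using loop_steps_body[OF gwp_step_output[OF _ Q] _ _ dfs_step_size] dfs_output by blast
  have "length P \<le> 2 * n" using dfs_output(2) distinct_lits_length[of P] by (auto simp: is_path_def)
  then have "1 * Suc branch_time \<le> descent P" by (intro mult_le_mono1) simp
  then have "Suc branch_time \<le> descent P" by (simp only: mult_1)
  moreover have "10 * n + 13 \<le> Suc branch_time" by (simp add: branch_time_def)
  ultimately have "10 * n + 13 \<le> descent P" by (rule le_trans[rotated])
  then have "paced (Tick (bcells pending m) (bwords pending m) # tr) (descent P) pace rest_time"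
    unfolding paced_def using 1(4) by (auto intro!: exI[of _ "[]"])
  then show ?case using 1 by (intro exI[of _ "Tick (bcells pending m) (bwords pending m) # tr"] exI[of _ m'] exI[of _ "[y]"]) simp
next
  case (dfs_branch P y zs es)
  let ?C = "candidates F (lneg x) (P @ [y]) y"
  have zs: "set zs = ?C" "distinct zs" using dfs_branch(2) by (auto simp: increasing_listing_def)
  have y: "y \<notin> set P" "set (P @ [y]) \<subseteq> lits F" using dfs_branch.prems(1) by (auto simp: is_path_def)
  have lenzs: "length zs \<le> length (occ (lneg y))"
    using zs distinct_card[of zs] card_candidates[of "lneg x" "P @ [y]" y] by simp
  have cap: "capacity (set (P @ [y])) = capacity (set P) + length (occ (lneg y))"
    using y by (simp add: capacity_def)
  have len: "length st + length zs \<le> B"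
    using dfs_branch.prems(5) lenzs cap capacity_le[OF y(2)] by simp
  have "bval pending m" using dfs_branch.prems by (simp add: machine_inv_def stack_def)
  then obtain tr m' where 1: "loop_steps B pending dfs_step m (Tick (bcells pending m) (bwords pending m) # tr) m'"
    "machine_inv (P @ [y]) (map (\<lambda>z. (z, Suc (length P))) zs @ st) m'"
    "list_all2 (emits_event e) (emissions tr) [DFS_call P y]"
    "\<exists>a. waits output_tag tr = [a] \<and> a \<le> branch_time"
    using loop_steps_body[OF gwp_step_branch[OF _ _ _ _ dfs_branch(2) len] _ _ dfs_step_size]
      dfs_branch.prems dfs_branch(1) by blast
  have m': "bounded B m'" using 1(1) by (simp add: loop_steps_def)
  have "\<exists>tr m'' J'. loop_steps B pending dfs_step m' tr m'' \<and> machine_inv ((P @ [y]) @ J') st m'' \<and>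
      list_all2 (emits_event e) (emissions tr) es \<and>
      (if zs = [] then tr = [] else paced tr (descent (P @ [y])) pace rest_time)"
  proof (rule dfs_branch.IH)
    show "\<forall>z\<in>set zs. is_path F ((P @ [y]) @ [z]) \<and> reaches (P @ [y]) z"
      using is_path_candidate[OF dfs_branch.prems(1)] zs(1) by (auto simp: candidates_def)
    show "length st + length zs \<le> capacity (set (P @ [y]))" using dfs_branch.prems(5) lenzs cap by simp
    show "machine_inv ((P @ [y]) @ []) (map (\<lambda>z. (z, length (P @ [y]))) zs @ st) m'" using 1(2) by simp
  qed (use dfs_branch m' in simp_all)
  then obtain tr' m'' J' where 2: "loop_steps B pending dfs_step m' tr' m''" "machine_inv ((P @ [y]) @ J') st m''"
    "list_all2 (emits_event e) (emissions tr') es"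
    "if zs = [] then tr' = [] else paced tr' (descent (P @ [y])) pace rest_time" by blast
  have "lneg x \<noteq> y"
  proof -
    have "x \<in> set (P @ [y])" using dfs_branch.prems(2) by (metis hd_in_set snoc_eq_iff_butlast)
    then show ?thesis using dfs_branch(1) unfolding regular_iff by auto
  qed
  \<comment> \<open>Dead ends are excluded here; otherwise the subtree could consume time without
    any output.\<close>
  then have "zs \<noteq> []" using candidates_nonempty[OF dfs_branch.prems(4)] zs(1) by auto
  then have paced: "paced tr' (descent (P @ [y])) pace rest_time" using 2(4) by simp
  obtain a where a: "waits output_tag tr = [a]" "a \<le> branch_time" using 1(4) by blast
  let ?tr = "Tick (bcells pending m) (bwords pending m) # tr"
  have "paced (?tr @ tr') (Suc a + descent (P @ [y])) pace rest_time"
    by (rule paced_prefix[OF _ paced]) (simp add: a)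
  moreover have "Suc a + descent (P @ [y]) \<le> descent P"
  proof -
    have "length P \<le> 2 * n" using y(2) dfs_branch.prems(1) distinct_lits_length[of P] by (auto simp: is_path_def)
    then have "2 * n + 2 - length P = Suc (2 * n + 2 - length (P @ [y]))" by simp
    then show ?thesis using a(2) by simp
  qed
  ultimately have "paced (?tr @ tr') (descent P) pace rest_time"
    unfolding paced_def by (meson le_trans)
  moreover have "loop_steps B pending dfs_step m (?tr @ tr') m''" using loop_steps_trans[OF 1(1) 2(1)] .
  moreover have "list_all2 (emits_event e) (emissions (?tr @ tr')) (DFS_call P y # es)"
    using list_all2_appendI[OF 1(3) 2(3)] by simp
  ultimately show ?case using 2(2) by (intro exI[of _ "?tr @ tr'"] exI[of _ m''] exI[of _ "y # J'"]) simp
next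
  case (loop_done P)
  then show ?case using loop_steps_refl by (intro exI[of _ "[]"] exI[of _ m] exI[of _ J]) simp
next
  case (loop_next P z es zs es')
  have "\<exists>tr m' J'. loop_steps B pending dfs_step m tr m' \<and> machine_inv (P @ J') (map (\<lambda>z. (z, length P)) zs @ st) m' \<and>
      list_all2 (emits_event e) (emissions tr) es \<and> paced tr (descent P) pace rest_time"
    using loop_next.prems by (intro loop_next(2)) (auto simp: hd_append)
  then obtain tr m' J' where 1: "loop_steps B pending dfs_step m tr m'"
    "machine_inv (P @ J') (map (\<lambda>z. (z, length P)) zs @ st) m'"
    "list_all2 (emits_event e) (emissions tr) es" "paced tr (descent P) pace rest_time" by blast
  have "bounded B m'" using 1(1) by (simp add: loop_steps_def)
  then have "\<exists>tr m'' J'. loop_steps B pending dfs_step m' tr m'' \<and> machine_inv (P @ J') st m'' \<and>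
      list_all2 (emits_event e) (emissions tr) es' \<and>
      (if zs = [] then tr = [] else paced tr (descent P) pace rest_time)"
    using loop_next.prems 1(2) by (intro loop_next(4)) auto
  then obtain tr' m'' J'' where 2: "loop_steps B pending dfs_step m' tr' m''" "machine_inv (P @ J'') st m''"
    "list_all2 (emits_event e) (emissions tr') es'"
    "if zs = [] then tr' = [] else paced tr' (descent P) pace rest_time" by blast
  \<comment> \<open>The gap between siblings: the rest of the step after the last output of one,
    then the descent into the next.\<close>
  have "rest_time + descent P \<le> pace" by (intro add_left_mono mult_le_mono1) simp
  then have "paced (tr @ tr') (descent P) pace rest_time"
    using 1(4) 2(4) paced_append by (cases "zs = []") auto
  moreover have "loop_steps B pending dfs_step m (tr @ tr') m''" using loop_steps_trans[OF 1(1) 2(1)] .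
  ultimately show ?case using list_all2_appendI[OF 1(3) 2(3)] 2(2)
    by (intro exI[of _ "tr @ tr'"] exI[of _ m''] exI[of _ J'']) simp
qed

lemma reachable_iff: "x \<in> backward {} \<longleftrightarrow> (x, lneg x) \<in> (idg F)\<^sup>*"
proof -
  have "Restr (idg F) (lits F - {}) = idg F" using idg_lits by fastforce
  then show ?thesis by (simp add: backward_def)
qed

text \<open>The search for the empty path decides whether \<open>lneg x\<close> is reachable. Its
  time and that of \<open>init\<close> add up to \<open>24 * n + 28 * length ps + 16\<close>; the
  test and three stores give the remaining four ticks.\<close>

lemma wp_first_search:
  "wp B first_search (\<lambda>m t. machine_inv [] (if (x, lneg x) \<in> (idg F)\<^sup>* then [(x, 0)] else []) m \<and>
    t \<le> 24 * n + 28 * length ps + 20) (input_mem e ps ls x F) 0"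
  (is "wp B _ _ ?m 0")
  unfolding first_search_def
  apply (rule wp_Seq, rule wp_conseq[OF wp_init[OF refl]])
  subgoal premises p for m1 t1
  proof -
    have st1: "static m1" and t1: "t1 \<le> 10 * n + 14 * length ps + 9" and prt: "m1 PRT 0 = cd x" using p(1) by auto
    have fr1: "m1 POS = ?m POS" "m1 SP = ?m SP" "m1 DEP = ?m DEP" "m1 CAND = ?m CAND"
      using p(3) by (simp_all add: init_def init_neg_def init_rank_def init_slots_def init_chains_def)
    show ?thesis
      apply (rule wp_Seq, rule wp_conseq[OF wp_search[OF st1, of "{}"]])
      subgoal using fr1 input_mem_simps by (simp add: avoids_def)
      subgoal by simp
      subgoal premises p2 for m2 t2
      proof -
        have fr2: "m2 0 = m1 0" "m2 LS = m1 LS" "m2 NEG = m1 NEG" "m2 RANK = m1 RANK" "m2 OTH = m1 OTH" "m2 NXT = m1 NXT"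
          "m2 HEAD = m1 HEAD" "m2 CAND = m1 CAND" "m2 POS = m1 POS" "m2 PRT = m1 PRT" "m2 SP = m1 SP" "m2 DEP = m1 DEP"
          using p2(3) by (simp_all add: search_def scan_def)
        have st2: "static m2" using st1 by (subst static_cong[of _ m1]) (use fr2 in simp_all)
        have x2: "m2 0 2 = cd x" using staticD(3)[OF st2] .
        have vis: "0 < m2 VIS (cd x) \<longleftrightarrow> (x, lneg x) \<in> (idg F)\<^sup>*"
          using p2(1) by (simp add: reachable_iff)
        have zero: "m2 POS i = 0" "m2 CAND i = 0" "m2 SP 0 = 0" "m2 DEP 0 = 0" for i
          using fr1 fr2 input_mem_simps by simp_all
        have machine_inv: "machine_inv [] st m3" if "stack st m3" "m3 0 = m2 0" "m3 LS = m2 LS" "m3 NEG = m2 NEG" "m3 RANK = m2 RANK"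
          "m3 OTH = m2 OTH" "m3 NXT = m2 NXT" "m3 HEAD = m2 HEAD" "m3 CAND = m2 CAND" "m3 POS = m2 POS"
          "m3 PRT = m2 PRT" "m3 DEP = m2 DEP" for m3 st
        proof -
          have "static m3" using st2 by (subst static_cong[of _ m2]) (use that in simp_all)
          then show ?thesis using that zero prt fr2 by (simp add: machine_inv_def current_def)
        qed
        show ?thesis
          apply (intro wp_intros)
          subgoal using boundedD(1)[OF p2(2)] by simp
          subgoal by simp
          subgoal using boundedD(2)[OF p2(2)] by simp
          subgoal
            apply (rule conjI, rule machine_inv)
            using vis x2 t1 p2(1) by (simp_all add: stack_def)
          subgoal
            apply (rule conjI, rule machine_inv)
            using vis x2 t1 p2(1) zero by (simp_all add: stack_def)
          done
      qed
      done
  qed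
  done

section \<open>Total running time\<close>

lemma paced_silent:
  assumes "paced tr a T d" "silent tr'"
  shows "paced (tr @ tr') a T (d + length tr')"
proof -
  obtain b ws c where "waits output_tag tr = b # ws @ [c]" "b \<le> a" "c \<le> d" "\<forall>w\<in>set ws. w \<le> T"
    using assms(1) by (auto simp: paced_def)
  then show ?thesis unfolding paced_def using assms(2)
    by (intro exI[of _ b] exI[of _ ws] exI[of _ "c + length tr'"]) (simp add: waits_append butlast_append)
qed

text \<open>Origin of 400: the descent needs at most \<open>4 * n\<close> times
  \<open>81 * nocc F\<close> ticks, and the initial phase at most \<open>72 * nocc F\<close>,
  together 396 times \<open>n * nocc F\<close>.\<close>

lemma time_bounds:
  "24 * n + 28 * length ps + 20 + descent [] \<le> 400 * (n * nocc F)" "pace \<le> 400 * (n * nocc F)"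
  "Suc rest_time \<le> 400 * nocc F" "24 * n + 28 * length ps + 21 \<le> 400 * nocc F"
proof -
  have "branch_time \<le> 80 * nocc F" using nocc_ge by (simp add: branch_time_def)
  then have "(2 * n + 2) * Suc branch_time \<le> (4 * n) * (81 * nocc F)"
    using nocc_ge by (intro mult_le_mono) auto
  then have 1: "(2 * n + 2) * Suc branch_time \<le> 324 * (n * nocc F)" by simp
  have "1 * nocc F \<le> n * nocc F" using nocc_ge by (intro mult_le_mono1) simp
  then have 2: "nocc F \<le> n * nocc F" by simp
  have 3: "24 * n + 28 * length ps + 20 \<le> 72 * nocc F" "4 * n + 2 \<le> 6 * nocc F"
    using nocc_ge by simp_all
  have "descent [] = (2 * n + 2) * Suc branch_time" by (simp only: list.size diff_zero)
  then show "24 * n + 28 * length ps + 20 + descent [] \<le> 400 * (n * nocc F)" using 1 2 3(1) by linarith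
  show "pace \<le> 400 * (n * nocc F)" using 1 2 3(2) by linarith
  show "Suc rest_time \<le> 400 * nocc F" "24 * n + 28 * length ps + 21 \<le> 400 * nocc F"
    using nocc_ge by simp_all
qed

lemma enum_program_run:
  "\<exists>tr m es. exec enum_program (input_mem e ps ls x F) tr m \<and> words tr \<subseteq> {..16 * B} \<and> enum F x L es \<and>
    list_all2 (emits_event e) (emissions tr) es \<and>
    (\<forall>g\<in>set (butlast (waits output_tag tr)). g \<le> 400 * (n * nocc F)) \<and>
    last (waits output_tag tr) \<le> 400 * nocc F"
proof -
  let ?m0 = "input_mem e ps ls x F"
  obtain es where es: "enum F x L es" using enum_ex1 by blast
  have size: "max_exp_size first_search \<le> 16"
    by (simp add: first_search_def init_def init_neg_def init_rank_def init_slots_def init_chains_def search_def scan_def)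
  obtain tr1 m1 where 1: "exec first_search ?m0 tr1 m1" "bounded B m1" "words tr1 \<subseteq> {..16 * B}" "silent tr1"
    "machine_inv [] (if (x, lneg x) \<in> (idg F)\<^sup>* then [(x, 0)] else []) m1" "length tr1 \<le> 24 * n + 28 * length ps + 20"
    using gwp_of_wp[OF wp_first_search] size bounded_input unfolding gwp_def by auto
  let ?stop = "\<lambda>m. [Tick (bcells pending m) (bwords pending m)]"
  have stop: "exec (While pending dfs_step) m (?stop m) m" "words (?stop m) \<subseteq> {..16 * B}" if "machine_inv P [] m" "bounded B m" for m P
    using that exec.While_False[of pending m dfs_step] test_words_le[OF that(2), of pending] by (simp_all add: machine_inv_def stack_def)
  show ?thesis
  proof (cases "(x, lneg x) \<in> (idg F)\<^sup>*")
    case True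
    have "\<exists>tr m' J'. loop_steps B pending dfs_step m1 tr m' \<and> machine_inv ([] @ J') [] m' \<and>
        list_all2 (emits_event e) (emissions tr) es \<and> paced tr (descent []) pace rest_time"
    proof (rule dfs_steps(1))
      show "dfs F L x [] x es" using es True by (simp add: enum_def)
      show "is_path F ([] @ [x])" by (simp add: is_path_def)
      show "reaches [] x" using True reachable_iff by (simp add: backward_def)
      show "machine_inv ([] @ []) ((x, length []) # []) m1" using 1(5) True by simp
    qed (simp_all add: 1 capacity_def)
    then obtain tr2 m2 J where 2: "loop_steps B pending dfs_step m1 tr2 m2" "machine_inv J [] m2"
      "list_all2 (emits_event e) (emissions tr2) es" "paced tr2 (descent []) pace rest_time" by auto
    then have m2: "bounded B m2" "words tr2 \<subseteq> {..16 * B}" by (simp_all add: loop_steps_def)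
    let ?tr = "tr1 @ tr2 @ ?stop m2"
    have run: "exec enum_program ?m0 ?tr m2"
      unfolding enum_program_def using 1(1) 2(1) stop(1)[OF 2(2) m2(1)]
      by (intro exec.Seq) (auto simp: loop_steps_def)
    have "paced (tr2 @ ?stop m2) (descent []) pace (Suc rest_time)"
      using paced_silent[OF 2(4), of "?stop m2"] by simp
    then have "paced ?tr (length tr1 + descent []) pace (Suc rest_time)"
      using 1(4) by (intro paced_prefix) simp
    then obtain a ws d where w: "waits output_tag ?tr = a # ws @ [d]" "a \<le> length tr1 + descent []" "d \<le> Suc rest_time"
      "\<forall>w\<in>set ws. w \<le> pace" unfolding paced_def by blast
    have "\<forall>g\<in>set (butlast (waits output_tag ?tr)). g \<le> 400 * (n * nocc F)"
      unfolding w(1) using w(2,4) 1(6) time_bounds(1,2) by (auto simp: butlast_append)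
    moreover have "last (waits output_tag ?tr) \<le> 400 * nocc F" unfolding w(1) using w(3) time_bounds(3) by simp
    moreover have "list_all2 (emits_event e) (emissions ?tr) es" using 1(4) 2(3) by simp
    moreover have "words ?tr \<subseteq> {..16 * B}" using 1(3) m2(2) stop(2)[OF 2(2) m2(1)] by simp
    ultimately show ?thesis using run es by blast
  next
    case False
    then have machine_inv: "machine_inv [] [] m1" using 1(5) by simp
    let ?tr = "tr1 @ ?stop m1"
    have "exec enum_program ?m0 ?tr m1"
      unfolding enum_program_def using 1(1) stop(1)[OF machine_inv 1(2)] by (rule exec.Seq)
    \<comment> \<open>Without any output the only wait is the final one, and it includes
      initialisation and the first search, all linear.\<close>
    moreover have "waits output_tag ?tr = [Suc (length tr1)]" using 1(4) by (simp add: waits_append)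
    moreover have "Suc (length tr1) \<le> 400 * nocc F" using 1(6) time_bounds(4) by simp
    moreover have "es = []" using es False by (simp add: enum_def)
    moreover have "words ?tr \<subseteq> {..16 * B}" using 1(3) stop(2)[OF machine_inv 1(2)] by simp
    ultimately show ?thesis using es 1(4) by (intro exI[of _ ?tr] exI[of _ m1] exI[of _ es]) simp
  qed
qed

lemma emitted_tags: "list_all2 (emits_event e) ems es \<Longrightarrow> map fst ems = map event_tag es"
proof (induction rule: list_all2_induct)
  case (Cons em ems ev es)
  then show ?case by (cases em; cases ev) auto
qed simp

text \<open>By the ballot property gap \<open>k\<close> contains at most \<open>k + 1\<close>
  outputs, so it takes at most \<open>T * (k + 1) + T\<close>, which is below the doubled
  product.\<close>

lemma print_waits:
  assumes "enum F x L es" "list_all2 (emits_event e) (emissions tr) es"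
    and "\<forall>g\<in>set (waits output_tag tr). g \<le> T" and k: "k < length (waits print_tag tr)"
  shows "waits print_tag tr ! k \<le> 2 * ((k + 1) * T)"
proof -
  let ?gaps = "output_gaps (map fst (emissions tr))"
  let ?bs = "map (output_prints L) (outputs es)"
  have gaps: "?gaps = output_gaps (concat (map (\<lambda>b. if b then [output_tag, print_tag] else [output_tag]) ?bs))"
    unfolding emitted_tags[OF assms(2)] enum_outputs(4)[OF assms(1), symmetric] output_gaps_filter ..
  obtain w ws where w: "waits output_tag tr = w # ws" by (cases "waits output_tag tr") auto
  obtain p pp where p: "waits print_tag tr = p # pp" by (cases "waits print_tag tr") auto
  obtain g gg where g: "?gaps = g # gg" by (cases ?gaps) auto
  have "list_all2 (\<lambda>p g. p \<le> T * g + T) (waits print_tag tr) ?gaps"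
    using waits_print_le[OF assms(3)] assms(3) unfolding w p g by simp
  then have le: "waits print_tag tr ! k \<le> T * (?gaps ! k) + T" and "length (waits print_tag tr) = length ?gaps"
    using k by (auto simp: list_all2_conv_all_nth)
  have "length (filter (\<lambda>b. \<not> b) (take i ?bs)) \<le> length (filter (\<lambda>b. b) (take i ?bs)) + 0" for i
    using outputs_ballot[OF assms(1), of i] by (simp add: take_map filter_map comp_def)
  then have "?gaps ! k \<le> 0 + k + 1"
    unfolding gaps by (rule output_gaps_ballot) (use k \<open>length _ = length ?gaps\<close> gaps in simp)
  then have "T * (?gaps ! k) \<le> T * (k + 1)" by (intro mult_le_mono2) simp
  then show ?thesis using le by (simp add: algebra_simps)
qed

end

theorem theorem7p4:
  shows "\<exists>(p :: com) (c :: nat).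
    \<forall>(F :: 'v clauses) (x :: 'v literal) (L :: ('v literal \<times> 'v literal) set).
      is_clause_set F \<and> (\<forall>C\<in>F. card C = 1 \<or> card C = 2) \<and> {x} \<in> F \<and> linear_order_on (lits F) L
      \<longrightarrow>
      (\<exists>!es. enum F x L es) \<and>
      (\<forall>es. enum F x L es \<longrightarrow>
         distinct (outputs es) \<and> set (outputs es) = nr_paths F x \<and>
         sorted_wrt (pathlex L) (outputs es) \<and>
         distinct (prints es) \<and> set (prints es) = mus_with x F \<and>
         sorted_wrt (muslex_from L F x) (prints es) \<and>
         sorted_wrt (\<lambda>F' F''. least_unit L F' = x \<and> least_unit L F'' = x \<longrightarrow> muslex L F F' F'')
           (prints es) \<and>
         (\<forall>F'\<in>mus_with x F. \<exists>P. output_prints L P \<and>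
            (filter (\<lambda>Q. path_clauses Q = F') (outputs es) = [P] \<or>
             (\<exists>P'. filter (\<lambda>Q. path_clauses Q = F') (outputs es) = [P, P'] \<and>
                   \<not> output_prints L P')))) \<and>
      (\<forall>e ps ls. represents_input e ps ls F L \<longrightarrow>
         (\<exists>tr. implements_enum p F x L tr e ps ls \<and>
            (\<forall>g \<in> set (butlast (waits output_tag tr)). g \<le> c * (nvars F * nocc F)) \<and>
            last (waits output_tag tr) \<le> c * nocc F \<and>
            space tr \<le> c * nocc F \<and>
            (\<forall>w \<in> words tr. w \<le> c * nocc F) \<and>
            (\<forall>k < length (waits print_tag tr).
               waits print_tag tr ! k \<le> c * ((k + 1) * (nvars F * nocc F)))))"
\<comment> \<open>800 doubles the 400 of the waits for outputs, as \<open>print_waits\<close>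
  requires. The 65 per array counts the addresses from zero to \<open>16 * B\<close>, which is 64
  times \<open>nocc F\<close>.\<close>
proof (intro exI[of _ enum_program] exI[of _ "800 + 65 * card (arrays enum_program)"] allI impI)
  fix F :: "'v clauses" and x L
  let ?c = "800 + 65 * card (arrays enum_program)"
  assume "is_clause_set F \<and> (\<forall>C\<in>F. card C = 1 \<or> card C = 2) \<and> {x} \<in> F \<and> linear_order_on (lits F) L"
  then interpret instance_2cnf F x L by unfold_locales auto
  have run: "\<exists>tr. implements_enum enum_program F x L tr e ps ls \<and>
      (\<forall>g \<in> set (butlast (waits output_tag tr)). g \<le> ?c * (nvars F * nocc F)) \<and>
      last (waits output_tag tr) \<le> ?c * nocc F \<and> space tr \<le> ?c * nocc F \<and>
      (\<forall>w \<in> words tr. w \<le> ?c * nocc F) \<and>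
      (\<forall>k < length (waits print_tag tr). waits print_tag tr ! k \<le> ?c * ((k + 1) * (nvars F * nocc F)))"
    if "represents_input e ps ls F L" for e ps ls
  proof -
    interpret coded_instance F x L e ps ls using that by unfold_locales
    obtain tr m es where run: "exec enum_program (input_mem e ps ls x F) tr m" "words tr \<subseteq> {..16 * B}"
      "enum F x L es" "list_all2 (emits_event e) (emissions tr) es"
      "\<forall>g\<in>set (butlast (waits output_tag tr)). g \<le> 400 * (nvars F * nocc F)"
      "last (waits output_tag tr) \<le> 400 * nocc F"
      using enum_program_run by blast
    have "implements_enum enum_program F x L tr e ps ls"
      unfolding implements_enum_def using run(1,3,4) by blast
    moreover have "\<forall>g \<in> set (butlast (waits output_tag tr)). g \<le> ?c * (nvars F * nocc F)"
    proof
      fix g assume "g \<in> set (butlast (waits output_tag tr))"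
      then have "g \<le> 400 * (nvars F * nocc F)" using run(5) by blast
      also have "\<dots> \<le> ?c * (nvars F * nocc F)" by (rule mult_le_mono1) simp
      finally show "g \<le> ?c * (nvars F * nocc F)" .
    qed
    moreover have "last (waits output_tag tr) \<le> ?c * nocc F"
      by (rule le_trans[OF run(6)], rule mult_le_mono1) simp
    moreover have "space tr \<le> ?c * nocc F"
    proof -
      have "space tr \<le> card (arrays enum_program) * Suc (16 * B)" by (rule space_le[OF run(1,2)])
      also have "\<dots> \<le> card (arrays enum_program) * (65 * nocc F)"
        using nocc_ge by (intro mult_le_mono2) (simp add: B_def)
      also have "\<dots> \<le> ?c * nocc F" by (simp add: algebra_simps)
      finally show ?thesis .
    qed
    moreover have "\<forall>w \<in> words tr. w \<le> ?c * nocc F"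
    proof
      fix w assume "w \<in> words tr"
      then have "w \<le> 64 * nocc F" using run(2) by (auto simp: B_def)
      also have "\<dots> \<le> ?c * nocc F" by (rule mult_le_mono1) simp
      finally show "w \<le> ?c * nocc F" .
    qed
    moreover have "\<forall>k < length (waits print_tag tr). waits print_tag tr ! k \<le> ?c * ((k + 1) * (nvars F * nocc F))"
    proof (intro allI impI)
      fix k assume k: "k < length (waits print_tag tr)"
      \<comment> \<open>\<open>print_waits\<close> wants one bound for all waits, so the linear
        bound on the final wait is weakened to the quadratic one.\<close>
      have "1 * nocc F \<le> nvars F * nocc F" using nocc_ge by (intro mult_le_mono1) simp
      then have "last (waits output_tag tr) \<le> 400 * (nvars F * nocc F)" using run(6) by linarith
      then have all: "g \<le> 400 * (nvars F * nocc F)"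
        if "g \<in> set (butlast (waits output_tag tr) @ [last (waits output_tag tr)])" for g
        using that run(5) unfolding set_append by auto
      have "\<forall>g\<in>set (waits output_tag tr). g \<le> 400 * (nvars F * nocc F)"
        by (intro ballI all) simp
      from print_waits[OF run(3,4) this k]
      have "waits print_tag tr ! k \<le> 800 * ((k + 1) * (nvars F * nocc F))" by (simp add: algebra_simps)
      also have "\<dots> \<le> ?c * ((k + 1) * (nvars F * nocc F))" by (rule mult_le_mono1) simp
      finally show "waits print_tag tr ! k \<le> ?c * ((k + 1) * (nvars F * nocc F))" .
    qed
    ultimately show ?thesis by blast
  qed
  show "(\<exists>!es. enum F x L es) \<and>
      (\<forall>es. enum F x L es \<longrightarrow>
         distinct (outputs es) \<and> set (outputs es) = nr_paths F x \<and>
         sorted_wrt (pathlex L) (outputs es) \<and>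
         distinct (prints es) \<and> set (prints es) = mus_with x F \<and>
         sorted_wrt (muslex_from L F x) (prints es) \<and>
         sorted_wrt (\<lambda>F' F''. least_unit L F' = x \<and> least_unit L F'' = x \<longrightarrow> muslex L F F' F'')
           (prints es) \<and>
         (\<forall>F'\<in>mus_with x F. \<exists>P. output_prints L P \<and>
            (filter (\<lambda>Q. path_clauses Q = F') (outputs es) = [P] \<or>
             (\<exists>P'. filter (\<lambda>Q. path_clauses Q = F') (outputs es) = [P, P'] \<and>
                   \<not> output_prints L P')))) \<and>
      (\<forall>e ps ls. represents_input e ps ls F L \<longrightarrow>
         (\<exists>tr. implements_enum enum_program F x L tr e ps ls \<and>
            (\<forall>g \<in> set (butlast (waits output_tag tr)). g \<le> ?c * (nvars F * nocc F)) \<and>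
            last (waits output_tag tr) \<le> ?c * nocc F \<and>
            space tr \<le> ?c * nocc F \<and>
            (\<forall>w \<in> words tr. w \<le> ?c * nocc F) \<and>
            (\<forall>k < length (waits print_tag tr).
               waits print_tag tr ! k \<le> ?c * ((k + 1) * (nvars F * nocc F)))))"
    using enum_ex1 enum_correct run by (intro conjI allI impI) blast+
qed

end
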